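(* With $G=\mathrm{Gal}(\mathcal K/k)$ acting on the character lattice $\hat T_{L/k}$, there is an isomorphism $$\mathrm{Sha}^2_{\mathrm{cycl}}(G,\hat T_{L/k})\simeq C(L)/D.$$
   Context: Let $k$ be a field with separable closure $k_s$. Let $p$ be a prime, $n\ge1$, $K$ a cyclic field extension of $k$ of degree $p^n$, $K_i$ ($i\in I$, $I$ finite) finite separable field extensions of $k$, and $L=K\times\prod_{i\in I}K_i$. For $0\le m\le n$ let $K(m)$ be the subfield of $K$ of degree $p^m$ over $k$, $E_i(m)=K(m)K_i$ (compositum in $k_s$), and $[E_i(m):K_i]=p^{e_i(m)}$. Let $\mathcal K$ be a finite Galois extension of $k$ containing $K$ and all $K_i$, $G=\mathrm{Gal}(\mathcal K/k)$, and $G_F$ the subgroup of $G$ fixing an intermediate field $F$. For $1\le m\le n$, $\Gamma_i^m$ is the set of conjugacy classes of $g\in G$ with $\langle g\rangle\cap(G_{E_i(n-m)}\setminus G_{E_i(n-m+1)})\ne\emptyset$ (if nonempty then $e_i(n)-e_i(n-m)=m$). Let $A_m=\prod_{i\in I}\mathbf Z/p^{e_i(n)-e_i(n-m)}\mathbf Z$ (functions $c$ on $I$), $\pi_{n,m}:A_n\to A_m$ componentwise reduction, $C^m=\{c\in A_m: c(i)=c(j)\in\mathbf Z/p^m\mathbf Z \text{ whenever } \Gamma_i^m\cap\Gamma_j^m\ne\emptyset\}$, $C(L)=\{c\in C^n:\pi_{n,m}(c)\in C^m\ \forall\,1\le m\le n\}$, and $D$ the subgroup of $c$ with $c(i)=x\bmod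 p^{e_i(n)}$ for some fixed $x\in\mathbf Z$. $T_{L/k}$ is the norm-one torus, the kernel of $N_{L/k}:R_{L/k}(\mathbb G_m)\to\mathbb G_m$; its character group $\hat T_{L/k}$ is a $G$-lattice. For a finite group $G$ and $G$-lattice $M$, $\mathrm{Sha}^2_{\mathrm{cycl}}(G,M)=\ker\big(H^2(G,M)\to\prod_{g\in G}H^2(\langle g\rangle,M)\big)$. *)

theory Defs
  imports
    "HOL-Algebra.Algebra"
    "HOL-Algebra.Algebraic_Closure_Type"
    "Jordan_Normal_Form.Determinant"
begin

section \<open>Fields inside a separable closure\<close>

text \<open>The separable closure of the base field is the whole type \<open>'a::field\<close>; the base field and
  all its extensions are subsets of it.\<close>

abbreviation ks :: "'a::field ring"
  where "ks \<equiv> ring_of_type_algebra"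

definition separable_over :: "'a::field set \<Rightarrow> 'a \<Rightarrow> bool"
  where "separable_over k x \<longleftrightarrow>
    (\<exists>f::'a poly. f \<noteq> 0 \<and> (\<forall>i. coeff f i \<in> k) \<and> coprime f (pderiv f) \<and> poly f x = 0)"

definition is_separable_closure_of :: "'a::field set \<Rightarrow> bool"
  where "is_separable_closure_of k \<longleftrightarrow>
    subfield k ks \<and> (\<forall>x. separable_over k x) \<and>
    (\<forall>f::'a poly. degree f > 0 \<and> coprime f (pderiv f) \<longrightarrow> (\<exists>x. poly f x = 0))"

definition finite_extension :: "'a::field set \<Rightarrow> 'a set \<Rightarrow> bool"
  where "finite_extension k F \<longleftrightarrow>
    subfield k ks \<and> subfield F ks \<and> k \<subseteq> F \<and> ring.finite_dimension ks k F"

definition finite_separable_extension :: "'a::field set \<Rightarrow> 'a set \<Rightarrow> bool"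
  where "finite_separable_extension k F \<longleftrightarrow>
    finite_extension k F \<and> (\<forall>x\<in>F. separable_over k x)"

definition Gal :: "'a::field set \<Rightarrow> 'a set \<Rightarrow> ('a \<Rightarrow> 'a) monoid"
  where "Gal k F = BijGroup F
    \<lparr>carrier := {\<sigma> \<in> Bij F. \<sigma> \<in> Ring.ring_hom (ks\<lparr>carrier := F\<rparr>) (ks\<lparr>carrier := F\<rparr>) \<and> (\<forall>x\<in>k. \<sigma> x = x)}\<rparr>"

definition finite_galois_extension :: "'a::field set \<Rightarrow> 'a set \<Rightarrow> bool"
  where "finite_galois_extension k F \<longleftrightarrow>
    finite_extension k F \<and> {x \<in> F. \<forall>\<sigma> \<in> carrier (Gal k F). \<sigma> x = x} = k"

definition cyclic_extension :: "'a::field set \<Rightarrow> 'a set \<Rightarrow> nat \<Rightarrow> bool"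
  where "cyclic_extension k F d \<longleftrightarrow>
    finite_galois_extension k F \<and> cyclic_group (Gal k F) \<and> ring.dim ks k F = d"

definition fixing_subgroup :: "('a \<Rightarrow> 'a) monoid \<Rightarrow> 'a set \<Rightarrow> ('a \<Rightarrow> 'a) set"
  where "fixing_subgroup G F = {g \<in> carrier G. \<forall>x\<in>F. g x = x}"


section \<open>Degree two group cohomology\<close>

text \<open>Inhomogeneous cochains of \<open>G\<close> with values in an abelian group \<open>M\<close> (written multiplicatively)
  on which \<open>G\<close> acts through \<open>act\<close>.\<close>

definition C2 :: "'g monoid \<Rightarrow> 'm monoid \<Rightarrow> ('g \<times> 'g \<Rightarrow> 'm) monoid"
  where "C2 G M = product_group (carrier G \<times> carrier G) (\<lambda>_. M)"

definition Z2 :: "'g monoid \<Rightarrow> 'm monoid \<Rightarrow> ('g \<Rightarrow> 'm \<Rightarrow> 'm) \<Rightarrow> ('g \<times> 'g \<Rightarrow> 'm) monoid"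
  where "Z2 G M act = (C2 G M)\<lparr>carrier := {f \<in> carrier (C2 G M).
    \<forall>g\<in>carrier G. \<forall>h\<in>carrier G. \<forall>l\<in>carrier G.
      act g (f (h, l)) \<otimes>\<^bsub>M\<^esub> f (g, h \<otimes>\<^bsub>G\<^esub> l) = f (g \<otimes>\<^bsub>G\<^esub> h, l) \<otimes>\<^bsub>M\<^esub> f (g, h)}\<rparr>"

definition B2 :: "'g monoid \<Rightarrow> 'm monoid \<Rightarrow> ('g \<Rightarrow> 'm \<Rightarrow> 'm) \<Rightarrow> ('g \<times> 'g \<Rightarrow> 'm) set"
  where "B2 G M act =
    (\<lambda>\<phi>. \<lambda>(g, h) \<in> carrier G \<times> carrier G.
        act g (\<phi> h) \<otimes>\<^bsub>M\<^esub> inv\<^bsub>M\<^esub> (\<phi> (g \<otimes>\<^bsub>G\<^esub> h)) \<otimes>\<^bsub>M\<^esub> \<phi> g)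
      ` (carrier G \<rightarrow>\<^sub>E carrier M)"

definition H2 :: "'g monoid \<Rightarrow> 'm monoid \<Rightarrow> ('g \<Rightarrow> 'm \<Rightarrow> 'm) \<Rightarrow> ('g \<times> 'g \<Rightarrow> 'm) set monoid"
  where "H2 G M act = Z2 G M act Mod B2 G M act"

text \<open>All representatives \<open>f\<close> of a class \<open>\<xi>\<close> restrict to the same coset of \<open>B2 H\<close>, so
  the union below is that single coset.\<close>

definition res2 :: "'g monoid \<Rightarrow> 'm monoid \<Rightarrow> ('g \<Rightarrow> 'm \<Rightarrow> 'm) \<Rightarrow> 'g set \<Rightarrow>
    ('g \<times> 'g \<Rightarrow> 'm) set \<Rightarrow> ('g \<times> 'g \<Rightarrow> 'm) set"
  where "res2 G M act H \<xi> =
    (\<Union>f\<in>\<xi>. r_coset (Z2 (G\<lparr>carrier := H\<rparr>) M act) (B2 (G\<lparr>carrier := H\<rparr>) M act) (restrict f (H \<times> H)))"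

definition Sha2_cycl :: "'g monoid \<Rightarrow> 'm monoid \<Rightarrow> ('g \<Rightarrow> 'm \<Rightarrow> 'm) \<Rightarrow> ('g \<times> 'g \<Rightarrow> 'm) set monoid"
  where "Sha2_cycl G M act = (H2 G M act)\<lparr>carrier :=
    kernel (H2 G M act)
      (product_group (carrier G) (\<lambda>g. H2 (G\<lparr>carrier := generate G {g}\<rparr>) M act))
      (\<lambda>\<xi>. \<lambda>g\<in>carrier G. res2 G M act (generate G {g}) \<xi>)\<rparr>"


section \<open>The norm-one torus and its characters\<close>

text \<open>\<open>J\<close> is a finite index set and \<open>L\<close> is the algebra of functions \<open>\<Pi>\<^sub>E j\<in>J. F j\<close> with pointwise
  operations. A \<open>k\<close>-basis \<open>b\<close> of \<open>L\<close> identifies \<open>L \<otimes>\<^sub>k k\<^sub>s\<close> with the \<open>k\<^sub>s\<close>-algebra of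
  \<open>d \<times> d\<close> matrices spanned by the regular representation of \<open>L\<close>, so that \<open>R\<^bsub>L/k\<^esub>(\<bbbG>\<^sub>m)\<close> becomes
  a closed subgroup of \<open>GL\<^sub>d\<close> and the norm becomes the determinant. As these groups are smooth and
  \<open>k\<^sub>s\<close> is separably closed, they are given by their \<open>k\<^sub>s\<close>-points, and
  their morphisms over \<open>k\<^sub>s\<close> are the maps on \<open>k\<^sub>s\<close>-points given by regular functions.\<close>

definition lincomb :: "'j set \<Rightarrow> ('j \<Rightarrow> 'a::field) list \<Rightarrow> (nat \<Rightarrow> 'a) \<Rightarrow> 'j \<Rightarrow> 'a"
  where "lincomb J b c = (\<lambda>j\<in>J. \<Sum>r<length b. c r * (b ! r) j)"

definition is_basis :: "'a::field set \<Rightarrow> 'j set \<Rightarrow> ('j \<Rightarrow> 'a) set \<Rightarrow> ('j \<Rightarrow> 'a) list \<Rightarrow> bool"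
  where "is_basis k J L b \<longleftrightarrow>
    set b \<subseteq> L \<and> (\<forall>x\<in>L. \<exists>!c. c \<in> {..<length b} \<rightarrow>\<^sub>E k \<and> x = lincomb J b c)"

definition coords :: "'a::field set \<Rightarrow> 'j set \<Rightarrow> ('j \<Rightarrow> 'a) list \<Rightarrow> ('j \<Rightarrow> 'a) \<Rightarrow> nat \<Rightarrow> 'a"
  where "coords k J b x = (THE c. c \<in> {..<length b} \<rightarrow>\<^sub>E k \<and> x = lincomb J b c)"

definition mult_matrix :: "'a::field set \<Rightarrow> 'j set \<Rightarrow> ('j \<Rightarrow> 'a) list \<Rightarrow> ('j \<Rightarrow> 'a) \<Rightarrow> 'a mat"
  where "mult_matrix k J b x = mat (length b) (length b)
    (\<lambda>(r, s). coords k J b (\<lambda>j\<in>J. x j * (b ! s) j) r)"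

text \<open>Multiplication by \<open>\<Sum>\<^sub>r b\<^sub>r \<otimes> c\<^sub>r\<close> on \<open>L \<otimes>\<^sub>k k\<^sub>s\<close>, in the basis \<open>b\<^sub>r \<otimes> 1\<close>.\<close>

definition tensor_mult_matrix ::
    "'a::field set \<Rightarrow> 'j set \<Rightarrow> ('j \<Rightarrow> 'a) list \<Rightarrow> (nat \<Rightarrow> 'a) \<Rightarrow> 'a mat"
  where "tensor_mult_matrix k J b c = mat (length b) (length b)
    (\<lambda>(u, v). \<Sum>r<length b. c r * mult_matrix k J b (b ! r) $$ (u, v))"

definition weil_Gm :: "'a::field set \<Rightarrow> 'j set \<Rightarrow> ('j \<Rightarrow> 'a) list \<Rightarrow> 'a mat monoid"
  where "weil_Gm k J b =
    \<lparr>carrier = {A \<in> range (tensor_mult_matrix k J b). det A \<noteq> 0},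
     monoid.mult = (*), one = 1\<^sub>m (length b)\<rparr>"

definition norm_one_torus :: "'a::field set \<Rightarrow> 'j set \<Rightarrow> ('j \<Rightarrow> 'a) list \<Rightarrow> 'a mat monoid"
  where "norm_one_torus k J b =
    (weil_Gm k J b)\<lparr>carrier := kernel (weil_Gm k J b) (mult_of ks) det\<rparr>"

inductive_set regular_GL :: "nat \<Rightarrow> ('a::field mat \<Rightarrow> 'a) set" for d :: nat
  where
    const: "(\<lambda>_. a) \<in> regular_GL d"
  | entry: "\<lbrakk>u < d; v < d\<rbrakk> \<Longrightarrow> (\<lambda>A. A $$ (u, v)) \<in> regular_GL d"
  | inv_det: "(\<lambda>A. inverse (det A)) \<in> regular_GL d"
  | add: "\<lbrakk>f \<in> regular_GL d; g \<in> regular_GL d\<rbrakk> \<Longrightarrow> (\<lambda>A. f A + g A) \<in> regular_GL d"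
  | mult: "\<lbrakk>f \<in> regular_GL d; g \<in> regular_GL d\<rbrakk> \<Longrightarrow> (\<lambda>A. f A * g A) \<in> regular_GL d"

text \<open>The group of characters of a closed subgroup \<open>T\<close> of \<open>GL\<^sub>d\<close>; the ambient
  \<open>product_group\<close> consists of all maps from \<open>T\<close> to \<open>k\<^sub>s\<^sup>\<times>\<close> under pointwise multiplication.\<close>

definition characters :: "nat \<Rightarrow> 'a::field mat monoid \<Rightarrow> ('a mat \<Rightarrow> 'a) monoid"
  where "characters d T = (product_group (carrier T) (\<lambda>_. mult_of ks))
    \<lparr>carrier := {\<chi> \<in> hom T (mult_of ks). \<exists>f \<in> regular_GL d. \<chi> = restrict f (carrier T)}\<rparr>"

text \<open>The action \<open>(\<sigma>\<chi>)(t) = \<sigma>(\<chi>(\<sigma>\<^sup>-\<^sup>1 t))\<close> of the absolute Galois group. When all characters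
  are defined over \<open>\<K>\<close>, as for the tori considered here, it factors through \<open>Gal(\<K>/k)\<close>, so the
  choice of the lift \<open>\<sigma>\<close> of \<open>g\<close> is irrelevant.\<close>

definition character_action ::
    "'a::field set \<Rightarrow> 'a set \<Rightarrow> 'a mat monoid \<Rightarrow> ('a \<Rightarrow> 'a) \<Rightarrow> ('a mat \<Rightarrow> 'a) \<Rightarrow> 'a mat \<Rightarrow> 'a"
  where "character_action k \<K> T g \<chi> =
    (let \<sigma> = (SOME \<sigma>. \<sigma> \<in> carrier (Gal k UNIV) \<and> restrict \<sigma> \<K> = g)
     in (\<lambda>A\<in>carrier T. \<sigma> (\<chi> (map_mat (inv_into UNIV \<sigma>) A))))"


section \<open>The group \<open>C(L)/D\<close>\<close>

definition subext :: "'a::field set \<Rightarrow> 'a set \<Rightarrow> nat \<Rightarrow> nat \<Rightarrow> 'a set"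
  where "subext k K p m =
    (THE F. subfield F ks \<and> k \<subseteq> F \<and> F \<subseteq> K \<and> ring.dim ks k F = p ^ m)"

text \<open>\<open>compositum k K p F m\<close> is the compositum of \<open>K(m)\<close> and \<open>F\<close>, and \<open>e_exp k K p F m\<close> the exponent of
  its degree over \<open>F\<close>.\<close>

definition compositum :: "'a::field set \<Rightarrow> 'a set \<Rightarrow> nat \<Rightarrow> 'a set \<Rightarrow> nat \<Rightarrow> 'a set"
  where "compositum k K p F m = generate_field ks (subext k K p m \<union> F)"

definition e_exp :: "'a::field set \<Rightarrow> 'a set \<Rightarrow> nat \<Rightarrow> 'a set \<Rightarrow> nat \<Rightarrow> nat"
  where "e_exp k K p F m = (THE r. ring.dim ks F (compositum k K p F m) = p ^ r)"

definition conj_class :: "'g monoid \<Rightarrow> 'g \<Rightarrow> 'g set"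
  where "conj_class G g = (\<lambda>h. h \<otimes>\<^bsub>G\<^esub> g \<otimes>\<^bsub>G\<^esub> inv\<^bsub>G\<^esub> h) ` carrier G"

definition Gam :: "'a::field set \<Rightarrow> 'a set \<Rightarrow> 'a set \<Rightarrow> nat \<Rightarrow> nat \<Rightarrow> 'a set \<Rightarrow> nat \<Rightarrow> ('a \<Rightarrow> 'a) set set"
  where "Gam k \<K> K p n F m = (let G = Gal k \<K> in
    {conj_class G g | g. g \<in> carrier G \<and>
       generate G {g} \<inter>
         (fixing_subgroup G (compositum k K p F (n - m))
            - fixing_subgroup G (compositum k K p F (n - m + 1))) \<noteq> {}})"

context
  fixes k \<K> K :: "'a::field set" and p n :: nat and I :: "'i set" and Ki :: "'i \<Rightarrow> 'a set"
begin

definition A_exp :: "nat \<Rightarrow> 'i \<Rightarrow> nat"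
  where "A_exp m i = e_exp k K p (Ki i) n - e_exp k K p (Ki i) (n - m)"

definition A_group :: "nat \<Rightarrow> ('i \<Rightarrow> int) monoid"
  where "A_group m = product_group I (\<lambda>i. integer_mod_group (p ^ A_exp m i))"

definition reduction :: "nat \<Rightarrow> ('i \<Rightarrow> int) \<Rightarrow> 'i \<Rightarrow> int"
  where "reduction m c = (\<lambda>i\<in>I. c i mod int (p ^ A_exp m i))"

text \<open>The residues \<open>c i\<close> and \<open>c j\<close> are represented by integers in \<open>{0..<p ^ A_exp m i}\<close> and
  \<open>{0..<p ^ A_exp m j}\<close>. Both exponents equal \<open>m\<close> when the sets \<open>\<Gamma>\<close> for \<open>i\<close> and \<open>j\<close> meet, so
  equality of these integers is equality in \<open>\<int>/p\<^sup>m\<int>\<close>.\<close>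

definition C_level :: "nat \<Rightarrow> ('i \<Rightarrow> int) set"
  where "C_level m = {c \<in> carrier (A_group m). \<forall>i\<in>I. \<forall>j\<in>I.
    Gam k \<K> K p n (Ki i) m \<inter> Gam k \<K> K p n (Ki j) m \<noteq> {} \<longrightarrow> c i = c j}"

definition C_L :: "('i \<Rightarrow> int) monoid"
  where "C_L = (A_group n)\<lparr>carrier := {c \<in> C_level n. \<forall>m\<in>{1..n}. reduction m c \<in> C_level m}\<rparr>"

definition D_L :: "('i \<Rightarrow> int) set"
  where "D_L = range (\<lambda>x::int. \<lambda>i\<in>I. x mod int (p ^ e_exp k K p (Ki i) n))"

end

end

theory Submission
  imports Defs
begin

text \<open>By independence of characters, every character of the norm-one torus is a monomial in the
  eigenvalues of the multiplication matrices, unique up to powers of the norm. So the character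
  lattice is \<open>\<int>[S]/\<int>\<close>, where \<open>S\<close> is the \<open>G\<close>-set of embeddings of the factors of \<open>L\<close>.

  A two-cocycle with values in \<open>\<int>[S]/\<int>\<close> becomes trivial over \<open>\<rat>\<close>. Let \<open>lam\<close> be the character of \<open>G\<close>
  modulo \<open>p\<^sup>n\<close> with kernel \<open>G\<^sub>K\<close>. Triviality on the cyclic subgroups allows to normalise the rational
  trivialisation so that its restriction to the stabiliser of each \<open>s \<in> S\<close> is a multiple
  \<open>u s * lam / p\<^sup>n\<close> modulo \<open>\<int>\<close>, for a \<open>G\<close>-invariant \<open>u\<close> vanishing on the embeddings of \<open>K\<close>.
  Conversely every such \<open>u\<close> defines a class, which is trivial on a subgroup \<open>H\<close> if and only if there is
  an integer \<open>x\<close> such that \<open>p\<^sup>n\<close> divides \<open>lam h * (u s - x)\<close> whenever \<open>h \<in> H\<close> fixes \<open>s\<close>.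

  If \<open>u\<close> has value \<open>c i\<close> on the embeddings of \<open>K\<^sub>i\<close>, then for \<open>H = G\<close> this says that \<open>c i\<close> is congruent to
  \<open>x\<close> modulo \<open>p\<close> to the power \<open>e\<^sub>i(n)\<close>, which gives \<open>D\<close>. For \<open>H = \<langle>g\<rangle>\<close>, taking for \<open>x\<close> the value \<open>c i\<close> at a pair
  \<open>(i, h)\<close> with \<open>lam h\<close> of least valuation shows that it amounts to the congruences between the \<open>c i\<close>
  indexed by the \<open>\<Gamma>\<^sub>i\<^sup>m\<close>, which gives \<open>C(L)\<close>.\<close>

section \<open>Two-cocycles with values in a quotient of a permutation lattice\<close>

text \<open>The lattice is a quotient by constants, so every cochain identity holds only up to a
  term independent of \<open>s\<close>, and these unknown constants keep a rational trivialisation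
  from being a one-cocycle modulo Z. The factor \<open>K\<close> of \<open>L\<close> removes them:
  its inclusion is a point \<open>s\<^sub>0\<close> at which values can be subtracted, and the
  stabiliser of this point is exactly the kernel of \<open>lam\<close>. An element of the kernel
  that fixes another point \<open>s\<close> fixes \<open>s\<^sub>0\<close> as well, and local
  triviality on its cyclic group compares the two points. Hence the characters of the stabilisers
  vanish on the kernel; this is why only multiples of \<open>lam / p^n\<close> occur and why a class
  is encoded by one integer for each \<open>K\<^sub>i\<close>.

  The prime power matters because the subgroups of Z/p^n form a chain. An element of least valuation
  acquires any larger valuation after passing to a power, so pairwise congruences already produce a
  common \<open>x\<close>. Divisibility of integers is used in place of residue classes, since the
  moduli differ from one \<open>i\<close> to another.\<close>

lemma divide_shift:
  fixes n :: "'a::field"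
  assumes "n \<noteq> 0" and "A + C = B + n * f + K"
  shows "f = A / n - B / n + C / n + - K / n"
proof -
  have *: "A - B + C - K = (A + C) - B - K" by simp
  have "n * f = A - B + C - K" unfolding * assms(2) by simp
  then have "f = (A - B + C - K) / n" using assms(1) by (metis nonzero_mult_div_cancel_left)
  then show ?thesis by (simp add: add_divide_distrib diff_divide_distrib)
qed

text \<open>\<open>M\<close> consists of integer functions on \<open>S\<close> modulo constants,
  presented by the quotient map \<open>q\<close>, which only sees values on \<open>S\<close>.
  Calculating with functions in front of \<open>q\<close> turns the multiplicative cochains of
  \<open>C2\<close> into integer arithmetic.\<close>

locale quotient_lattice = group G for G :: "'g monoid" (structure) +
  fixes S :: "'s set" and star :: "'g \<Rightarrow> 's \<Rightarrow> 's" (infixr "\<star>" 75)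
    and M :: "'m monoid" and act :: "'g \<Rightarrow> 'm \<Rightarrow> 'm" and q :: "('s \<Rightarrow> int) \<Rightarrow> 'm"
  assumes finite_G: "finite (carrier G)"
    and star_closed: "g \<in> carrier G \<Longrightarrow> s \<in> S \<Longrightarrow> g \<star> s \<in> S"
    and star_one: "s \<in> S \<Longrightarrow> \<one> \<star> s = s"
    and star_mult: "g \<in> carrier G \<Longrightarrow> h \<in> carrier G \<Longrightarrow> s \<in> S \<Longrightarrow> (g \<otimes> h) \<star> s = g \<star> h \<star> s"
    and comm_M: "comm_group M"
    and q_closed: "q a \<in> carrier M"
    and q_surj: "x \<in> carrier M \<Longrightarrow> \<exists>a. x = q a"
    and q_add: "q (\<lambda>s. a s + b s) = q a \<otimes>\<^bsub>M\<^esub> q b"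
    and q_eq_one: "q a = \<one>\<^bsub>M\<^esub> \<longleftrightarrow> (\<exists>c. \<forall>s\<in>S. a s = c)"
    and act_q: "g \<in> carrier G \<Longrightarrow> act g (q a) = q (\<lambda>s. a (inv g \<star> s))"
begin

sublocale M: comm_group M by (rule comm_M)

text \<open>Local conditions concern subgroups \<open>H\<close>; instantiating the locale again for
  \<open>H\<close> makes every result about \<open>G\<close> available there.\<close>

lemma quotient_lattice_subgroup:
  assumes "subgroup H G"
  shows "quotient_lattice (G\<lparr>carrier := H\<rparr>) S star M act q"
proof -
  have HG: "h \<in> carrier G" if "h \<in> H" for h
    using assms that subgroup.mem_carrier by fast
  have inv: "inv\<^bsub>G\<lparr>carrier := H\<rparr>\<^esub> h = inv h" if "h \<in> H" for h
    using m_inv_consistent[OF assms that] .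
  have "group (G\<lparr>carrier := H\<rparr>)"
    using assms by (rule subgroup.subgroup_is_group) (rule group_axioms)
  moreover have "finite H"
    using finite_G assms finite_subset subgroup.subset by blast
  ultimately show ?thesis
    unfolding quotient_lattice_def quotient_lattice_axioms_def
    using HG inv star_closed star_one star_mult comm_M q_closed q_surj q_add q_eq_one act_q
    by auto
qed

lemma q_minus: "q (\<lambda>s. a s - b s) = q a \<otimes>\<^bsub>M\<^esub> inv\<^bsub>M\<^esub> q b"
proof -
  have "q (\<lambda>s. a s - b s) \<otimes>\<^bsub>M\<^esub> q b = q a"
    by (simp flip: q_add)
  then show ?thesis
    using q_closed by (simp add: M.inv_solve_right)
qed

lemma q_uminus: "q (\<lambda>s. - b s) = inv\<^bsub>M\<^esub> q b"
proof -
  have "q (\<lambda>s. 0) = \<one>\<^bsub>M\<^esub>" by (simp add: q_eq_one)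
  then show ?thesis using q_minus[of "\<lambda>s. 0" b] q_closed by simp
qed

lemma q_eq_iff: "q a = q b \<longleftrightarrow> (\<exists>c. \<forall>s\<in>S. a s = b s + c)"
proof -
  have "q a = q b \<longleftrightarrow> q (\<lambda>s. a s - b s) = \<one>\<^bsub>M\<^esub>"
    using q_closed by (auto simp: q_minus M.inv_solve_right')
  also have "\<dots> \<longleftrightarrow> (\<exists>c. \<forall>s\<in>S. a s = b s + c)"
    unfolding q_eq_one by (simp add: algebra_simps)
  finally show ?thesis .
qed

lemma star_inv_star [simp]: "g \<in> carrier G \<Longrightarrow> s \<in> S \<Longrightarrow> inv g \<star> g \<star> s = s"
  "g \<in> carrier G \<Longrightarrow> s \<in> S \<Longrightarrow> g \<star> inv g \<star> s = s"
  by (simp_all flip: star_mult add: star_one)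

lemma inv_mult_star:
  "g \<in> carrier G \<Longrightarrow> h \<in> carrier G \<Longrightarrow> s \<in> S \<Longrightarrow> inv (g \<otimes> h) \<star> s = inv h \<star> inv g \<star> s"
  by (simp add: inv_mult_group star_mult)

lemma act_closed: "g \<in> carrier G \<Longrightarrow> x \<in> carrier M \<Longrightarrow> act g x \<in> carrier M"
  using q_surj act_q q_closed by metis

lemma group_C2: "group (C2 G M)"
  unfolding C2_def by simp

lemma carrier_Z2: "f \<in> carrier (Z2 G M act) \<longleftrightarrow>
    f \<in> (carrier G \<times> carrier G) \<rightarrow>\<^sub>E carrier M \<and> (\<forall>g\<in>carrier G. \<forall>h\<in>carrier G. \<forall>l\<in>carrier G.
      act g (f (h, l)) \<otimes>\<^bsub>M\<^esub> f (g, h \<otimes> l) = f (g \<otimes> h, l) \<otimes>\<^bsub>M\<^esub> f (g, h))"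
  by (simp add: Z2_def C2_def)

lemma mult_Z2: "monoid.mult (Z2 G M act) = (\<lambda>x y. \<lambda>i\<in>carrier G \<times> carrier G. x i \<otimes>\<^bsub>M\<^esub> y i)"
  by (simp add: Z2_def C2_def)

text \<open>Cochains are handled through integer-valued lifts. Equality in \<open>M\<close> becomes
  equality up to a function of the group elements alone, the \<open>\<kappa>\<close> of the
  following lemmas.\<close>

definition cochain :: "('g \<Rightarrow> 'g \<Rightarrow> 's \<Rightarrow> int) \<Rightarrow> 'g \<times> 'g \<Rightarrow> 'm"
  where "cochain f = (\<lambda>(g, h) \<in> carrier G \<times> carrier G. q (f g h))"

lemma cochain_eq_iff:
  "cochain f = cochain f' \<longleftrightarrow> (\<exists>\<kappa>. \<forall>g\<in>carrier G. \<forall>h\<in>carrier G. \<forall>s\<in>S. f g h s = f' g h s + \<kappa> g h)"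
proof
  assume eq: "cochain f = cochain f'"
  have "\<exists>c. \<forall>s\<in>S. f g h s = f' g h s + c" if "g \<in> carrier G" "h \<in> carrier G" for g h
    using fun_cong[OF eq, of "(g, h)"] that by (simp add: cochain_def q_eq_iff)
  then show "\<exists>\<kappa>. \<forall>g\<in>carrier G. \<forall>h\<in>carrier G. \<forall>s\<in>S. f g h s = f' g h s + \<kappa> g h"
    by metis
next
  assume "\<exists>\<kappa>. \<forall>g\<in>carrier G. \<forall>h\<in>carrier G. \<forall>s\<in>S. f g h s = f' g h s + \<kappa> g h"
  then show "cochain f = cochain f'"
    unfolding cochain_def by (intro restrict_ext) (auto simp: q_eq_iff)
qed

lemma cochain_mult:
  "monoid.mult (Z2 G M act) (cochain f) (cochain f') = cochain (\<lambda>g h s. f g h s + f' g h s)"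
  unfolding mult_Z2 cochain_def by (intro restrict_ext) (auto simp: q_add)

lemma cochain_in_Z2_iff: "cochain f \<in> carrier (Z2 G M act) \<longleftrightarrow>
  (\<exists>\<kappa>. \<forall>g\<in>carrier G. \<forall>h\<in>carrier G. \<forall>l\<in>carrier G. \<forall>s\<in>S.
     f h l (inv g \<star> s) + f g (h \<otimes> l) s = f (g \<otimes> h) l s + f g h s + \<kappa> g h l)"
proof -
  have "cochain f \<in> carrier (Z2 G M act) \<longleftrightarrow>
    (\<forall>g\<in>carrier G. \<forall>h\<in>carrier G. \<forall>l\<in>carrier G. \<exists>c. \<forall>s\<in>S.
     f h l (inv g \<star> s) + f g (h \<otimes> l) s = f (g \<otimes> h) l s + f g h s + c)"
    unfolding carrier_Z2 by (auto simp: cochain_def q_closed act_q q_eq_iff simp flip: q_add)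
  then show ?thesis by metis
qed

lemma cochain_surj:
  assumes "f \<in> (carrier G \<times> carrier G) \<rightarrow>\<^sub>E carrier M"
  shows "\<exists>f'. f = cochain f'"
proof -
  have "\<forall>g h. \<exists>a. g \<in> carrier G \<and> h \<in> carrier G \<longrightarrow> f (g, h) = q a"
    using assms q_surj by blast
  then obtain f' where "\<And>g h. g \<in> carrier G \<Longrightarrow> h \<in> carrier G \<Longrightarrow> f (g, h) = q (f' g h)"
    by metis
  then have "f = cochain f'"
    using assms by (auto simp: cochain_def PiE_def extensional_def fun_eq_iff)
  then show ?thesis by blast
qed

lemma cochain_in_B2_iff: "cochain f \<in> B2 G M act \<longleftrightarrow>
  (\<exists>\<phi> \<kappa>. \<forall>g\<in>carrier G. \<forall>h\<in>carrier G. \<forall>s\<in>S.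
     f g h s = \<phi> h (inv g \<star> s) - \<phi> (g \<otimes> h) s + \<phi> g s + \<kappa> g h)"
proof -
  have cob: "(\<lambda>(g, h) \<in> carrier G \<times> carrier G.
        act g (\<psi> h) \<otimes>\<^bsub>M\<^esub> inv\<^bsub>M\<^esub> (\<psi> (g \<otimes>\<^bsub>G\<^esub> h)) \<otimes>\<^bsub>M\<^esub> \<psi> g)
     = cochain (\<lambda>g h s. \<phi> h (inv g \<star> s) - \<phi> (g \<otimes> h) s + \<phi> g s)"
    if "\<And>g. g \<in> carrier G \<Longrightarrow> \<psi> g = q (\<phi> g)" for \<psi> \<phi>
    unfolding cochain_def by (intro restrict_ext) (auto simp: that act_q q_minus q_add)
  show ?thesis
  proof
    assume "cochain f \<in> B2 G M act"
    then obtain \<psi> where \<psi>: "\<psi> \<in> carrier G \<rightarrow>\<^sub>E carrier M" "cochain f = (\<lambda>(g, h) \<in> carrier G \<times> carrier G.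
        act g (\<psi> h) \<otimes>\<^bsub>M\<^esub> inv\<^bsub>M\<^esub> (\<psi> (g \<otimes>\<^bsub>G\<^esub> h)) \<otimes>\<^bsub>M\<^esub> \<psi> g)"
      unfolding B2_def by blast
    from \<psi>(1) have "\<forall>g. \<exists>a. g \<in> carrier G \<longrightarrow> \<psi> g = q a"
      using q_surj by blast
    then obtain \<phi> where "\<And>g. g \<in> carrier G \<Longrightarrow> \<psi> g = q (\<phi> g)" by metis
    from cob[OF this] \<psi>(2)
    have "cochain f = cochain (\<lambda>g h s. \<phi> h (inv g \<star> s) - \<phi> (g \<otimes> h) s + \<phi> g s)" by simp
    then show "\<exists>\<phi> \<kappa>. \<forall>g\<in>carrier G. \<forall>h\<in>carrier G. \<forall>s\<in>S.
     f g h s = \<phi> h (inv g \<star> s) - \<phi> (g \<otimes> h) s + \<phi> g s + \<kappa> g h"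
      unfolding cochain_eq_iff by blast
  next
    assume "\<exists>\<phi> \<kappa>. \<forall>g\<in>carrier G. \<forall>h\<in>carrier G. \<forall>s\<in>S.
     f g h s = \<phi> h (inv g \<star> s) - \<phi> (g \<otimes> h) s + \<phi> g s + \<kappa> g h"
    then obtain \<phi> where *: "cochain f = cochain (\<lambda>g h s. \<phi> h (inv g \<star> s) - \<phi> (g \<otimes> h) s + \<phi> g s)"
      unfolding cochain_eq_iff by blast
    have "(\<lambda>g\<in>carrier G. q (\<phi> g)) \<in> carrier G \<rightarrow>\<^sub>E carrier M"
      using q_closed by auto
    moreover have "cochain f = (\<lambda>(g, h) \<in> carrier G \<times> carrier G.
        act g ((\<lambda>g\<in>carrier G. q (\<phi> g)) h) \<otimes>\<^bsub>M\<^esub> inv\<^bsub>M\<^esub> ((\<lambda>g\<in>carrier G. q (\<phi> g)) (g \<otimes>\<^bsub>G\<^esub> h))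
        \<otimes>\<^bsub>M\<^esub> (\<lambda>g\<in>carrier G. q (\<phi> g)) g)"
      unfolding * by (intro cob[symmetric]) auto
    ultimately show "cochain f \<in> B2 G M act"
      unfolding B2_def by blast
  qed
qed

lemma B2_subset_C2: "B2 G M act \<subseteq> carrier (C2 G M)"
  unfolding B2_def C2_def by (auto simp: act_closed PiE_iff)

lemma B2_subset_Z2: "B2 G M act \<subseteq> carrier (Z2 G M act)"
proof
  fix f assume f: "f \<in> B2 G M act"
  then have "f \<in> carrier (C2 G M)" using B2_subset_C2 by blast
  then obtain f' where f': "f = cochain f'" using cochain_surj by (auto simp: C2_def)
  from f obtain \<phi> \<kappa> where "\<And>g h s. g \<in> carrier G \<Longrightarrow> h \<in> carrier G \<Longrightarrow> s \<in> S \<Longrightarrow>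
     f' g h s = \<phi> h (inv g \<star> s) - \<phi> (g \<otimes> h) s + \<phi> g s + \<kappa> g h"
    unfolding f' cochain_in_B2_iff by blast
  then show "f \<in> carrier (Z2 G M act)"
    unfolding f' cochain_in_Z2_iff
    \<comment> \<open>Constants are fixed by the action, so the defect is the coboundary of
      \<open>\<kappa>\<close> for the trivial action.\<close>
    by (intro exI[of _ "\<lambda>g h l. \<kappa> h l + \<kappa> g (h \<otimes> l) - \<kappa> (g \<otimes> h) l - \<kappa> g h"] ballI)
       (simp add: star_closed inv_mult_star m_assoc)
qed

lemma cochain_inv_C2: "inv\<^bsub>C2 G M\<^esub> (cochain f) = cochain (\<lambda>g h s. - f g h s)"
proof -
  have "cochain f \<in> (\<Pi>\<^sub>E i\<in>carrier G \<times> carrier G. carrier M)"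
    by (auto simp: cochain_def q_closed)
  then have "inv\<^bsub>C2 G M\<^esub> (cochain f) = (\<lambda>i\<in>carrier G \<times> carrier G. inv\<^bsub>M\<^esub> cochain f i)"
    unfolding C2_def by (intro inv_product_group) auto
  also have "\<dots> = cochain (\<lambda>g h s. - f g h s)"
    unfolding cochain_def by (intro restrict_ext) (auto simp: q_uminus)
  finally show ?thesis .
qed

text \<open>Inverses in the function group are negated lifts, so closure under differences of lifts
  suffices; cocycles and coboundaries are both treated this way.\<close>

lemma subgroup_C2I:
  assumes "U \<subseteq> carrier (C2 G M)" "cochain (\<lambda>_ _ _. 0) \<in> U"
    and "\<And>f f'. cochain f \<in> U \<Longrightarrow> cochain f' \<in> U \<Longrightarrow> cochain (\<lambda>g h s. f g h s - f' g h s) \<in> U"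
  shows "subgroup U (C2 G M)"
proof -
  interpret C: group "C2 G M" by (rule group_C2)
  have m: "cochain f \<otimes>\<^bsub>C2 G M\<^esub> cochain f' = cochain (\<lambda>g h s. f g h s + f' g h s)" for f f'
    using cochain_mult by (simp add: Z2_def)
  have inv: "inv\<^bsub>C2 G M\<^esub> x \<in> U" if "x \<in> U" for x
  proof -
    have "x \<in> carrier (C2 G M)" using assms(1) that by blast
    then obtain f where "x = cochain f" using cochain_surj by (auto simp: C2_def)
    then show ?thesis using assms(3)[OF assms(2), of f] that by (simp add: cochain_inv_C2)
  qed
  show ?thesis
  proof (rule C.subgroupI)
    fix x y assume xy: "x \<in> U" "y \<in> U"
    then obtain f f' where "x = cochain f" "y = cochain f'"
      using assms(1) cochain_surj by (force simp: C2_def)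
    then show "x \<otimes>\<^bsub>C2 G M\<^esub> y \<in> U"
      using assms(3)[of f "\<lambda>g h s. - f' g h s"] inv[OF xy(2)] xy by (simp add: m cochain_inv_C2)
  qed (use assms inv in auto)
qed

lemma subgroup_Z2: "subgroup (carrier (Z2 G M act)) (C2 G M)"
proof (rule subgroup_C2I)
  fix f f' assume "cochain f \<in> carrier (Z2 G M act)" "cochain f' \<in> carrier (Z2 G M act)"
  then obtain \<kappa> \<kappa>' where "\<forall>g\<in>carrier G. \<forall>h\<in>carrier G. \<forall>l\<in>carrier G. \<forall>s\<in>S.
     f h l (inv g \<star> s) + f g (h \<otimes> l) s = f (g \<otimes> h) l s + f g h s + \<kappa> g h l"
     "\<forall>g\<in>carrier G. \<forall>h\<in>carrier G. \<forall>l\<in>carrier G. \<forall>s\<in>S.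
     f' h l (inv g \<star> s) + f' g (h \<otimes> l) s = f' (g \<otimes> h) l s + f' g h s + \<kappa>' g h l"
    unfolding cochain_in_Z2_iff by blast
  then show "cochain (\<lambda>g h s. f g h s - f' g h s) \<in> carrier (Z2 G M act)"
    unfolding cochain_in_Z2_iff
    by (intro exI[of _ "\<lambda>g h l. \<kappa> g h l - \<kappa>' g h l"] ballI) (smt (verit))
next
  show "cochain (\<lambda>_ _ _. 0) \<in> carrier (Z2 G M act)"
    unfolding cochain_in_Z2_iff by (intro exI[of _ "\<lambda>_ _ _. 0"]) simp
qed (auto simp: Z2_def)

lemma subgroup_B2_C2: "subgroup (B2 G M act) (C2 G M)"
proof (rule subgroup_C2I[OF B2_subset_C2])
  fix f f' assume "cochain f \<in> B2 G M act" "cochain f' \<in> B2 G M act"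
  then obtain \<phi> \<kappa> \<phi>' \<kappa>' where "\<forall>g\<in>carrier G. \<forall>h\<in>carrier G. \<forall>s\<in>S.
     f g h s = \<phi> h (inv g \<star> s) - \<phi> (g \<otimes> h) s + \<phi> g s + \<kappa> g h"
     "\<forall>g\<in>carrier G. \<forall>h\<in>carrier G. \<forall>s\<in>S.
     f' g h s = \<phi>' h (inv g \<star> s) - \<phi>' (g \<otimes> h) s + \<phi>' g s + \<kappa>' g h"
    unfolding cochain_in_B2_iff by blast
  then show "cochain (\<lambda>g h s. f g h s - f' g h s) \<in> B2 G M act"
    unfolding cochain_in_B2_iff
    by (intro exI[of _ "\<lambda>g s. \<phi> g s - \<phi>' g s"] exI[of _ "\<lambda>g h. \<kappa> g h - \<kappa>' g h"] ballI)
      (smt (verit))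
next
  show "cochain (\<lambda>_ _ _. 0) \<in> B2 G M act"
    unfolding cochain_in_B2_iff by (intro exI[of _ "\<lambda>_ _. 0"]) auto
qed

lemma comm_group_Z2: "comm_group (Z2 G M act)"
proof -
  have "group (Z2 G M act)"
    unfolding Z2_def using subgroup.subgroup_is_group[OF subgroup_Z2 group_C2]
    by (simp add: Z2_def)
  moreover have "x \<otimes>\<^bsub>Z2 G M act\<^esub> y = y \<otimes>\<^bsub>Z2 G M act\<^esub> x"
    if "x \<in> carrier (Z2 G M act)" "y \<in> carrier (Z2 G M act)" for x y
    using that unfolding carrier_Z2 mult_Z2 by (intro restrict_ext M.m_comm) auto
  ultimately show ?thesis by (rule group.group_comm_groupI)
qed

lemma subgroup_B2: "subgroup (B2 G M act) (Z2 G M act)"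
  using group.subgroup_incl[OF group_C2 subgroup_B2_C2 subgroup_Z2 B2_subset_Z2]
  by (simp add: Z2_def)

lemma normal_B2: "B2 G M act \<lhd> Z2 G M act"
  using comm_group.subgroup_imp_normal[OF comm_group_Z2 subgroup_B2] .

text \<open>\<open>F\<close> is a rational one-cochain whose coboundary is \<open>f\<close> among
  the rational functions modulo constants; \<open>k g h\<close> is the constant lost in the
  quotient.\<close>

definition potential :: "('g \<Rightarrow> 'g \<Rightarrow> 's \<Rightarrow> int) \<Rightarrow> ('g \<Rightarrow> 's \<Rightarrow> rat) \<Rightarrow> bool"
  where "potential f F \<longleftrightarrow> (\<exists>k. \<forall>g\<in>carrier G. \<forall>h\<in>carrier G. \<forall>s\<in>S.
    of_int (f g h s) = F h (inv g \<star> s) - F (g \<otimes> h) s + F g s + k g h)"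

lemma sum_translate:
  fixes F :: "'g \<Rightarrow> 'c::comm_monoid_add"
  assumes "g \<in> carrier G"
  shows "(\<Sum>h\<in>carrier G. F (g \<otimes> h)) = (\<Sum>h\<in>carrier G. F h)"
  by (rule sum.reindex_bij_witness[of _ "\<lambda>h. inv g \<otimes> h" "\<lambda>h. g \<otimes> h"])
     (use assms in \<open>auto simp flip: m_assoc\<close>)

lemma card_G_pos: "card (carrier G) > 0"
  using finite_G one_closed by (auto simp: card_gt_0_iff)

text \<open>Averaging the cocycle identity over its last argument trivialises a cocycle rationally.\<close>

lemma potential_exists:
  assumes "cochain f \<in> carrier (Z2 G M act)"
  shows "potential f (\<lambda>g s. of_int (\<Sum>l\<in>carrier G. f g l s) / of_nat (card (carrier G)))"
proof -
  let ?n = "of_nat (card (carrier G)) :: rat"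
  have n: "?n \<noteq> 0" using card_G_pos by simp
  from assms obtain \<kappa> where \<kappa>: "\<And>g h l s. g \<in> carrier G \<Longrightarrow> h \<in> carrier G \<Longrightarrow> l \<in> carrier G \<Longrightarrow> s \<in> S \<Longrightarrow>
     f h l (inv g \<star> s) + f g (h \<otimes> l) s = f (g \<otimes> h) l s + f g h s + \<kappa> g h l"
    unfolding cochain_in_Z2_iff by blast
  have "rat_of_int (f g h s) = of_int (\<Sum>l\<in>carrier G. f h l (inv g \<star> s)) / ?n
     - of_int (\<Sum>l\<in>carrier G. f (g \<otimes> h) l s) / ?n + of_int (\<Sum>l\<in>carrier G. f g l s) / ?n
     + - of_int (\<Sum>l\<in>carrier G. \<kappa> g h l) / ?n"
    if "g \<in> carrier G" "h \<in> carrier G" "s \<in> S" for g h s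
  proof -
    have "(\<Sum>l\<in>carrier G. f h l (inv g \<star> s)) + (\<Sum>l\<in>carrier G. f g (h \<otimes> l) s)
       = (\<Sum>l\<in>carrier G. f (g \<otimes> h) l s) + int (card (carrier G)) * f g h s + (\<Sum>l\<in>carrier G. \<kappa> g h l)"
      using \<kappa>[OF that(1,2) _ that(3)] by (simp flip: sum.distrib)
    moreover have "(\<Sum>l\<in>carrier G. f g (h \<otimes> l) s) = (\<Sum>l\<in>carrier G. f g l s)"
      using sum_translate[OF that(2), of "\<lambda>l. f g l s"] .
    ultimately have "rat_of_int (\<Sum>l\<in>carrier G. f h l (inv g \<star> s)) + of_int (\<Sum>l\<in>carrier G. f g l s)
       = of_int (\<Sum>l\<in>carrier G. f (g \<otimes> h) l s) + ?n * of_int (f g h s) + of_int (\<Sum>l\<in>carrier G. \<kappa> g h l)"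
      by (metis of_int_add of_int_mult of_int_of_nat_eq)
    then show ?thesis
      using divide_shift[OF n] by (simp only: of_int_minus minus_divide_left)
  qed
  then show ?thesis unfolding potential_def
    by (intro exI[of _ "\<lambda>g h. - of_int (\<Sum>l\<in>carrier G. \<kappa> g h l) / ?n"] ballI)
qed

text \<open>The difference of a rational and an integral trivialisation is a rational one-cocycle, hence
  a coboundary.\<close>

lemma cochain_in_B2_iff_potential:
  assumes "potential f F"
  shows "cochain f \<in> B2 G M act \<longleftrightarrow>
    (\<exists>W \<mu>. \<forall>g\<in>carrier G. \<forall>s\<in>S. F g s - W s + W (inv g \<star> s) - \<mu> g \<in> \<int>)"
proof -
  obtain k where k: "\<And>g h s. g \<in> carrier G \<Longrightarrow> h \<in> carrier G \<Longrightarrow> s \<in> S \<Longrightarrow>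
    rat_of_int (f g h s) = F h (inv g \<star> s) - F (g \<otimes> h) s + F g s + k g h"
    using assms unfolding potential_def by blast
  show ?thesis
  proof
    assume "cochain f \<in> B2 G M act"
    then obtain \<phi> \<kappa> where \<phi>: "\<And>g h s. g \<in> carrier G \<Longrightarrow> h \<in> carrier G \<Longrightarrow> s \<in> S \<Longrightarrow>
     f g h s = \<phi> h (inv g \<star> s) - \<phi> (g \<otimes> h) s + \<phi> g s + \<kappa> g h"
      unfolding cochain_in_B2_iff by blast
    define \<rho> where "\<rho> g s = F g s - of_int (\<phi> g s)" for g s
    let ?n = "of_nat (card (carrier G)) :: rat"
    have n: "?n \<noteq> 0" using card_G_pos by simp
    \<comment> \<open>Averaging \<open>\<rho>\<close>, a one-cocycle up to constants, gives a
      function \<open>R / n\<close> whose coboundary is \<open>\<rho>\<close> up to a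
      constant.\<close>
    define R where "R s = (\<Sum>h\<in>carrier G. \<rho> h s)" for s
    define c where "c g = (\<Sum>h\<in>carrier G. of_int (\<kappa> g h) - k g h)" for g
    have "F g s - R s / ?n + R (inv g \<star> s) / ?n - c g / ?n \<in> \<int>"
      if g: "g \<in> carrier G" and s: "s \<in> S" for g s
    proof -
      have "\<rho> h (inv g \<star> s) - \<rho> (g \<otimes> h) s + \<rho> g s = of_int (\<kappa> g h) - k g h" if "h \<in> carrier G" for h
        using k[OF g that s] \<phi>[OF g that s] by (simp add: \<rho>_def)
      then have "(\<Sum>h\<in>carrier G. \<rho> h (inv g \<star> s) - \<rho> (g \<otimes> h) s + \<rho> g s) = c g"
        unfolding c_def by (intro sum.cong) auto
      then have "R s + c g = R (inv g \<star> s) + ?n * \<rho> g s + 0"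
        by (simp add: sum.distrib sum_subtractf R_def sum_translate[OF g, of "\<lambda>h. \<rho> h s"])
      from divide_shift[OF n this]
      have "F g s - R s / ?n + R (inv g \<star> s) / ?n - c g / ?n = of_int (\<phi> g s)"
        by (simp add: \<rho>_def)
      then show ?thesis by simp
    qed
    then show "\<exists>W \<mu>. \<forall>g\<in>carrier G. \<forall>s\<in>S. F g s - W s + W (inv g \<star> s) - \<mu> g \<in> \<int>"
      by (intro exI[of _ "\<lambda>s. R s / ?n"] exI[of _ "\<lambda>g. c g / ?n"] ballI)
  next
    assume "\<exists>W \<mu>. \<forall>g\<in>carrier G. \<forall>s\<in>S. F g s - W s + W (inv g \<star> s) - \<mu> g \<in> \<int>"
    then obtain W \<mu> where W: "\<And>g s. g \<in> carrier G \<Longrightarrow> s \<in> S \<Longrightarrow> F g s - W s + W (inv g \<star> s) - \<mu> g \<in> \<int>"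
      by blast
    define \<phi> where "\<phi> g s = \<lfloor>F g s - W s + W (inv g \<star> s) - \<mu> g\<rfloor>" for g s
    have \<phi>: "rat_of_int (\<phi> g s) = F g s - W s + W (inv g \<star> s) - \<mu> g" if "g \<in> carrier G" "s \<in> S" for g s
      using W[OF that] by (simp add: \<phi>_def)
    \<comment> \<open>The rational constant is a difference of integers as soon as \<open>S\<close>
      has a point, so the floor does not change it there and yields a \<open>\<kappa>\<close>
      independent of \<open>s\<close>.\<close>
    have "f g h s = \<phi> h (inv g \<star> s) - \<phi> (g \<otimes> h) s + \<phi> g s + \<lfloor>k g h + \<mu> h - \<mu> (g \<otimes> h) + \<mu> g\<rfloor>"
      if "g \<in> carrier G" "h \<in> carrier G" "s \<in> S" for g h s
    proof -
      have "rat_of_int (f g h s) = rat_of_int (\<phi> h (inv g \<star> s) - \<phi> (g \<otimes> h) s + \<phi> g s)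
         + (k g h + \<mu> h - \<mu> (g \<otimes> h) + \<mu> g)"
        using that by (simp add: \<phi> k star_closed inv_mult_star)
      then have "k g h + \<mu> h - \<mu> (g \<otimes> h) + \<mu> g = of_int (f g h s - (\<phi> h (inv g \<star> s) - \<phi> (g \<otimes> h) s + \<phi> g s))"
        by simp
      then have "\<lfloor>k g h + \<mu> h - \<mu> (g \<otimes> h) + \<mu> g\<rfloor> = f g h s - (\<phi> h (inv g \<star> s) - \<phi> (g \<otimes> h) s + \<phi> g s)"
        by (simp only: floor_of_int)
      then show ?thesis by simp
    qed
    then show "cochain f \<in> B2 G M act"
      unfolding cochain_in_B2_iff
      by (intro exI[of _ \<phi>] exI[of _ "\<lambda>g h. \<lfloor>k g h + \<mu> h - \<mu> (g \<otimes> h) + \<mu> g\<rfloor>"] ballI)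
  qed
qed

end

section \<open>Classes attached to a character modulo N\<close>

lemma of_int_divide_in_Ints_iff:
  assumes "N \<noteq> 0"
  shows "(of_int a :: rat) / of_int N \<in> \<int> \<longleftrightarrow> N dvd a"
proof
  assume "(of_int a :: rat) / of_int N \<in> \<int>"
  then obtain m where "(of_int a :: rat) / of_int N = of_int m" by (elim Ints_cases)
  then have "(of_int a :: rat) = of_int (m * N)" using assms by (simp add: nonzero_divide_eq_eq)
  then show "N dvd a" by (simp only: of_int_eq_iff) simp
qed (use assms in auto)

lemma Ints_by_witness:
  assumes "x - y \<in> \<int>" shows "x \<in> \<int> \<longleftrightarrow> y \<in> (\<int> :: 'a::ring_1 set)"
  using assms by (metis Ints_add Ints_diff add_diff_cancel_left' diff_add_cancel diff_diff_eq2)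

text \<open>A homomorphism to Z/N is kept as a choice of integer representatives, additive only
  modulo \<open>N\<close>. The failure of additivity, divided by \<open>N\<close>, is what produces
  two-cocycles below.\<close>

locale mod_character = group G for G :: "'g monoid" (structure) +
  fixes lam :: "'g \<Rightarrow> int" and N :: int
  assumes N_pos: "N > 0"
    and lam_mult: "g \<in> carrier G \<Longrightarrow> h \<in> carrier G \<Longrightarrow> N dvd lam (g \<otimes> h) - (lam g + lam h)"
begin

lemma mod_character_subgroup:
  assumes "subgroup H G" shows "mod_character (G\<lparr>carrier := H\<rparr>) lam N"
proof -
  have "h \<in> carrier G" if "h \<in> H" for h
    using assms that subgroup.mem_carrier by fast
  moreover have "group (G\<lparr>carrier := H\<rparr>)"
    using assms by (rule subgroup.subgroup_is_group) (rule group_axioms)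
  ultimately show ?thesis
    unfolding mod_character_def mod_character_axioms_def using N_pos lam_mult by auto
qed

lemma lam_one: "N dvd lam \<one>"
  using lam_mult[of \<one> \<one>] by simp

lemma lam_inv:
  assumes "g \<in> carrier G" shows "N dvd lam (inv g) + lam g"
proof -
  have "N dvd lam \<one> - (lam (inv g) + lam g)"
    using lam_mult[of "inv g" g] assms by simp
  then show ?thesis using lam_one by (metis dvd_diff_right_iff)
qed

lemma lam_pow:
  assumes "g \<in> carrier G" shows "N dvd lam (g [^] (n::nat)) - int n * lam g"
proof (induction n)
  case (Suc n)
  have "N dvd lam (g [^] n \<otimes> g) - (lam (g [^] n) + lam g)"
    using assms by (intro lam_mult) auto
  from dvd_add[OF this Suc.IH] show ?case by (simp add: algebra_simps)
qed (use lam_one in simp)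

lemma lam_conj:
  assumes "g \<in> carrier G" "h \<in> carrier G"
  shows "N dvd lam (g \<otimes> h \<otimes> inv g) - lam h"
proof -
  have "N dvd (lam (g \<otimes> h \<otimes> inv g) - (lam (g \<otimes> h) + lam (inv g))) + (lam (g \<otimes> h) - (lam g + lam h))
      + (lam (inv g) + lam g)"
    by (rule dvd_add[OF dvd_add[OF lam_mult lam_mult] lam_inv]) (use assms in auto)
  then show ?thesis by simp
qed

lemma kernel_conj:
  assumes "g \<in> carrier G" "h \<in> carrier G"
  shows "N dvd lam (g \<otimes> h \<otimes> inv g) \<longleftrightarrow> N dvd lam h"
  using lam_conj[OF assms] by (metis dvd_diff_commute dvd_diff_right_iff dvd_diff_left_iff)

lemma hom_mod_Ints_pow:
  fixes \<mu> :: "'g \<Rightarrow> rat"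
  assumes "\<And>g h. g \<in> carrier G \<Longrightarrow> h \<in> carrier G \<Longrightarrow> \<mu> (g \<otimes> h) - \<mu> g - \<mu> h \<in> \<int>" and "g \<in> carrier G"
  shows "\<mu> (g [^] (n::nat)) - of_nat n * \<mu> g \<in> \<int>"
proof (induction n)
  case 0
  have "\<mu> \<one> \<in> \<int>" using assms(1)[of \<one> \<one>] by simp
  then show ?case by simp
next
  case (Suc n)
  have "\<mu> (g [^] n \<otimes> g) - \<mu> (g [^] n) - \<mu> g \<in> \<int>" using assms by auto
  from Ints_add[OF this Suc.IH] show ?case by (simp add: algebra_simps)
qed

text \<open>The values of \<open>lam\<close> generate an ideal \<open>d\<int>\<close> with \<open>d dvd N\<close>, so a character into \<open>\<rat>/\<int>\<close>
  that is trivial on the kernel is determined by its value at an element with \<open>lam\<close>-value \<open>d\<close>.\<close>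

lemma character_multiple:
  fixes \<mu> :: "'g \<Rightarrow> rat"
  assumes hom: "\<And>g h. g \<in> carrier G \<Longrightarrow> h \<in> carrier G \<Longrightarrow> \<mu> (g \<otimes> h) - \<mu> g - \<mu> h \<in> \<int>"
    and ker: "\<And>g. g \<in> carrier G \<Longrightarrow> N dvd lam g \<Longrightarrow> \<mu> g \<in> \<int>"
  shows "\<exists>x::int. \<forall>g\<in>carrier G. \<mu> g - of_int (x * lam g) / of_int N \<in> \<int>"
proof -
  \<comment> \<open>\<open>J\<close> is the preimage in Z of the image of \<open>lam\<close> modulo
    \<open>N\<close>; it is an ideal, generated by its least positive element
    \<open>d\<close>.\<close>
  define J where "J = {z. \<exists>g\<in>carrier G. N dvd z - lam g}"
  have J_diff: "z - w \<in> J" if zw: "z \<in> J" "w \<in> J" for z w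
  proof -
    from zw obtain g h where g: "g \<in> carrier G" "N dvd z - lam g" and h: "h \<in> carrier G" "N dvd w - lam h"
      unfolding J_def by auto
    have "N dvd (z - lam g) - (w - lam h) - (lam (g \<otimes> inv h) - (lam g + lam (inv h))) - (lam (inv h) + lam h)"
      by (rule dvd_diff[OF dvd_diff[OF dvd_diff[OF g(2) h(2)] lam_mult] lam_inv]) (use g h in auto)
    then have "N dvd (z - w) - lam (g \<otimes> inv h)" by (simp add: algebra_simps)
    then show ?thesis unfolding J_def using g h by blast
  qed
  have "0 \<in> J" unfolding J_def using lam_one by (auto intro: bexI[of _ \<one>])
  have J_add: "z + w \<in> J" if "z \<in> J" "w \<in> J" for z w
    using J_diff[OF that(1) J_diff[OF \<open>0 \<in> J\<close> that(2)]] by simp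
  have J_nat: "int k * z \<in> J" if "z \<in> J" for k z
    by (induction k) (use J_add that \<open>0 \<in> J\<close> in \<open>auto simp: algebra_simps\<close>)
  have J_mult: "k * z \<in> J" if "z \<in> J" for k z
    by (cases k rule: int_cases2)
      (use J_nat[OF that] J_diff[OF \<open>0 \<in> J\<close> J_nat[OF that]] in auto)
  have "N \<in> J" unfolding J_def using lam_one by (auto intro: bexI[of _ \<one>])
  define d where "d = (LEAST k. k > 0 \<and> int k \<in> J)"
  have d: "d > 0" "int d \<in> J"
    using LeastI[of "\<lambda>k. k > 0 \<and> int k \<in> J" "nat N"] N_pos \<open>N \<in> J\<close> unfolding d_def by auto
  have d_dvd: "int d dvd z" if "z \<in> J" for z
  proof -
    have "z mod int d = z - (z div int d) * int d" by (simp add: minus_div_mult_eq_mod)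
    then have "z mod int d \<in> J" using J_diff[OF that J_mult[OF d(2)]] by simp
    then have "int (nat (z mod int d)) \<in> J" using d(1) by simp
    moreover have "nat (z mod int d) < d" using d(1) by (simp add: nat_less_iff)
    ultimately have "\<not> nat (z mod int d) > 0"
      using not_less_Least[of "nat (z mod int d)" "\<lambda>k. k > 0 \<and> int k \<in> J"] unfolding d_def by auto
    then have "z mod int d = 0"
      using d(1) pos_mod_sign[of "int d" z] by linarith
    then show ?thesis by auto
  qed
  from d(2) obtain g\<^sub>1 where g1: "g\<^sub>1 \<in> carrier G" "N dvd int d - lam g\<^sub>1"
    unfolding J_def by auto
  obtain t where t: "N = int d * t" using d_dvd[OF \<open>N \<in> J\<close>] by (elim dvdE)
  have t_pos: "t > 0" using N_pos d(1) unfolding t by (simp add: zero_less_mult_iff)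
  have "N dvd lam (g\<^sub>1 [^] nat t) - t * lam g\<^sub>1"
    using lam_pow[OF g1(1), of "nat t"] t_pos by simp
  moreover have "N dvd t * (int d - lam g\<^sub>1)" using g1(2) by (rule dvd_mult)
  ultimately have "N dvd lam (g\<^sub>1 [^] nat t) - t * lam g\<^sub>1 - t * (int d - lam g\<^sub>1)" by (rule dvd_diff)
  then have "N dvd lam (g\<^sub>1 [^] nat t) - N" unfolding t by (simp add: algebra_simps)
  then have "N dvd lam (g\<^sub>1 [^] nat t)" by (metis diff_add_cancel dvd_add dvd_refl)
  then have "\<mu> (g\<^sub>1 [^] nat t) \<in> \<int>" using ker g1(1) by auto
  moreover have "\<mu> (g\<^sub>1 [^] nat t) - of_int t * \<mu> g\<^sub>1 \<in> \<int>"
    using hom_mod_Ints_pow[of \<mu>, OF hom g1(1), of "nat t"] t_pos by simp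
  ultimately have "of_int t * \<mu> g\<^sub>1 \<in> \<int>" using Ints_by_witness by blast
  \<comment> \<open>The power \<open>g\<^sub>1 [^] t\<close> lies in the kernel, so
    \<open>t * \<mu> g\<^sub>1\<close> is integral; this integer is the required multiplier.\<close>
  then obtain x where x: "of_int t * \<mu> g\<^sub>1 = of_int x" by (elim Ints_cases)
  have \<mu>g1: "\<mu> g\<^sub>1 = of_int (x * int d) / of_int N"
    using x t_pos d(1) unfolding t by (simp add: field_simps)
  have "\<mu> g - of_int (x * lam g) / of_int N \<in> \<int>" if g: "g \<in> carrier G" for g
  proof -
    have "lam g mod N = lam g - (lam g div N) * N" by (simp add: minus_div_mult_eq_mod)
    moreover have "lam g \<in> J" unfolding J_def using g by force
    ultimately have "lam g mod N \<in> J" using J_diff J_mult \<open>N \<in> J\<close> by simp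
    then obtain a where a: "lam g mod N = int d * a" using d_dvd unfolding dvd_def by blast
    have "a \<ge> 0"
      using d(1) pos_mod_sign[OF N_pos, of "lam g"] unfolding a by (simp add: zero_le_mult_iff)
    then obtain k where k: "a = int k" using nonneg_int_cases by blast
    \<comment> \<open>Division by a power of \<open>g\<^sub>1\<close> moves \<open>g\<close> into
      the kernel, where \<open>\<mu>\<close> is integral.\<close>
    let ?h = "g \<otimes> inv (g\<^sub>1 [^] k)"
    have h: "?h \<in> carrier G" using g g1 by simp
    have g_eq: "g = ?h \<otimes> g\<^sub>1 [^] k" using g g1 by (simp add: m_assoc)
    have d1: "N dvd lam g - (lam ?h + lam (g\<^sub>1 [^] k))"
      using lam_mult[OF h, of "g\<^sub>1 [^] k"] g1 by (simp flip: g_eq)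
    have d2: "N dvd lam (g\<^sub>1 [^] k) - a * lam g\<^sub>1"
      using lam_pow[OF g1(1), of k] k by simp
    have d3: "N dvd a * (int d - lam g\<^sub>1)" using g1(2) by (rule dvd_mult)
    have "N dvd lam g - lam g mod N" by simp
    from dvd_add[OF dvd_diff[OF dvd_diff[OF this d1] d2] d3]
    have "N dvd (lam g - lam g mod N) - (lam g - (lam ?h + lam (g\<^sub>1 [^] k)))
        - (lam (g\<^sub>1 [^] k) - a * lam g\<^sub>1) + a * (int d - lam g\<^sub>1)" .
    then have "N dvd lam ?h" unfolding a by (simp add: algebra_simps)
    then have "\<mu> ?h \<in> \<int>" using ker h by blast
    moreover have "\<mu> g - \<mu> ?h - \<mu> (g\<^sub>1 [^] k) \<in> \<int>"
      using hom[OF h, of "g\<^sub>1 [^] k"] g1 by (simp flip: g_eq)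
    moreover have "\<mu> (g\<^sub>1 [^] k) - of_int a * \<mu> g\<^sub>1 \<in> \<int>"
      using hom_mod_Ints_pow[of \<mu>, OF hom g1(1), of k] k by simp
    ultimately have "(\<mu> g - \<mu> ?h - \<mu> (g\<^sub>1 [^] k)) + \<mu> ?h + (\<mu> (g\<^sub>1 [^] k) - of_int a * \<mu> g\<^sub>1) \<in> \<int>"
      by (intro Ints_add)
    then have 1: "\<mu> g - of_int a * \<mu> g\<^sub>1 \<in> \<int>" by simp
    have "x * (lam g mod N) - x * lam g = - x * (lam g div N) * N"
      by (simp add: minus_div_mult_eq_mod[symmetric] algebra_simps)
    then have "(of_int (x * (lam g mod N) - x * lam g) :: rat) / of_int N \<in> \<int>"
      using N_pos of_int_divide_in_Ints_iff[of N] by simp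
    then have 2: "of_int a * \<mu> g\<^sub>1 - of_int (x * lam g) / of_int N \<in> \<int>"
      unfolding a \<mu>g1 by (simp add: diff_divide_distrib mult_ac)
    show ?thesis using Ints_add[OF 1 2] by simp
  qed
  then show ?thesis by blast
qed

end

text \<open>The point \<open>s\<^sub>0\<close> will be the inclusion of \<open>K\<close>. It serves
  as origin for functions on \<open>S\<close> modulo constants, and its stabiliser is the kernel of
  \<open>lam\<close>.\<close>

locale character_lattice =
  quotient_lattice G S star M act q + mod_character G lam N
  for G :: "'g monoid" (structure) and S :: "'s set" and star (infixr "\<star>" 75)
    and M :: "'m monoid" and act q lam N +
  fixes s\<^sub>0 :: 's
  assumes s0: "s\<^sub>0 \<in> S"
    and stabilizer_s0: "g \<in> carrier G \<Longrightarrow> g \<star> s\<^sub>0 = s\<^sub>0 \<longleftrightarrow> N dvd lam g"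
begin

lemma character_lattice_subgroup:
  assumes "subgroup H G" shows "character_lattice (G\<lparr>carrier := H\<rparr>) S star M act q lam N s\<^sub>0"
proof -
  have "h \<in> carrier G" if "h \<in> H" for h
    using assms that subgroup.mem_carrier by fast
  then show ?thesis
    unfolding character_lattice_def character_lattice_axioms_def
    using quotient_lattice_subgroup[OF assms] mod_character_subgroup[OF assms] s0 stabilizer_s0 by auto
qed

definition orbit_of :: "'s \<Rightarrow> 's set" where "orbit_of s = (\<lambda>g. g \<star> s) ` carrier G"

lemma orbit_of_star:
  assumes "g \<in> carrier G" "s \<in> S" shows "orbit_of (g \<star> s) = orbit_of s"
proof -
  have "h \<star> g \<star> s \<in> orbit_of s" if "h \<in> carrier G" for h
    using that assms unfolding orbit_of_def by (auto simp flip: star_mult)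
  moreover have "h \<star> s \<in> orbit_of (g \<star> s)" if "h \<in> carrier G" for h
    using that assms unfolding orbit_of_def
    by (auto intro!: rev_image_eqI[of "h \<otimes> inv g"] simp: star_mult star_closed)
  ultimately show ?thesis by (auto simp: orbit_of_def)
qed

lemma self_in_orbit: "s \<in> S \<Longrightarrow> s \<in> orbit_of s"
  unfolding orbit_of_def by (metis image_iff one_closed star_one)

lemma orbit_representatives:
  obtains r a where "\<And>s. s \<in> S \<Longrightarrow> r s \<in> S" "\<And>s. s \<in> S \<Longrightarrow> a s \<in> carrier G"
    "\<And>s. s \<in> S \<Longrightarrow> a s \<star> r s = s" "\<And>s g. s \<in> S \<Longrightarrow> g \<in> carrier G \<Longrightarrow> r (g \<star> s) = r s"
proof -
  \<comment> \<open>The choice depends only on the orbit as a set, hence is the same for all its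
    points.\<close>
  define r where "r s = (SOME t. t \<in> orbit_of s)" for s
  have r: "r s \<in> orbit_of s" if "s \<in> S" for s
    unfolding r_def using self_in_orbit[OF that] by (rule someI)
  have "\<exists>a\<in>carrier G. a \<star> r s = s" if s: "s \<in> S" for s
  proof -
    obtain g where "g \<in> carrier G" "r s = g \<star> s" using r[OF s] unfolding orbit_of_def by auto
    then show ?thesis using s by (auto intro!: bexI[of _ "inv g"])
  qed
  then obtain a where "\<And>s. s \<in> S \<Longrightarrow> a s \<in> carrier G \<and> a s \<star> r s = s" by metis
  moreover have "r s \<in> S" if "s \<in> S" for s
    using r[OF that] that star_closed unfolding orbit_of_def by auto
  moreover have "r (g \<star> s) = r s" if "s \<in> S" "g \<in> carrier G" for s g
    using that by (simp add: r_def orbit_of_star)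
  ultimately show ?thesis using that by blast
qed

text \<open>The quotient is the integral two-cocycle representing the image of \<open>lam\<close>
  under the connecting map of 0 -> Z -> Z -> Z/N -> 0. For invariant \<open>u\<close>, its product
  with \<open>u\<close> is the coboundary of \<open>lam * u / N\<close>.\<close>

definition fc :: "('s \<Rightarrow> int) \<Rightarrow> 'g \<Rightarrow> 'g \<Rightarrow> 's \<Rightarrow> int"
  where "fc u g h s = ((lam g + lam h - lam (g \<otimes> h)) div N) * u s"

definition invariant :: "('s \<Rightarrow> int) \<Rightarrow> bool"
  where "invariant u \<longleftrightarrow> (\<forall>g\<in>carrier G. \<forall>s\<in>S. u (g \<star> s) = u s)"

lemma invariantD: "invariant u \<Longrightarrow> g \<in> carrier G \<Longrightarrow> s \<in> S \<Longrightarrow> u (g \<star> s) = u s"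
  by (simp add: invariant_def)

lemma N_times_defect:
  assumes "g \<in> carrier G" "h \<in> carrier G"
  shows "N * ((lam g + lam h - lam (g \<otimes> h)) div N) = lam g + lam h - lam (g \<otimes> h)"
proof -
  have "N dvd - (lam (g \<otimes> h) - (lam g + lam h))" unfolding dvd_minus_iff by (rule lam_mult[OF assms])
  then show ?thesis by simp
qed

lemma fc_potential:
  assumes "invariant u"
  shows "potential (fc u) (\<lambda>g s. of_int (lam g * u s) / of_int N)"
proof -
  have "rat_of_int (fc u g h s) = of_int (lam h * u (inv g \<star> s)) / of_int N
      - of_int (lam (g \<otimes> h) * u s) / of_int N + of_int (lam g * u s) / of_int N + 0"
    if "g \<in> carrier G" "h \<in> carrier G" "s \<in> S" for g h s
  proof -
    have "N * fc u g h s = (N * ((lam g + lam h - lam (g \<otimes> h)) div N)) * u s"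
      by (simp add: fc_def)
    also have "\<dots> = lam h * u (inv g \<star> s) - lam (g \<otimes> h) * u s + lam g * u s"
      unfolding N_times_defect[OF that(1,2)] using invariantD[OF assms, of "inv g" s] that
      by (simp add: algebra_simps)
    finally have "rat_of_int N * of_int (fc u g h s)
      = of_int (lam h * u (inv g \<star> s)) - of_int (lam (g \<otimes> h) * u s) + of_int (lam g * u s)"
      by (metis of_int_add of_int_diff of_int_mult)
    then have "rat_of_int (fc u g h s)
      = (of_int (lam h * u (inv g \<star> s)) - of_int (lam (g \<otimes> h) * u s) + of_int (lam g * u s)) / of_int N"
      using N_pos by (metis nonzero_mult_div_cancel_left of_int_0_eq_iff less_irrefl)
    then show ?thesis by (simp only: add_divide_distrib diff_divide_distrib add_0_right)
  qed
  then show ?thesis unfolding potential_def by (intro exI[of _ "\<lambda>_ _. 0"] ballI)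
qed

lemma fc_in_Z2:
  assumes "invariant u" shows "cochain (fc u) \<in> carrier (Z2 G M act)"
proof -
  let ?e = "\<lambda>g h. (lam g + lam h - lam (g \<otimes> h)) div N"
  have "fc u h l (inv g \<star> s) + fc u g (h \<otimes> l) s = fc u (g \<otimes> h) l s + fc u g h s + 0"
    if "g \<in> carrier G" "h \<in> carrier G" "l \<in> carrier G" "s \<in> S" for g h l s
  proof -
    have "N * (?e h l + ?e g (h \<otimes> l)) = N * (?e (g \<otimes> h) l + ?e g h)"
      unfolding distrib_left using that by (simp only: N_times_defect m_closed) (simp add: m_assoc)
    then have "?e h l + ?e g (h \<otimes> l) = ?e (g \<otimes> h) l + ?e g h" using N_pos by simp
    then show ?thesis
      using invariantD[OF assms, of "inv g" s] that by (simp add: fc_def distrib_right[symmetric])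
  qed
  then show ?thesis unfolding cochain_in_Z2_iff by (intro exI[of _ "\<lambda>_ _ _. 0"] ballI)
qed

text \<open>Since \<open>u\<close> vanishes on the orbit of \<open>s\<^sub>0\<close>, the constants
  \<open>\<mu>\<close> of a trivialisation form a character modulo Z. It is trivial on the kernel of
  \<open>lam\<close>, which fixes \<open>s\<^sub>0\<close>, and so equals
  \<open>x * lam / N\<close>. At a point fixed by \<open>g\<close> the terms \<open>W\<close> cancel
  and the divisibility remains.\<close>

lemma fc_in_B2_iff:
  assumes u: "invariant u" and u0: "u s\<^sub>0 = 0"
  shows "cochain (fc u) \<in> B2 G M act \<longleftrightarrow>
    (\<exists>x. \<forall>s\<in>S. \<forall>g\<in>carrier G. g \<star> s = s \<longrightarrow> N dvd lam g * (u s - x))"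
proof -
  note N0 = N_pos[THEN less_imp_neq, symmetric]
  show ?thesis unfolding cochain_in_B2_iff_potential[OF fc_potential[OF u]]
  proof
    assume "\<exists>W \<mu>. \<forall>g\<in>carrier G. \<forall>s\<in>S.
      rat_of_int (lam g * u s) / of_int N - W s + W (inv g \<star> s) - \<mu> g \<in> \<int>"
    then obtain W \<mu> where W: "\<And>g s. g \<in> carrier G \<Longrightarrow> s \<in> S \<Longrightarrow>
      rat_of_int (lam g * u s) / of_int N - W s + W (inv g \<star> s) - \<mu> g \<in> \<int>" by blast
    have hom: "\<mu> (g \<otimes> h) - \<mu> g - \<mu> h \<in> \<int>" if gh: "g \<in> carrier G" "h \<in> carrier G" for g h
    proof -
      have s1: "inv g \<star> s\<^sub>0 \<in> S" "u (inv g \<star> s\<^sub>0) = 0"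
        using gh s0 u0 invariantD[OF u] by (auto simp: star_closed)
      have a1: "- W s\<^sub>0 + W (inv g \<star> s\<^sub>0) - \<mu> g \<in> \<int>" using W[OF gh(1) s0] u0 by simp
      have a2: "- W (inv g \<star> s\<^sub>0) + W (inv h \<star> inv g \<star> s\<^sub>0) - \<mu> h \<in> \<int>"
        using W[OF gh(2) s1(1)] s1(2) by simp
      have a3: "- W s\<^sub>0 + W (inv h \<star> inv g \<star> s\<^sub>0) - \<mu> (g \<otimes> h) \<in> \<int>"
        using W[OF m_closed[OF gh] s0] u0 gh s0 by (simp add: inv_mult_star)
      show ?thesis using Ints_diff[OF Ints_add[OF a1 a2] a3] by (simp add: algebra_simps)
    qed
    have fix_inv: "inv g \<star> s = s" if "g \<in> carrier G" "s \<in> S" "g \<star> s = s" for g s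
      using star_inv_star(1)[OF that(1,2)] that(3) by simp
    have "\<mu> g \<in> \<int>" if g: "g \<in> carrier G" "N dvd lam g" for g
      using W[OF g(1) s0] u0 fix_inv[OF g(1) s0] stabilizer_s0[OF g(1)] g(2) by simp
    from character_multiple[of \<mu>, OF hom this]
    obtain x where x: "\<And>g. g \<in> carrier G \<Longrightarrow> \<mu> g - of_int (x * lam g) / of_int N \<in> \<int>" by blast
    have "N dvd lam g * (u s - x)" if g: "g \<in> carrier G" "s \<in> S" "g \<star> s = s" for g s
    proof -
      have "rat_of_int (lam g * u s) / of_int N - \<mu> g \<in> \<int>"
        using W[OF g(1,2)] fix_inv[OF g] by simp
      from Ints_add[OF this x[OF g(1)]]
      have "rat_of_int (lam g * u s) / of_int N - of_int (x * lam g) / of_int N \<in> \<int>" by simp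
      then have "rat_of_int (lam g * u s - x * lam g) / of_int N \<in> \<int>"
        by (simp add: diff_divide_distrib)
      then show ?thesis unfolding of_int_divide_in_Ints_iff[OF N0] by (simp add: algebra_simps)
    qed
    then show "\<exists>x. \<forall>s\<in>S. \<forall>g\<in>carrier G. g \<star> s = s \<longrightarrow> N dvd lam g * (u s - x)" by blast
  next
    assume "\<exists>x. \<forall>s\<in>S. \<forall>g\<in>carrier G. g \<star> s = s \<longrightarrow> N dvd lam g * (u s - x)"
    then obtain x where x: "\<And>s g. s \<in> S \<Longrightarrow> g \<in> carrier G \<Longrightarrow> g \<star> s = s \<Longrightarrow> N dvd lam g * (u s - x)"
      by blast
    obtain r a where r: "\<And>s. s \<in> S \<Longrightarrow> r s \<in> S" and a: "\<And>s. s \<in> S \<Longrightarrow> a s \<in> carrier G"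
      and ar: "\<And>s. s \<in> S \<Longrightarrow> a s \<star> r s = s"
      and r_star: "\<And>s g. s \<in> S \<Longrightarrow> g \<in> carrier G \<Longrightarrow> r (g \<star> s) = r s"
      using orbit_representatives by metis
    have "rat_of_int (lam g * u s) / of_int N - of_int (lam (a s) * (u s - x)) / of_int N
      + of_int (lam (a (inv g \<star> s)) * (u (inv g \<star> s) - x)) / of_int N - of_int (x * lam g) / of_int N \<in> \<int>"
      if g: "g \<in> carrier G" and s: "s \<in> S" for g s
    proof -
      define s' where "s' = inv g \<star> s"
      have s': "s' \<in> S" "r s' = r s" "u s' = u s" "g \<star> s' = s"
        using g s r_star invariantD[OF u] by (auto simp: s'_def star_closed)
      have c: "a s \<in> carrier G" "a s' \<in> carrier G" using a s s' by auto
      \<comment> \<open>\<open>?b\<close> carries the orbit representative to \<open>s'\<close>, on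
        to \<open>s\<close> and back; it fixes the representative, so the hypothesis applies to
        it.\<close>
      let ?b = "inv (a s) \<otimes> (g \<otimes> a s')"
      have "?b \<star> r s = r s"
      proof -
        have "?b \<star> r s = inv (a s) \<star> g \<star> a s' \<star> r s'"
          unfolding s'(2) using c g r[OF s] by (simp add: star_mult star_closed)
        also have "\<dots> = inv (a s) \<star> a s \<star> r s" unfolding ar[OF s'(1)] ar[OF s] s'(4) ..
        finally show ?thesis using c r[OF s] by simp
      qed
      then have "N dvd lam ?b * (u (r s) - x)" using x r[OF s] c g by simp
      moreover have "u (r s) = u s" using invariantD[OF u c(1) r[OF s]] ar[OF s] by simp
      ultimately have "N dvd lam ?b * (u s - x)" by simp
      moreover have "N dvd (lam g + lam (a s') - lam (a s)) - lam ?b"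
      proof -
        have "N dvd (lam (inv (a s)) + lam (a s)) + (lam ?b - (lam (inv (a s)) + lam (g \<otimes> a s')))
           + (lam (g \<otimes> a s') - (lam g + lam (a s')))"
          by (rule dvd_add[OF dvd_add[OF lam_inv lam_mult] lam_mult]) (use c g in auto)
        then have "N dvd - (lam ?b - (lam g + lam (a s') - lam (a s)))"
          unfolding dvd_minus_iff by (simp add: algebra_simps)
        then show ?thesis by simp
      qed
      ultimately have "N dvd ((lam g + lam (a s') - lam (a s)) - lam ?b) * (u s - x) + lam ?b * (u s - x)"
        using dvd_add[OF dvd_mult2] by blast
      then have "N dvd lam g * u s - lam (a s) * (u s - x) + lam (a s') * (u s - x) - x * lam g"
        by (simp add: algebra_simps)
      then have "rat_of_int (lam g * u s - lam (a s) * (u s - x) + lam (a s') * (u s - x) - x * lam g)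
         / of_int N \<in> \<int>"
        unfolding of_int_divide_in_Ints_iff[OF N0] .
      then show ?thesis
        using s'(3) unfolding s'_def
        by (simp only: add_divide_distrib diff_divide_distrib of_int_add of_int_diff)
    qed
    then show "\<exists>W \<mu>. \<forall>g\<in>carrier G. \<forall>s\<in>S.
      rat_of_int (lam g * u s) / of_int N - W s + W (inv g \<star> s) - \<mu> g \<in> \<int>"
      \<comment> \<open>\<open>W\<close> transports \<open>lam * (u - x) / N\<close> from the orbit
        representatives; by the stabiliser condition it does not depend modulo Z on the choice of
        \<open>a s\<close>.\<close>
      by (intro exI[of _ "\<lambda>s. of_int (lam (a s) * (u s - x)) / of_int N"]
          exI[of _ "\<lambda>g. of_int (x * lam g) / of_int N"] ballI)
  qed
qed

end

section \<open>Restriction of cochains to subgroups\<close>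

context quotient_lattice
begin

lemma restrict_cochain:
  assumes "subgroup H G"
  shows "restrict (cochain f) (H \<times> H) = quotient_lattice.cochain (G\<lparr>carrier := H\<rparr>) q f"
proof -
  interpret H: quotient_lattice "G\<lparr>carrier := H\<rparr>" S star M act q
    by (rule quotient_lattice_subgroup[OF assms])
  have "h \<in> carrier G" if "h \<in> H" for h
    using assms that subgroup.mem_carrier by fast
  then show ?thesis
    unfolding cochain_def H.cochain_def by (auto simp: fun_eq_iff)
qed

lemma potential_subgroup:
  assumes "subgroup H G" and "potential f F"
  shows "quotient_lattice.potential (G\<lparr>carrier := H\<rparr>) S star f F"
proof -
  interpret H: quotient_lattice "G\<lparr>carrier := H\<rparr>" S star M act q
    by (rule quotient_lattice_subgroup[OF assms(1)])
  have "h \<in> carrier G" if "h \<in> H" for h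
    using assms that subgroup.mem_carrier by fast
  then show ?thesis
    using assms(2) unfolding potential_def H.potential_def
    by (auto simp: m_inv_consistent[OF assms(1)])
qed

text \<open>A potential for \<open>G\<close> restricts to \<open>H\<close>, so one rational
  trivialisation tests triviality on all subgroups.\<close>

lemma restrict_in_B2_iff_potential:
  assumes "subgroup H G" and "potential f F"
  shows "restrict (cochain f) (H \<times> H) \<in> B2 (G\<lparr>carrier := H\<rparr>) M act \<longleftrightarrow>
    (\<exists>W \<mu>. \<forall>g\<in>H. \<forall>s\<in>S. F g s - W s + W (inv g \<star> s) - \<mu> g \<in> \<int>)"
proof -
  interpret H: quotient_lattice "G\<lparr>carrier := H\<rparr>" S star M act q
    by (rule quotient_lattice_subgroup[OF assms(1)])
  show ?thesis
    unfolding restrict_cochain[OF assms(1)]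
      H.cochain_in_B2_iff_potential[OF potential_subgroup[OF assms]]
    by (simp add: m_inv_consistent[OF assms(1)])
qed

lemma restrict_B2:
  assumes "subgroup H G" and "f \<in> B2 G M act"
  shows "restrict f (H \<times> H) \<in> B2 (G\<lparr>carrier := H\<rparr>) M act"
proof -
  have "f \<in> carrier (C2 G M)" using assms(2) B2_subset_C2 by blast
  then obtain f' where f': "f = cochain f'" using cochain_surj by (auto simp: C2_def)
  have "cochain f' \<in> carrier (Z2 G M act)" using assms(2) B2_subset_Z2 f' by blast
  note pot = potential_exists[OF this]
  have "h \<in> carrier G" if "h \<in> H" for h
    using assms that subgroup.mem_carrier by fast
  then show ?thesis
    using assms(2) unfolding f' restrict_in_B2_iff_potential[OF assms(1) pot] cochain_in_B2_iff_potential[OF pot]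
    by blast
qed

lemma fix_inv_star: "g \<in> carrier G \<Longrightarrow> s \<in> S \<Longrightarrow> g \<star> s = s \<Longrightarrow> inv g \<star> s = s"
  using star_inv_star(1) by metis

lemma subgroup_generate1: "g \<in> carrier G \<Longrightarrow> subgroup (generate G {g}) G"
  by (intro generate_is_subgroup) auto

text \<open>At a point fixed by \<open>h\<close> the terms \<open>W\<close> cancel, and
  \<open>F h\<close> is there congruent to \<open>\<mu> h\<close>, whatever the point.\<close>

lemma potential_agrees_at_fixed_points:
  assumes "potential f F" and "h \<in> carrier G"
    and "restrict (cochain f) (generate G {h} \<times> generate G {h}) \<in> B2 (G\<lparr>carrier := generate G {h}\<rparr>) M act"
    and "s \<in> S" "t \<in> S" "h \<star> s = s" "h \<star> t = t"
  shows "F h s - F h t \<in> \<int>"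
proof -
  from assms(3) obtain W \<mu> where W: "\<And>g s. g \<in> generate G {h} \<Longrightarrow> s \<in> S \<Longrightarrow>
      F g s - W s + W (inv g \<star> s) - \<mu> g \<in> \<int>"
    unfolding restrict_in_B2_iff_potential[OF subgroup_generate1[OF assms(2)] assms(1)] by blast
  have h: "h \<in> generate G {h}" by (simp add: generate.incl)
  have "F h s - \<mu> h \<in> \<int>" "F h t - \<mu> h \<in> \<int>"
    using W[OF h assms(4)] W[OF h assms(5)] fix_inv_star[OF assms(2)] assms(4-7) by simp_all
  from Ints_diff[OF this] show ?thesis by simp
qed

end

section \<open>Locally trivial classes come from invariant functions\<close>

context character_lattice
begin

lemma sub_fc:
  assumes "subgroup H G"
  shows "restrict (cochain (fc u)) (H \<times> H) = 
    quotient_lattice.cochain (G\<lparr>carrier := H\<rparr>) q (character_lattice.fc (G\<lparr>carrier := H\<rparr>) lam N u)"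
proof -
  interpret H: character_lattice "G\<lparr>carrier := H\<rparr>" S star M act q lam N s\<^sub>0
    by (rule character_lattice_subgroup[OF assms])
  have "fc u = H.fc u" unfolding fc_def H.fc_def by simp
  then show ?thesis unfolding restrict_cochain[OF assms] by simp
qed

lemma restrict_fc_in_B2_iff:
  assumes "subgroup H G" "invariant u" "u s\<^sub>0 = 0"
  shows "restrict (cochain (fc u)) (H \<times> H) \<in> B2 (G\<lparr>carrier := H\<rparr>) M act \<longleftrightarrow>
    (\<exists>x. \<forall>s\<in>S. \<forall>g\<in>H. g \<star> s = s \<longrightarrow> N dvd lam g * (u s - x))"
proof -
  interpret H: character_lattice "G\<lparr>carrier := H\<rparr>" S star M act q lam N s\<^sub>0
    by (rule character_lattice_subgroup[OF assms(1)])
  have "h \<in> carrier G" if "h \<in> H" for h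
    using assms that subgroup.mem_carrier by fast
  then have "H.invariant u" using assms(2) unfolding invariant_def H.invariant_def by auto
  from H.fc_in_B2_iff[OF this assms(3)] show ?thesis
    unfolding sub_fc[OF assms(1)] by simp
qed

text \<open>A locally trivial class restricts to zero on the cyclic group generated by an element on which
  \<open>lam\<close> takes the value 1. This normalises the rational trivialisation so far that its restrictions to
  the point stabilisers become characters into \<open>\<rat>/\<int>\<close>; these vanish on the kernel of \<open>lam\<close>, hence
  are multiples of \<open>lam / N\<close>.\<close>

lemma locally_trivial_eq_fc:
  assumes f: "cochain f \<in> carrier (Z2 G M act)"
    and loc: "\<And>g. g \<in> carrier G \<Longrightarrow> restrict (cochain f) (generate G {g} \<times> generate G {g})
       \<in> B2 (G\<lparr>carrier := generate G {g}\<rparr>) M act"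
    and \<gamma>: "\<gamma> \<in> carrier G" "N dvd lam \<gamma> - 1"
  obtains u where "invariant u" "u s\<^sub>0 = 0" "cochain (\<lambda>g h s. f g h s - fc u g h s) \<in> B2 G M act"
proof -
  note N0 = N_pos[THEN less_imp_neq, symmetric]
  let ?C = "generate G {\<gamma>}"
  obtain F0 where F0: "potential f F0" using potential_exists[OF f] by blast
  obtain W0 \<mu>0 where W0: "\<And>g s. g \<in> ?C \<Longrightarrow> s \<in> S \<Longrightarrow> F0 g s - W0 s + W0 (inv g \<star> s) - \<mu>0 g \<in> \<int>"
    using loc[OF \<gamma>(1)]
    unfolding restrict_in_B2_iff_potential[OF subgroup_generate1[OF \<gamma>(1)] F0] by blast
  \<comment> \<open>The coboundary of \<open>W0\<close> makes \<open>F0\<close> independent of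
    \<open>s\<close> modulo Z on the cyclic group of \<open>\<gamma>\<close>. Subtracting the value
    at \<open>s\<^sub>0\<close> makes it integral there and fixes the free constant.\<close>
  define F where "F g s = (F0 g s - W0 s + W0 (inv g \<star> s)) - (F0 g s\<^sub>0 - W0 s\<^sub>0 + W0 (inv g \<star> s\<^sub>0))" for g s
  have F_s0 [simp]: "F g s\<^sub>0 = 0" for g by (simp add: F_def)
  have F_C: "F g s \<in> \<int>" if "g \<in> ?C" "s \<in> S" for g s
  proof -
    have "F g s = (F0 g s - W0 s + W0 (inv g \<star> s) - \<mu>0 g) - (F0 g s\<^sub>0 - W0 s\<^sub>0 + W0 (inv g \<star> s\<^sub>0) - \<mu>0 g)"
      by (simp add: F_def)
    then show ?thesis using Ints_diff[OF W0[OF that] W0[OF that(1) s0]] by simp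
  qed
  have F_pot: "potential f F"
  proof -
    obtain k where k: "\<And>g h s. g \<in> carrier G \<Longrightarrow> h \<in> carrier G \<Longrightarrow> s \<in> S \<Longrightarrow>
      rat_of_int (f g h s) = F0 h (inv g \<star> s) - F0 (g \<otimes> h) s + F0 g s + k g h"
      using F0 unfolding potential_def by blast
    define \<nu> where "\<nu> g = F0 g s\<^sub>0 - W0 s\<^sub>0 + W0 (inv g \<star> s\<^sub>0)" for g
    show ?thesis unfolding potential_def
      by (intro exI[of _ "\<lambda>g h. k g h + \<nu> h - \<nu> (g \<otimes> h) + \<nu> g"] ballI)
        (simp add: k F_def \<nu>_def[symmetric] inv_mult_star)
  qed
  then obtain k where k: "\<And>g h s. g \<in> carrier G \<Longrightarrow> h \<in> carrier G \<Longrightarrow> s \<in> S \<Longrightarrow>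
      rat_of_int (f g h s) = F h (inv g \<star> s) - F (g \<otimes> h) s + F g s + k g h"
    unfolding potential_def by blast
  have F_fixed: "F h s - F h t \<in> \<int>"
    if "h \<in> carrier G" "s \<in> S" "t \<in> S" "h \<star> s = s" "h \<star> t = t" for h s t
    by (rule potential_agrees_at_fixed_points[OF F_pot that(1) loc[OF that(1)] that(2-5)])
  have F_ker: "F h s \<in> \<int>" if "h \<in> carrier G" "s \<in> S" "h \<star> s = s" "N dvd lam h" for h s
    using F_fixed[OF that(1,2) s0 that(3)] stabilizer_s0 that by simp
  \<comment> \<open>The kernel of \<open>lam\<close> is normal and fixes \<open>s\<^sub>0\<close>,
    hence fixes the whole orbit pointwise.\<close>
  have ker_fixes: "h \<star> s = s" if h: "h \<in> carrier G" "N dvd lam h" and s: "s \<in> orbit_of s\<^sub>0" for h s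
  proof -
    obtain a where a: "a \<in> carrier G" "s = a \<star> s\<^sub>0" using s unfolding orbit_of_def by auto
    have "N dvd lam (inv a \<otimes> h \<otimes> inv (inv a))"
      using kernel_conj[of "inv a" h] h a by blast
    then have "(inv a \<otimes> h \<otimes> a) \<star> s\<^sub>0 = s\<^sub>0" using stabilizer_s0 a h by simp
    then have "a \<star> inv a \<star> h \<star> a \<star> s\<^sub>0 = a \<star> s\<^sub>0" using a h s0 by (simp add: star_mult star_closed)
    then show ?thesis using a h s0 by (simp add: star_closed)
  qed
  have orbit_S: "s \<in> S" if "s \<in> orbit_of s\<^sub>0" for s
    using that s0 star_closed unfolding orbit_of_def by auto
  have orbit_closed: "g \<star> s \<in> orbit_of s\<^sub>0 \<longleftrightarrow> s \<in> orbit_of s\<^sub>0" if "g \<in> carrier G" "s \<in> S" for g s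
  proof -
    have "t \<in> orbit_of s\<^sub>0 \<longleftrightarrow> orbit_of t = orbit_of s\<^sub>0" if "t \<in> S" for t
    proof
      assume "t \<in> orbit_of s\<^sub>0"
      then obtain h where "h \<in> carrier G" "t = h \<star> s\<^sub>0" unfolding orbit_of_def by auto
      then show "orbit_of t = orbit_of s\<^sub>0" using orbit_of_star s0 by simp
    qed (use self_in_orbit[OF that] in simp)
    then show ?thesis using that star_closed orbit_of_star by simp
  qed
  \<comment> \<open>Comparison with the same identity at \<open>s\<^sub>0\<close> eliminates
    \<open>k g h\<close>; the remaining error is a value of \<open>F\<close> on the orbit of
    \<open>s\<^sub>0\<close>.\<close>
  have cocycle0: "F (g \<otimes> h) s - F h (inv g \<star> s) - F g s + F h (inv g \<star> s\<^sub>0) \<in> \<int>"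
    if "g \<in> carrier G" "h \<in> carrier G" "s \<in> S" for g h s
  proof -
    have "F (g \<otimes> h) s - F h (inv g \<star> s) - F g s + F h (inv g \<star> s\<^sub>0) = of_int (f g h s\<^sub>0 - f g h s)"
      using k[OF that] k[OF that(1,2) s0] by simp
    then show ?thesis by simp
  qed
  have inv_s0: "inv g \<star> s\<^sub>0 \<in> orbit_of s\<^sub>0" if "g \<in> carrier G" for g
    using that unfolding orbit_of_def by auto
  have F_orbit: "F g s \<in> \<int>" if g: "g \<in> carrier G" and s: "s \<in> orbit_of s\<^sub>0" for g s
  proof -
    \<comment> \<open>Since \<open>lam \<gamma>\<close> is 1 modulo \<open>N\<close>, this power of
      \<open>\<gamma>\<close> agrees with \<open>g\<close> under \<open>lam\<close>. On the orbit of
      \<open>s\<^sub>0\<close>, \<open>F\<close> is integral for \<open>c\<close> by the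
      normalisation and for \<open>h\<close> because \<open>h\<close> lies in the kernel.\<close>
    define c where "c = \<gamma> [^] nat (lam g mod N)"
    define h where "h = inv c \<otimes> g"
    have c: "c \<in> carrier G" using \<gamma> by (simp add: c_def)
    have h: "h \<in> carrier G" using c g by (simp add: h_def)
    have g_eq: "g = c \<otimes> h" using c g by (simp add: h_def flip: m_assoc)
    have "c \<in> ?C" unfolding c_def generate_pow[OF \<gamma>(1)]
      by (intro CollectI exI[of _ "int (nat (lam g mod N))"]) (simp add: int_pow_int)
    have "N dvd lam c - (lam g mod N) * lam \<gamma>"
      using lam_pow[OF \<gamma>(1), of "nat (lam g mod N)"] N_pos by (simp add: c_def)
    from dvd_add[OF this dvd_mult[OF \<gamma>(2), of "lam g mod N"]]
    have "N dvd lam c - lam g mod N" by (simp add: algebra_simps)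
    from dvd_diff[OF this dvd_minus_mod[of N "lam g"]]
    have "N dvd lam c - lam g mod N - (lam g - lam g mod N)" .
    then have "N dvd lam c - lam g" by simp
    from dvd_add[OF this lam_mult[OF c h]] have "N dvd - lam h" unfolding g_eq[symmetric] by simp
    then have ker: "N dvd lam h" by simp
    have s': "inv c \<star> s \<in> orbit_of s\<^sub>0" using orbit_closed c orbit_S[OF s] s by simp
    have "F h (inv c \<star> s) \<in> \<int>" "F h (inv c \<star> s\<^sub>0) \<in> \<int>"
      using F_ker[OF h orbit_S _ ker] ker_fixes[OF h ker] s' inv_s0[OF c] by auto
    moreover have "F c s \<in> \<int>" using F_C \<open>c \<in> ?C\<close> orbit_S[OF s] by blast
    moreover have "F g s - F h (inv c \<star> s) - F c s + F h (inv c \<star> s\<^sub>0) \<in> \<int>"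
      using cocycle0[OF c h orbit_S[OF s]] unfolding g_eq[symmetric] .
    ultimately have "(F g s - F h (inv c \<star> s) - F c s + F h (inv c \<star> s\<^sub>0))
       + F h (inv c \<star> s) + F c s - F h (inv c \<star> s\<^sub>0) \<in> \<int>"
      using Ints_add Ints_diff by blast
    then show ?thesis by simp
  qed
  have cocycle: "F (g \<otimes> h) s - F h (inv g \<star> s) - F g s \<in> \<int>"
    if "g \<in> carrier G" "h \<in> carrier G" "s \<in> S" for g h s
    using Ints_diff[OF cocycle0[OF that] F_orbit[OF that(2) inv_s0[OF that(1)]]] by simp
  have "\<exists>c::int. \<forall>g\<in>carrier G. g \<star> s = s \<longrightarrow> F g s - of_int (c * lam g) / of_int N \<in> \<int>"
    if s: "s \<in> S" for s
  proof -
    let ?H = "{g \<in> carrier G. g \<star> s = s}"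
    have sub: "subgroup ?H G"
      by (rule subgroupI) (use s in \<open>auto simp: star_one star_mult fix_inv_star intro: exI[of _ \<one>]\<close>)
    interpret H: mod_character "G\<lparr>carrier := ?H\<rparr>" lam N by (rule mod_character_subgroup[OF sub])
    have "\<exists>x::int. \<forall>g\<in>carrier (G\<lparr>carrier := ?H\<rparr>). F g s - of_int (x * lam g) / of_int N \<in> \<int>"
    proof (rule H.character_multiple)
      fix g h assume "g \<in> carrier (G\<lparr>carrier := ?H\<rparr>)" "h \<in> carrier (G\<lparr>carrier := ?H\<rparr>)"
      then have g: "g \<in> carrier G" "inv g \<star> s = s" and h: "h \<in> carrier G" "h \<star> s = s"
        using fix_inv_star s by auto
      have "F (g \<otimes> h) s - F h s - F g s \<in> \<int>" using cocycle[OF g(1) h(1) s] unfolding g(2) .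
      then show "F (monoid.mult (G\<lparr>carrier := ?H\<rparr>) g h) s - F g s - F h s \<in> \<int>"
        by (simp add: diff_diff_eq add.commute)
    qed (use F_ker s in auto)
    then show ?thesis by (simp del: of_int_mult) blast
  qed
  then obtain c :: "'s \<Rightarrow> int" where c: "\<And>s g. s \<in> S \<Longrightarrow> g \<in> carrier G \<Longrightarrow> g \<star> s = s \<Longrightarrow>
    F g s - of_int (c s * lam g) / of_int N \<in> \<int>" by metis
  obtain r a where r: "\<And>s. s \<in> S \<Longrightarrow> r s \<in> S" and a: "\<And>s. s \<in> S \<Longrightarrow> a s \<in> carrier G"
    and ar: "\<And>s. s \<in> S \<Longrightarrow> a s \<star> r s = s"
    and r_star: "\<And>s g. s \<in> S \<Longrightarrow> g \<in> carrier G \<Longrightarrow> r (g \<star> s) = r s"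
    using orbit_representatives by metis
  \<comment> \<open>On the orbit of \<open>s\<^sub>0\<close> the function \<open>F\<close> is
    already integral, so 0 is an admissible multiple; elsewhere taking the value at the
    representative makes \<open>u\<close> invariant.\<close>
  define u where "u s = (if s \<in> orbit_of s\<^sub>0 then 0 else c (r s))" for s
  have u: "invariant u" unfolding invariant_def u_def by (simp add: orbit_closed r_star)
  have u0: "u s\<^sub>0 = 0" unfolding u_def using self_in_orbit[OF s0] by simp
  define F' where "F' g s = F g s - of_int (lam g * u s) / of_int N" for g s
  have cocycle': "F' (g \<otimes> h) s - F' h (inv g \<star> s) - F' g s \<in> \<int>"
    if gh: "g \<in> carrier G" "h \<in> carrier G" "s \<in> S" for g h s
  proof -
    have us: "u (inv g \<star> s) = u s" using invariantD[OF u] gh by simp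
    have "N dvd (lam (g \<otimes> h) - (lam g + lam h)) * u s" using lam_mult[OF gh(1,2)] by (rule dvd_mult2)
    then have "N dvd lam (g \<otimes> h) * u s - lam h * u s - lam g * u s" by (simp add: algebra_simps)
    then have "rat_of_int (lam (g \<otimes> h) * u s - lam h * u s - lam g * u s) / of_int N \<in> \<int>"
      unfolding of_int_divide_in_Ints_iff[OF N0] .
    moreover have "F' (g \<otimes> h) s - F' h (inv g \<star> s) - F' g s = (F (g \<otimes> h) s - F h (inv g \<star> s) - F g s)
       - rat_of_int (lam (g \<otimes> h) * u s - lam h * u s - lam g * u s) / of_int N"
      unfolding F'_def us by (simp add: diff_divide_distrib)
    ultimately show ?thesis using Ints_diff[OF cocycle[OF gh]] by simp
  qed
  have F'_stab: "F' g (r s) \<in> \<int>" if g: "g \<in> carrier G" and s: "s \<in> S" and fx: "g \<star> r s = r s" for g s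
  proof (cases "r s \<in> orbit_of s\<^sub>0")
    case True
    then show ?thesis unfolding F'_def u_def using F_orbit g by simp
  next
    case False
    have "r (r s) = r s" using r_star[OF r[OF s] a[OF s]] ar[OF s] by simp
    then have "u (r s) = c (r s)" unfolding u_def using False by simp
    then show ?thesis using c[OF r[OF s] g fx] unfolding F'_def by (simp add: mult.commute)
  qed
  \<comment> \<open>As in Shapiro's lemma, a one-cocycle modulo Z that is integral on the
    stabilisers of the representatives is a coboundary; its primitive is read off along
    \<open>a s\<close>.\<close>
  define W where "W s = F' (a s) s" for s
  have W: "F' g s - W s + W (inv g \<star> s) - 0 \<in> \<int>" if g: "g \<in> carrier G" and s: "s \<in> S" for g s
  proof -
    define s' where "s' = inv g \<star> s"
    have s': "s' \<in> S" "r s' = r s" "g \<star> s' = s"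
      using g s r_star by (auto simp: s'_def star_closed)
    have ca: "a s \<in> carrier G" "a s' \<in> carrier G" using a s s' by auto
    define b where "b = inv (a s) \<otimes> (g \<otimes> a s')"
    have b: "b \<in> carrier G" using ca g by (simp add: b_def)
    have "b \<star> r s = inv (a s) \<star> g \<star> a s' \<star> r s'"
      unfolding b_def s'(2) using ca g r[OF s] by (simp add: star_mult star_closed)
    also have "\<dots> = inv (a s) \<star> a s \<star> r s" unfolding ar[OF s'(1)] ar[OF s] s'(3) ..
    finally have "b \<star> r s = r s" using ca r[OF s] by simp
    then have b_int: "F' b (r s) \<in> \<int>" using F'_stab[OF b s] by blast
    have eq: "a s \<otimes> b = g \<otimes> a s'" unfolding b_def using ca g by (simp flip: m_assoc)
    have asr: "inv (a s) \<star> s = r s" using ar[OF s] star_inv_star(1)[OF ca(1) r[OF s]] by simp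
    have 1: "F' (g \<otimes> a s') s - F' (a s') s' - F' g s \<in> \<int>"
      using cocycle'[OF g ca(2) s] unfolding s'_def .
    have 2: "F' (g \<otimes> a s') s - F' b (r s) - F' (a s) s \<in> \<int>"
      using cocycle'[OF ca(1) b s] unfolding eq asr .
    have "F' g s - W s + W s' - 0 = (F' (g \<otimes> a s') s - F' b (r s) - F' (a s) s)
       - (F' (g \<otimes> a s') s - F' (a s') s' - F' g s) + F' b (r s)"
      by (simp add: W_def)
    then show ?thesis using Ints_add[OF Ints_diff[OF 2 1] b_int] unfolding s'_def by (simp only:)
  qed
  have pot: "potential (\<lambda>g h s. f g h s - fc u g h s) F'"
  proof -
    obtain k' where k': "\<And>g h s. g \<in> carrier G \<Longrightarrow> h \<in> carrier G \<Longrightarrow> s \<in> S \<Longrightarrow>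
      rat_of_int (fc u g h s) = of_int (lam h * u (inv g \<star> s)) / of_int N
       - of_int (lam (g \<otimes> h) * u s) / of_int N + of_int (lam g * u s) / of_int N + k' g h"
      using fc_potential[OF u] unfolding potential_def by blast
    show ?thesis unfolding potential_def F'_def
      by (intro exI[of _ "\<lambda>g h. k g h - k' g h"] ballI) (simp add: k k' del: of_int_mult)
  qed
  have "cochain (\<lambda>g h s. f g h s - fc u g h s) \<in> B2 G M act"
    unfolding cochain_in_B2_iff_potential[OF pot] by (intro exI[of _ W] exI[of _ "\<lambda>_. 0"] ballI W)
  then show ?thesis using that u u0 by blast
qed

end

section \<open>The group of classes trivial on all cyclic subgroups\<close>

context quotient_lattice
begin

abbreviation cls :: "('g \<times> 'g \<Rightarrow> 'm) \<Rightarrow> ('g \<times> 'g \<Rightarrow> 'm) set"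
  where "cls z \<equiv> r_coset (Z2 G M act) (B2 G M act) z"

lemma group_Z2: "group (Z2 G M act)"
  using comm_group_Z2 by (rule comm_group.axioms(2))

lemma cls_eq_B2_iff: "z \<in> carrier (Z2 G M act) \<Longrightarrow> cls z = B2 G M act \<longleftrightarrow> z \<in> B2 G M act"
  using group.coset_join1[OF group_Z2 _ _ subgroup_B2] group.coset_join2[OF group_Z2 _ subgroup_B2]
  by blast

lemma cls_hom: "cls \<in> hom (Z2 G M act) (H2 G M act)"
  using normal.r_coset_hom_Mod[OF normal_B2] unfolding H2_def .

lemma cls_mult_B2:
  assumes "z \<in> carrier (Z2 G M act)" "b \<in> B2 G M act"
  shows "cls (b \<otimes>\<^bsub>Z2 G M act\<^esub> z) = cls z"
proof -
  interpret Z: group "Z2 G M act" by (rule group_Z2)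
  have "b \<otimes>\<^bsub>Z2 G M act\<^esub> z \<in> cls z" using assms(2) by (auto simp: r_coset_def)
  from Z.repr_independence[OF this assms(1) subgroup_B2] show ?thesis by simp
qed

lemma restrict_hom_Z2:
  assumes "subgroup H G"
  shows "(\<lambda>z. restrict z (H \<times> H)) \<in> hom (Z2 G M act) (Z2 (G\<lparr>carrier := H\<rparr>) M act)"
proof -
  interpret H: quotient_lattice "G\<lparr>carrier := H\<rparr>" S star M act q
    by (rule quotient_lattice_subgroup[OF assms])
  have HG: "h \<in> carrier G" if "h \<in> H" for h
    using assms that subgroup.mem_carrier by fast
  show ?thesis
  proof (rule homI)
    fix z assume "z \<in> carrier (Z2 G M act)"
    then have z: "z \<in> (carrier G \<times> carrier G) \<rightarrow>\<^sub>E carrier M"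
      and coc: "\<And>g h l. g \<in> carrier G \<Longrightarrow> h \<in> carrier G \<Longrightarrow> l \<in> carrier G \<Longrightarrow>
        act g (z (h, l)) \<otimes>\<^bsub>M\<^esub> z (g, h \<otimes> l) = z (g \<otimes> h, l) \<otimes>\<^bsub>M\<^esub> z (g, h)"
      unfolding carrier_Z2 by blast+
    have "restrict z (H \<times> H) \<in> H \<times> H \<rightarrow>\<^sub>E carrier M"
      using PiE_mem[OF z] HG by (intro restrict_PiE_iff[THEN iffD2]) auto
    moreover have "g \<otimes> h \<in> H" if "g \<in> H" "h \<in> H" for g h
      using subgroup.m_closed[OF assms] that .
    ultimately show "restrict z (H \<times> H) \<in> carrier (Z2 (G\<lparr>carrier := H\<rparr>) M act)"
      unfolding H.carrier_Z2 using coc[OF HG HG HG] by simp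
  next
    fix x y
    show "restrict (x \<otimes>\<^bsub>Z2 G M act\<^esub> y) (H \<times> H) =
      restrict x (H \<times> H) \<otimes>\<^bsub>Z2 (G\<lparr>carrier := H\<rparr>) M act\<^esub> restrict y (H \<times> H)"
      unfolding mult_Z2 H.mult_Z2 using HG by (auto simp: restrict_def fun_eq_iff)
  qed
qed

text \<open>Coboundaries restrict to coboundaries, so one representative of the class decides for
  the whole union in \<open>res2\<close>.\<close>

lemma res2_cls_eq_one_iff:
  assumes "subgroup H G" and z: "z \<in> carrier (Z2 G M act)"
  shows "res2 G M act H (cls z) = B2 (G\<lparr>carrier := H\<rparr>) M act \<longleftrightarrow>
    restrict z (H \<times> H) \<in> B2 (G\<lparr>carrier := H\<rparr>) M act"
proof -
  interpret H: quotient_lattice "G\<lparr>carrier := H\<rparr>" S star M act q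
    by (rule quotient_lattice_subgroup[OF assms(1)])
  interpret Z: group "Z2 G M act" by (rule group_Z2)
  note hom = restrict_hom_Z2[OF assms(1)]
  have z_in: "z \<in> cls z" using Z.rcos_self[OF z subgroup_B2] .
  have res_Z: "restrict f (H \<times> H) \<in> carrier (Z2 (G\<lparr>carrier := H\<rparr>) M act)" if "f \<in> carrier (Z2 G M act)" for f
    using hom that by (auto simp: hom_def)
  show ?thesis
  proof
    assume eq: "res2 G M act H (cls z) = B2 (G\<lparr>carrier := H\<rparr>) M act"
    have "restrict z (H \<times> H) \<in> H.cls (restrict z (H \<times> H))"
      using group.rcos_self[OF H.group_Z2 res_Z[OF z] H.subgroup_B2] .
    then have "restrict z (H \<times> H) \<in> res2 G M act H (cls z)"
      using z_in unfolding res2_def by blast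
    then show "restrict z (H \<times> H) \<in> B2 (G\<lparr>carrier := H\<rparr>) M act" by (simp only: eq)
  next
    assume zB: "restrict z (H \<times> H) \<in> B2 (G\<lparr>carrier := H\<rparr>) M act"
    have "H.cls (restrict f (H \<times> H)) = B2 (G\<lparr>carrier := H\<rparr>) M act" if f: "f \<in> cls z" for f
    proof -
      from f obtain b where b: "b \<in> B2 G M act" "f = b \<otimes>\<^bsub>Z2 G M act\<^esub> z" by (auto simp: r_coset_def)
      then have bZ: "b \<in> carrier (Z2 G M act)" using B2_subset_Z2 by blast
      have "restrict f (H \<times> H) \<in> B2 (G\<lparr>carrier := H\<rparr>) M act"
        unfolding b(2) hom_mult[OF hom bZ z]
        using subgroup.m_closed[OF H.subgroup_B2 restrict_B2[OF assms(1) b(1)] zB] .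
      then show ?thesis using H.cls_eq_B2_iff res_Z b(2) bZ z by simp
    qed
    then show "res2 G M act H (cls z) = B2 (G\<lparr>carrier := H\<rparr>) M act"
      unfolding res2_def using z_in by auto
  qed
qed

definition locally_trivial :: "('g \<times> 'g \<Rightarrow> 'm) \<Rightarrow> bool"
  where "locally_trivial z \<longleftrightarrow> (\<forall>g\<in>carrier G.
    restrict z (generate G {g} \<times> generate G {g}) \<in> B2 (G\<lparr>carrier := generate G {g}\<rparr>) M act)"

lemma carrier_Sha2_cycl:
  "carrier (Sha2_cycl G M act) = cls ` {z \<in> carrier (Z2 G M act). locally_trivial z}"
proof -
  have restrict_eq: "restrict x (carrier G) = restrict y (carrier G) \<longleftrightarrow> (\<forall>g\<in>carrier G. x g = y g)"
    for x y :: "'g \<Rightarrow> ('g \<times> 'g \<Rightarrow> 'm) set"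
    by (metis restrict_apply' restrict_ext)
  have "cls z \<in> carrier (Sha2_cycl G M act) \<longleftrightarrow> locally_trivial z" if z: "z \<in> carrier (Z2 G M act)" for z
  proof -
    have "cls z \<in> carrier (H2 G M act)" using z by (simp add: H2_def carrier_FactGroup)
    then have "cls z \<in> carrier (Sha2_cycl G M act) \<longleftrightarrow> (\<forall>g\<in>carrier G.
        res2 G M act (generate G {g}) (cls z) = B2 (G\<lparr>carrier := generate G {g}\<rparr>) M act)"
      by (simp add: Sha2_cycl_def kernel_def restrict_eq) (simp add: H2_def)
    then show ?thesis
      unfolding locally_trivial_def using res2_cls_eq_one_iff[OF subgroup_generate1 z] by simp
  qed
  moreover have "carrier (Sha2_cycl G M act) \<subseteq> cls ` carrier (Z2 G M act)"
    by (auto simp: Sha2_cycl_def kernel_def H2_def carrier_FactGroup)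
  ultimately show ?thesis by blast
qed

text \<open>Local triviality is a property of the class and not of its representative, which
  sharpens the description of the kernel as an image.\<close>

lemma cls_in_Sha2_cycl_iff:
  assumes "z \<in> carrier (Z2 G M act)"
  shows "cls z \<in> carrier (Sha2_cycl G M act) \<longleftrightarrow> locally_trivial z"
proof -
  have "locally_trivial z" if "cls z = cls z'" "locally_trivial z'" "z' \<in> carrier (Z2 G M act)" for z'
    using that assms res2_cls_eq_one_iff[OF subgroup_generate1]
    unfolding locally_trivial_def by metis
  then show ?thesis using assms unfolding carrier_Sha2_cycl by auto
qed

lemma subgroup_locally_trivial:
  "subgroup {z \<in> carrier (Z2 G M act). locally_trivial z} (Z2 G M act)"
proof -
  interpret Z: group "Z2 G M act" by (rule group_Z2)
  have *: "subgroup {z \<in> carrier (Z2 G M act). restrict z (H \<times> H) \<in> B2 (G\<lparr>carrier := H\<rparr>) M act} (Z2 G M act)"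
    if H: "subgroup H G" for H
  proof -
    interpret H: quotient_lattice "G\<lparr>carrier := H\<rparr>" S star M act q
      by (rule quotient_lattice_subgroup[OF H])
    interpret h: group_hom "Z2 G M act" "Z2 (G\<lparr>carrier := H\<rparr>) M act" "\<lambda>z. restrict z (H \<times> H)"
      using restrict_hom_Z2[OF H] group_Z2 H.group_Z2 by (simp add: group_hom_def group_hom_axioms_def)
    note B = H.subgroup_B2
    show ?thesis
    proof (rule Z.subgroupI)
      show "{z \<in> carrier (Z2 G M act). restrict z (H \<times> H) \<in> B2 (G\<lparr>carrier := H\<rparr>) M act} \<noteq> {}"
        using h.hom_one subgroup.one_closed[OF B] Z.one_closed by (metis (mono_tags, lifting) empty_iff mem_Collect_eq)
    qed (use h.hom_inv h.hom_mult subgroup.m_inv_closed[OF B] subgroup.m_closed[OF B] in auto)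
  qed
  have eq: "{z \<in> carrier (Z2 G M act). locally_trivial z} = (\<Inter>g\<in>carrier G. {z \<in> carrier (Z2 G M act).
     restrict z (generate G {g} \<times> generate G {g}) \<in> B2 (G\<lparr>carrier := generate G {g}\<rparr>) M act})"
    using one_closed by (auto simp: locally_trivial_def)
  show ?thesis unfolding eq using * subgroup_generate1 one_closed
    by (intro Z.subgroups_Inter) auto
qed

lemma group_Sha2_cycl: "group (Sha2_cycl G M act)"
proof -
  have "group (H2 G M act)"
    using normal.factorgroup_is_group[OF normal_B2] by (simp add: H2_def)
  then have gh: "group_hom (Z2 G M act) (H2 G M act) cls"
    using cls_hom group_Z2 by (simp add: group_hom_def group_hom_axioms_def)
  have "subgroup (carrier (Sha2_cycl G M act)) (H2 G M act)"
    unfolding carrier_Sha2_cycl by (rule group_hom.subgroup_img_is_subgroup[OF gh subgroup_locally_trivial])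
  from subgroup.subgroup_is_group[OF this \<open>group (H2 G M act)\<close>]
  show ?thesis by (simp add: Sha2_cycl_def)
qed

end

section \<open>A criterion for isomorphism with a quotient of invariant functions\<close>

context character_lattice
begin

text \<open>For invariant \<open>u\<close> with \<open>u s\<^sub>0 = 0\<close> this says that the
  class of \<open>fc u\<close> dies on the subgroup \<open>H\<close>. The integer \<open>x\<close>
  may vary with \<open>H\<close>; this is the gap between local and global triviality.\<close>

definition trivial_on :: "'g set \<Rightarrow> ('s \<Rightarrow> int) \<Rightarrow> bool"
  where "trivial_on H u \<longleftrightarrow> (\<exists>x. \<forall>s\<in>S. \<forall>g\<in>H. g \<star> s = s \<longrightarrow> N dvd lam g * (u s - x))"

lemma cochain_fc_add:
  "cochain (fc (\<lambda>s. u s + v s)) = cochain (fc u) \<otimes>\<^bsub>Z2 G M act\<^esub> cochain (fc v)"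
  unfolding cochain_mult by (simp add: fc_def[abs_def] distrib_left)

lemma cls_fc_eqI:
  assumes "invariant u" "invariant v" "u s\<^sub>0 = 0" "v s\<^sub>0 = 0" "trivial_on (carrier G) (\<lambda>s. u s - v s)"
  shows "cls (cochain (fc u)) = cls (cochain (fc v))"
proof -
  have inv: "invariant (\<lambda>s. u s - v s)" using assms(1,2) by (simp add: invariant_def)
  have "cochain (fc (\<lambda>s. u s - v s)) \<in> B2 G M act"
    using assms fc_in_B2_iff[OF inv] by (simp add: trivial_on_def)
  from cls_mult_B2[OF fc_in_Z2[OF assms(2)] this] show ?thesis
    by (simp flip: cochain_fc_add)
qed

text \<open>The isomorphism is induced by sending \<open>c\<close> to the class of
  \<open>fc (\<nu> c)\<close>. Additivity of \<open>\<nu>\<close> is asked for only up to functions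
  trivial on \<open>G\<close>, because the elements of \<open>A\<close> will be tuples of reduced
  residues, whose sum is reduced again. The element \<open>\<gamma>\<close> feeds the normalisation
  of locally trivial classes and so surjectivity.\<close>

theorem Sha2_cycl_iso:
  fixes A :: "'c monoid"
  assumes \<gamma>: "\<gamma> \<in> carrier G" "N dvd lam \<gamma> - 1"
    and A: "group A"
    and inv: "\<And>c. c \<in> carrier A \<Longrightarrow> invariant (\<nu> c)" and zero: "\<And>c. c \<in> carrier A \<Longrightarrow> \<nu> c s\<^sub>0 = 0"
    and loc: "\<And>c g. c \<in> carrier A \<Longrightarrow> g \<in> carrier G \<Longrightarrow> trivial_on (generate G {g}) (\<nu> c)"
    and add: "\<And>c d. c \<in> carrier A \<Longrightarrow> d \<in> carrier A \<Longrightarrow>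
      trivial_on (carrier G) (\<lambda>s. \<nu> (c \<otimes>\<^bsub>A\<^esub> d) s - (\<nu> c s + \<nu> d s))"
    and surj: "\<And>u. invariant u \<Longrightarrow> u s\<^sub>0 = 0 \<Longrightarrow> (\<And>g. g \<in> carrier G \<Longrightarrow> trivial_on (generate G {g}) u)
      \<Longrightarrow> \<exists>c\<in>carrier A. trivial_on (carrier G) (\<lambda>s. u s - \<nu> c s)"
  shows "Sha2_cycl G M act \<cong> A Mod {c \<in> carrier A. trivial_on (carrier G) (\<nu> c)}"
proof -
  define \<Phi> where "\<Phi> c = cls (cochain (fc (\<nu> c)))" for c
  have Z: "cochain (fc (\<nu> c)) \<in> carrier (Z2 G M act)" if "c \<in> carrier A" for c
    using fc_in_Z2[OF inv[OF that]] .
  have closed: "\<Phi> c \<in> carrier (Sha2_cycl G M act)" if c: "c \<in> carrier A" for c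
    unfolding \<Phi>_def cls_in_Sha2_cycl_iff[OF Z[OF c]] locally_trivial_def
    using restrict_fc_in_B2_iff[OF subgroup_generate1 inv[OF c] zero[OF c]] loc[OF c]
    by (auto simp: trivial_on_def)
  have "\<Phi> (c \<otimes>\<^bsub>A\<^esub> d) = \<Phi> c \<otimes>\<^bsub>H2 G M act\<^esub> \<Phi> d" if c: "c \<in> carrier A" and d: "d \<in> carrier A" for c d
  proof -
    have cd: "c \<otimes>\<^bsub>A\<^esub> d \<in> carrier A" using A c d by (simp add: group.is_monoid monoid.m_closed)
    have "invariant (\<lambda>s. \<nu> c s + \<nu> d s)" using inv[OF c] inv[OF d] by (simp add: invariant_def)
    then have "\<Phi> (c \<otimes>\<^bsub>A\<^esub> d) = cls (cochain (fc (\<lambda>s. \<nu> c s + \<nu> d s)))"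
      unfolding \<Phi>_def using inv[OF cd] zero[OF cd] zero[OF c] zero[OF d] add[OF c d]
      by (intro cls_fc_eqI) auto
    also have "\<dots> = \<Phi> c \<otimes>\<^bsub>H2 G M act\<^esub> \<Phi> d"
      unfolding \<Phi>_def cochain_fc_add using hom_mult[OF cls_hom Z[OF c] Z[OF d]] .
    finally show ?thesis .
  qed
  then have "\<Phi> \<in> hom A (Sha2_cycl G M act)"
    using closed by (intro homI) (auto simp: Sha2_cycl_def)
  then interpret h: group_hom A "Sha2_cycl G M act" \<Phi>
    using A group_Sha2_cycl by (simp add: group_hom_def group_hom_axioms_def)
  have "\<xi> \<in> \<Phi> ` carrier A" if \<xi>: "\<xi> \<in> carrier (Sha2_cycl G M act)" for \<xi>
  proof -
    obtain z where z: "z \<in> carrier (Z2 G M act)" "locally_trivial z" "\<xi> = cls z"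
      using \<xi> unfolding carrier_Sha2_cycl by auto
    obtain f where f: "z = cochain f" using z(1) cochain_surj unfolding carrier_Z2 by blast
    obtain u where u: "invariant u" "u s\<^sub>0 = 0" "cochain (\<lambda>g h s. f g h s - fc u g h s) \<in> B2 G M act"
      using locally_trivial_eq_fc[OF _ _ \<gamma>, of f] z unfolding f locally_trivial_def by blast
    have "cochain (\<lambda>g h s. f g h s - fc u g h s) \<otimes>\<^bsub>Z2 G M act\<^esub> cochain (fc u) = z"
      unfolding cochain_mult f by simp
    then have \<xi>_eq: "\<xi> = cls (cochain (fc u))"
      using cls_mult_B2[OF fc_in_Z2[OF u(1)] u(3)] z(3) by simp
    have "locally_trivial (cochain (fc u))"
      using cls_in_Sha2_cycl_iff[OF fc_in_Z2[OF u(1)]] \<xi> \<xi>_eq by simp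
    then have "trivial_on (generate G {g}) u" if "g \<in> carrier G" for g
      using restrict_fc_in_B2_iff[OF subgroup_generate1[OF that] u(1,2)] that
      by (simp add: trivial_on_def locally_trivial_def)
    then obtain c where c: "c \<in> carrier A" "trivial_on (carrier G) (\<lambda>s. u s - \<nu> c s)"
      using surj[OF u(1,2)] by blast
    have "\<xi> = \<Phi> c"
      unfolding \<xi>_eq \<Phi>_def using cls_fc_eqI[OF u(1) inv[OF c(1)] u(2) zero[OF c(1)] c(2)] .
    then show ?thesis using c(1) by blast
  qed
  then have img: "\<Phi> ` carrier A = carrier (Sha2_cycl G M act)" using closed by blast
  have "kernel A (Sha2_cycl G M act) \<Phi> = {c \<in> carrier A. trivial_on (carrier G) (\<nu> c)}"
  proof -
    have "\<Phi> c = \<one>\<^bsub>Sha2_cycl G M act\<^esub> \<longleftrightarrow> trivial_on (carrier G) (\<nu> c)" if c: "c \<in> carrier A" for c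
      using cls_eq_B2_iff[OF Z[OF c]] fc_in_B2_iff[OF inv[OF c] zero[OF c]]
      by (simp add: \<Phi>_def Sha2_cycl_def H2_def trivial_on_def)
    then show ?thesis by (auto simp: kernel_def)
  qed
  then have "A Mod {c \<in> carrier A. trivial_on (carrier G) (\<nu> c)} \<cong> Sha2_cycl G M act"
    using h.FactGroup_iso[OF img] by simp
  then show ?thesis
    using group.iso_sym[OF normal.factorgroup_is_group[OF h.normal_kernel]]
      \<open>kernel A (Sha2_cycl G M act) \<Phi> = {c \<in> carrier A. trivial_on (carrier G) (\<nu> c)}\<close> by simp
qed

end

section \<open>Galois theory inside the separable closure\<close>

lemma ks_simps [simp]:
  "carrier ks = UNIV" "x \<otimes>\<^bsub>ks\<^esub> y = x * y" "x \<oplus>\<^bsub>ks\<^esub> y = x + y" "\<one>\<^bsub>ks\<^esub> = 1" "\<zero>\<^bsub>ks\<^esub> = 0"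
  by (simp_all add: ring_of_type_algebra_def)

lemma field_ks: "field (ks :: 'a::field ring)" by (rule field_from_type_algebra)

lemma a_inv_ks [simp]: "\<ominus>\<^bsub>ks\<^esub> x = - (x::'a::field)"
proof -
  interpret K: field "ks :: 'a ring" by (rule field_ks)
  show ?thesis by (rule K.minus_equality) simp_all
qed

lemma inv_ks: "x \<noteq> 0 \<Longrightarrow> inv\<^bsub>ks\<^esub> x = inverse (x::'a::field)"
proof -
  interpret K: field "ks :: 'a ring" by (rule field_ks)
  assume "x \<noteq> 0" then show ?thesis by (intro K.inv_unique'[symmetric]) simp_all
qed

lemma subfield_ksD:
  fixes F :: "'a::field set"
  assumes "subfield F ks"
  shows "0 \<in> F" "1 \<in> F" "x \<in> F \<Longrightarrow> y \<in> F \<Longrightarrow> x + y \<in> F" "x \<in> F \<Longrightarrow> y \<in> F \<Longrightarrow> x * y \<in> F"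
    "x \<in> F \<Longrightarrow> - x \<in> F" "x \<in> F \<Longrightarrow> inverse x \<in> F"
proof -
  interpret K: field "ks :: 'a ring" by (rule field_ks)
  have s: "subring F ks" using assms by (rule subfieldE(1))
  show F0: "0 \<in> F" using subringE(2)[OF s] by simp
  show "1 \<in> F" using subringE(3)[OF s] by simp
  show "x \<in> F \<Longrightarrow> y \<in> F \<Longrightarrow> x + y \<in> F" using subringE(7)[OF s] by simp
  show "x \<in> F \<Longrightarrow> y \<in> F \<Longrightarrow> x * y \<in> F" using subringE(6)[OF s] by simp
  show "x \<in> F \<Longrightarrow> - x \<in> F" using subringE(5)[OF s] by simp
  show "x \<in> F \<Longrightarrow> inverse x \<in> F"
    using K.subfield_m_inv(1)[OF assms, of x] inv_ks[of x] F0 by (cases "x = 0") auto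
qed

lemma subfield_ksI:
  fixes F :: "'a::field set"
  assumes "1 \<in> F" "\<And>x y. x \<in> F \<Longrightarrow> y \<in> F \<Longrightarrow> x + y \<in> F" "\<And>x y. x \<in> F \<Longrightarrow> y \<in> F \<Longrightarrow> x * y \<in> F"
    "\<And>x. x \<in> F \<Longrightarrow> - x \<in> F" "\<And>x. x \<in> F \<Longrightarrow> inverse x \<in> F"
  shows "subfield F ks"
proof -
  interpret K: field "ks :: 'a ring" by (rule field_ks)
  have "subring F ks" by (rule K.subringI) (use assms in auto)
  then show ?thesis by (rule K.subfieldI') (simp add: assms inv_ks)
qed

text \<open>Pairs of a polynomial over the domain of \<open>R\<close> and its image. With both in
  one relation, arguments about the first component carry the second along.\<close>

definition polys :: "('a::field \<times> 'a) set \<Rightarrow> ('a poly \<times> 'a poly) set"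
  where "polys R = {(P, Q). \<forall>i. (coeff P i, coeff Q i) \<in> R}"

text \<open>Partial homomorphisms over \<open>k\<close>, given by their graphs. As every element is algebraic over \<open>k\<close>,
  closure under inverses and injectivity are automatic.\<close>

definition rel_hom :: "'a::field set \<Rightarrow> ('a \<times> 'a) set \<Rightarrow> bool"
  where "rel_hom k R \<longleftrightarrow> (\<forall>a\<in>k. (a, a) \<in> R) \<and>
    (\<forall>x y x' y'. (x, y) \<in> R \<longrightarrow> (x', y') \<in> R \<longrightarrow> (x + x', y + y') \<in> R \<and> (x * x', y * y') \<in> R) \<and>
    (\<forall>y. (0, y) \<in> R \<longrightarrow> y = 0)"

definition Aut :: "'a::field set \<Rightarrow> ('a \<Rightarrow> 'a) set"
  where "Aut k = {\<sigma>. bij \<sigma> \<and> (\<forall>x y. \<sigma> (x + y) = \<sigma> x + \<sigma> y) \<and> (\<forall>x y. \<sigma> (x * y) = \<sigma> x * \<sigma> y) \<and> (\<forall>x\<in>k. \<sigma> x = x)}"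

lemma Aut_D:
  assumes "\<sigma> \<in> Aut k"
  shows "bij \<sigma>" "\<sigma> (x + y) = \<sigma> x + \<sigma> y" "\<sigma> (x * y) = \<sigma> x * \<sigma> y" "x \<in> k \<Longrightarrow> \<sigma> x = x"
    "\<sigma> 0 = 0" "\<sigma> 1 = 1" "\<sigma> (- x) = - \<sigma> x" "\<sigma> (x - y) = \<sigma> x - \<sigma> y" "\<sigma> (inverse x) = inverse (\<sigma> x)"
    "\<sigma> x = 0 \<longleftrightarrow> x = 0" "\<sigma> (sum f A) = (\<Sum>a\<in>A. \<sigma> (f a))" "\<sigma> (prod f A) = (\<Prod>a\<in>A. \<sigma> (f a))"
proof -
  note a = assms[unfolded Aut_def, simplified]
  show b: "bij \<sigma>" and add: "\<sigma> (x + y) = \<sigma> x + \<sigma> y" and mult: "\<sigma> (x * y) = \<sigma> x * \<sigma> y"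
    and "x \<in> k \<Longrightarrow> \<sigma> x = x" for x y using a by auto
  show 0: "\<sigma> 0 = 0" using add[of 0 0] by (metis add.right_neutral add_left_cancel)
  show n: "\<sigma> x = 0 \<longleftrightarrow> x = 0" for x using 0 b by (metis bij_pointE)
  have "\<sigma> 1 * \<sigma> 1 = \<sigma> 1 * 1" using mult[of 1 1] by simp
  then show 1: "\<sigma> 1 = 1" using n[of 1] by (metis mult_left_cancel zero_neq_one)
  show m: "\<sigma> (- x) = - \<sigma> x" for x using add[of x "-x"] 0 by (simp add: eq_neg_iff_add_eq_0 add.commute)
  show "\<sigma> (x - y) = \<sigma> x - \<sigma> y" using add[of x "-y"] m[of y] by simp
  show "\<sigma> (inverse x) = inverse (\<sigma> x)"
    using mult[of x "inverse x"] 1 0 by (cases "x = 0") (auto simp: inverse_unique)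
  show "\<sigma> (sum f A) = (\<Sum>a\<in>A. \<sigma> (f a))" by (induction A rule: infinite_finite_induct) (auto simp: 0 add)
  show "\<sigma> (prod f A) = (\<Prod>a\<in>A. \<sigma> (f a))" by (induction A rule: infinite_finite_induct) (auto simp: 1 mult)
qed

lemma Aut_map_poly:
  assumes "\<sigma> \<in> Aut k"
  shows "\<sigma> (poly f x) = poly (map_poly \<sigma> f) (\<sigma> x)"
  by (induction f) (auto simp: Aut_D[OF assms] map_poly_pCons)

lemma Aut_poly:
  assumes "\<sigma> \<in> Aut k" "\<forall>i. coeff f i \<in> k"
  shows "\<sigma> (poly f x) = poly f (\<sigma> x)"
proof -
  have "map_poly \<sigma> f = f" using assms Aut_D[OF assms(1)] by (intro poly_eqI) (simp add: coeff_map_poly)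
  then show ?thesis using Aut_map_poly[OF assms(1)] by metis
qed

lemma Aut_inv:
  assumes "\<sigma> \<in> Aut k" shows "inv_into UNIV \<sigma> \<in> Aut k"
proof -
  have b: "bij \<sigma>" using Aut_D(1)[OF assms] .
  have s: "\<sigma> (inv_into UNIV \<sigma> x) = x" and i: "inv_into UNIV \<sigma> (\<sigma> x) = x" for x
    using b by (auto simp: bij_def surj_f_inv_f)
  have "bij (inv_into UNIV \<sigma>)" using b by (rule bij_imp_bij_inv)
  moreover have "inv_into UNIV \<sigma> (x + y) = inv_into UNIV \<sigma> x + inv_into UNIV \<sigma> y"
    "inv_into UNIV \<sigma> (x * y) = inv_into UNIV \<sigma> x * inv_into UNIV \<sigma> y" for x y
    using i[of "inv_into UNIV \<sigma> x + inv_into UNIV \<sigma> y"] i[of "inv_into UNIV \<sigma> x * inv_into UNIV \<sigma> y"]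
    by (simp_all add: Aut_D[OF assms] s)
  moreover have "inv_into UNIV \<sigma> x = x" if "x \<in> k" for x
    using i[of x] Aut_D(4)[OF assms that] by simp
  ultimately show ?thesis by (simp add: Aut_def)
qed

lemma Aut_comp: "\<sigma> \<in> Aut k \<Longrightarrow> \<tau> \<in> Aut k \<Longrightarrow> \<sigma> \<circ> \<tau> \<in> Aut k"
  unfolding Aut_def by (auto simp: bij_comp)

lemma Aut_mono: "k \<subseteq> E \<Longrightarrow> Aut E \<subseteq> Aut k"
  unfolding Aut_def by auto

lemma Gal_UNIV: "carrier (Gal k UNIV) = Aut (k :: 'a::field set)"
proof -
  have "\<sigma> \<in> carrier (Gal k UNIV) \<longleftrightarrow> \<sigma> \<in> Aut k" for \<sigma>
    using Aut_D(6)[of \<sigma> k]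
    by (auto simp: Gal_def Bij_def Ring.ring_hom_def Aut_def)
  then show ?thesis by blast
qed

section \<open>Extension of partial homomorphisms to automorphisms\<close>

locale separable_closure =
  fixes k :: "'a::field set"
  assumes sep_closure: "is_separable_closure_of k"
begin

lemma subfield_k: "subfield k ks" using sep_closure by (simp add: is_separable_closure_of_def)

lemmas k_closed = subfield_ksD[OF subfield_k]

lemma separable: "separable_over k x" using sep_closure by (simp add: is_separable_closure_of_def)

lemma separable_poly_root:
  "degree (f :: 'a poly) > 0 \<Longrightarrow> coprime f (pderiv f) \<Longrightarrow> \<exists>x. poly f x = 0"
  using sep_closure by (simp add: is_separable_closure_of_def)

lemma separable_closure_mono:
  assumes "subfield E ks" "k \<subseteq> E" shows "separable_closure E"
proof
  have "separable_over E x" for x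
    using separable[of x] assms(2) unfolding separable_over_def by blast
  then show "is_separable_closure_of E"
    using assms(1) separable_poly_root unfolding is_separable_closure_of_def by blast
qed

text \<open>A relation over \<open>k\<close> of least degree has nonzero constant term and can be
  solved for 1. Inverses are therefore polynomial expressions, which any partial homomorphism
  respects.\<close>

lemma inverse_eq_poly:
  assumes "x \<noteq> 0"
  obtains p where "\<forall>i. coeff p i \<in> k" "x * poly p x = 1"
proof -
  define P where "P f \<longleftrightarrow> f \<noteq> 0 \<and> (\<forall>i. coeff f i \<in> k) \<and> poly f x = 0" for f
  have "\<exists>f. P f" using separable[of x] unfolding separable_over_def P_def by blast
  then obtain f where f: "P f" and min: "\<And>g. P g \<Longrightarrow> degree f \<le> degree g"
    using ex_has_least_nat[of P _ degree] by blast
  obtain a g where fg: "f = pCons a g" by (cases f)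
  have g: "coeff g i \<in> k" for i using f unfolding P_def fg by (metis coeff_pCons_Suc)
  have a: "a \<in> k" using f unfolding P_def fg by (metis coeff_pCons_0)
  have *: "a + x * poly g x = 0" using f unfolding P_def fg by simp
  have "a \<noteq> 0"
  proof
    assume "a = 0"
    then have "P g" using f * g assms unfolding P_def fg by auto
    from min[OF this] show False using f \<open>P g\<close> unfolding fg P_def by (simp split: if_splits)
  qed
  have "x * poly g x = - a" using * by (simp add: eq_neg_iff_add_eq_0 add.commute)
  moreover have "x * poly (smult (- inverse a) g) x = - inverse a * (x * poly g x)" by simp
  ultimately have "x * poly (smult (- inverse a) g) x = 1" using \<open>a \<noteq> 0\<close> by (simp only:) simp
  moreover have "\<forall>i. coeff (smult (- inverse a) g) i \<in> k" using g a k_closed by simp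
  ultimately show ?thesis using that by blast
qed

context
  fixes R assumes R: "rel_hom k R"
begin

lemma R_k: "a \<in> k \<Longrightarrow> (a, a) \<in> R" using R by (simp add: rel_hom_def)
lemma R_add: "(x, y) \<in> R \<Longrightarrow> (x', y') \<in> R \<Longrightarrow> (x + x', y + y') \<in> R" using R by (simp add: rel_hom_def)
lemma R_mult: "(x, y) \<in> R \<Longrightarrow> (x', y') \<in> R \<Longrightarrow> (x * x', y * y') \<in> R" using R by (simp add: rel_hom_def)
lemma R_0: "(0, y) \<in> R \<Longrightarrow> y = 0" using R by (simp add: rel_hom_def)

lemma R_uminus: "(x, y) \<in> R \<Longrightarrow> (- x, - y) \<in> R"
  using R_mult[OF R_k[of "-1"]] k_closed by fastforce

lemma R_diff: "(x, y) \<in> R \<Longrightarrow> (x', y') \<in> R \<Longrightarrow> (x - x', y - y') \<in> R"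
  using R_add[OF _ R_uminus] by fastforce

lemma R_unique: "(x, y) \<in> R \<Longrightarrow> (x, y') \<in> R \<Longrightarrow> y = y'"
  using R_0 R_diff by fastforce

lemma R_sum: "(\<And>a. a \<in> A \<Longrightarrow> (f a, g a) \<in> R) \<Longrightarrow> (sum f A, sum g A) \<in> R"
  by (induction A rule: infinite_finite_induct) (auto intro: R_add R_k k_closed)

lemma R_power: "(x, y) \<in> R \<Longrightarrow> (x ^ n, y ^ n) \<in> R"
  by (induction n) (auto intro: R_mult R_k k_closed)

lemma polys_k: "\<forall>i. coeff p i \<in> k \<Longrightarrow> (p, p) \<in> polys R"
  by (simp add: polys_def R_k)

lemma polys_add: "(P, Q) \<in> polys R \<Longrightarrow> (A, B) \<in> polys R \<Longrightarrow> (P + A, Q + B) \<in> polys R"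
  by (simp add: polys_def R_add)

lemma polys_diff: "(P, Q) \<in> polys R \<Longrightarrow> (A, B) \<in> polys R \<Longrightarrow> (P - A, Q - B) \<in> polys R"
  by (simp add: polys_def R_diff)

lemma polys_mult: "(P, Q) \<in> polys R \<Longrightarrow> (A, B) \<in> polys R \<Longrightarrow> (P * A, Q * B) \<in> polys R"
  by (auto simp: polys_def coeff_mult intro!: R_sum R_mult)

lemma polys_monom: "(x, y) \<in> R \<Longrightarrow> (monom x n, monom y n) \<in> polys R"
  using k_closed(1) by (simp add: polys_def R_k)

lemma polys_0: "(0, Q) \<in> polys R \<Longrightarrow> Q = 0"
  by (rule poly_eqI) (auto simp: polys_def dest: R_0)

lemma polys_degree: "(P, Q) \<in> polys R \<Longrightarrow> degree Q \<le> degree P"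
proof (intro degree_le allI impI)
  fix i assume "(P, Q) \<in> polys R" "degree P < i"
  moreover from this(1) have "(coeff P i, coeff Q i) \<in> R" by (simp add: polys_def)
  ultimately have "(0, coeff Q i) \<in> R" by (simp add: coeff_eq_0)
  then show "coeff Q i = 0" by (rule R_0)
qed

lemma polys_eval:
  assumes "(P, Q) \<in> polys R" "(x, y) \<in> R" shows "(poly P x, poly Q y) \<in> R"
proof -
  have "poly Q y = (\<Sum>i\<le>degree P. coeff Q i * y ^ i)"
    unfolding poly_altdef using polys_degree[OF assms(1)]
    by (intro sum.mono_neutral_left) (auto simp: coeff_eq_0)
  then show ?thesis
    unfolding poly_altdef[of P] using assms by (auto simp: polys_def intro!: R_sum R_mult R_power)
qed

lemma R_inverse:
  assumes "(x, y) \<in> R" shows "(inverse x, inverse y) \<in> R"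
proof (cases "x = 0")
  case True
  then have "y = 0" using assms R_0 by blast
  then show ?thesis using True R_k k_closed(1) by simp
next
  case False
  obtain p where p: "\<forall>i. coeff p i \<in> k" "x * poly p x = 1" using inverse_eq_poly[OF False] by blast
  have px: "(poly p x, poly p y) \<in> R" using polys_eval[OF polys_k[OF p(1)] assms] .
  have "y * poly p y = 1" using R_mult[OF assms px] R_unique R_k k_closed(2) unfolding p(2) by blast
  then have "inverse y = poly p y" "inverse x = poly p x" using p(2) by (auto intro: inverse_unique)
  then show ?thesis using px by simp
qed

lemma R_inj: assumes "(x, 0) \<in> R" shows "x = 0"
proof (rule ccontr)
  assume "x \<noteq> 0"
  then have "(1, 0) \<in> R" using R_mult[OF assms R_inverse[OF assms]] by simp
  then show False using R_unique R_k[OF k_closed(2)] zero_neq_one by metis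
qed

lemma polys_monic:
  assumes "(P, Q) \<in> polys R" "lead_coeff P = 1" shows "degree Q = degree P" "lead_coeff Q = 1"
proof -
  have "(coeff P (degree P), coeff Q (degree P)) \<in> R" using assms(1) by (simp add: polys_def)
  then have 1: "coeff Q (degree P) = 1" using R_unique R_k[OF k_closed(2)] assms(2) by metis
  then have "degree P \<le> degree Q" by (intro le_degree) simp
  then show "degree Q = degree P" using polys_degree[OF assms(1)] by simp
  then show "lead_coeff Q = 1" using 1 by simp
qed

text \<open>The degree of \<open>A\<close> alone steers the division; \<open>B\<close> undergoes the
  parallel steps with the partner coefficients.\<close>

lemma polys_division:
  assumes PQ: "(P, Q) \<in> polys R" "lead_coeff P = 1" and AB: "(A, B) \<in> polys R"
  shows "\<exists>U V r t. (U, V) \<in> polys R \<and> (r, t) \<in> polys R \<and> A = P * U + r \<and> B = Q * V + t \<and>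
    (r = 0 \<or> degree r < degree P)"
  using AB
\<comment> \<open>The zero polynomial must rank below the nonzero constants, so that a step remains
  possible when both degrees are 0.\<close>
proof (induction "if A = 0 then 0 else Suc (degree A)" arbitrary: A B rule: less_induct)
  case less
  show ?case
  proof (cases "A = 0 \<or> degree A < degree P")
    case True
    have "(0, 0) \<in> polys R" using k_closed(1) by (intro polys_k) simp
    then show ?thesis using True less.prems
      by (intro exI[of _ 0] exI[of _ 0] exI[of _ A] exI[of _ B]) auto
  next
    case False
    define m where "m = degree A - degree P"
    define c where "c = lead_coeff A"
    \<comment> \<open>The coefficient of \<open>B\<close> at the degree of \<open>A\<close> is the
      partner of \<open>c\<close>; it is not assumed to be the leading coefficient of
      \<open>B\<close>.\<close>
    define d where "d = coeff B (degree A)"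
    have cd: "(monom c m, monom d m) \<in> polys R"
      using less.prems by (intro polys_monom) (simp add: polys_def c_def d_def)
    let ?A = "A - monom c m * P" and ?B = "B - monom d m * Q"
    have AB: "(?A, ?B) \<in> polys R" using polys_diff[OF less.prems polys_mult[OF cd PQ(1)]] .
    have mA: "m + degree P = degree A" using False by (simp add: m_def)
    have "degree (monom c m * P) \<le> degree A"
      using degree_mult_le[of "monom c m" P] degree_monom_le[of c m] mA by linarith
    then have "degree ?A \<le> degree A" by (intro degree_diff_le) auto
    moreover have "coeff ?A (degree A) = 0"
      using PQ(2) by (simp add: coeff_monom_mult c_def flip: mA)
    ultimately have "?A = 0 \<or> degree ?A < degree A" by (rule eq_zero_or_degree_less)
    then have "(if ?A = 0 then 0 else Suc (degree ?A)) < (if A = 0 then 0 else Suc (degree A))"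
      using False by auto
    from less.hyps[OF this AB] obtain U V r t where *: "(U, V) \<in> polys R" "(r, t) \<in> polys R"
      "?A = P * U + r" "?B = Q * V + t" "r = 0 \<or> degree r < degree P" by blast
    have "A = P * (U + monom c m) + r" "B = Q * (V + monom d m) + t"
      using *(3,4) by (simp_all add: algebra_simps)
    then show ?thesis using * polys_add[OF *(1) cd] by blast
  qed
qed

text \<open>\<open>P\<close> is the minimal polynomial of \<open>\<alpha>\<close> over the domain of
  \<open>R\<close> and \<open>Q\<close> its image. A separable polynomial over \<open>k\<close>
  killing \<open>\<alpha>\<close> is its own partner, so \<open>Q\<close> divides it and is
  separable; this is what will provide a root of \<open>Q\<close>.\<close>

lemma min_poly_exists:
  obtains P Q where "(P, Q) \<in> polys R" "lead_coeff P = 1" "poly P \<alpha> = 0"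
    "\<And>A B. (A, B) \<in> polys R \<Longrightarrow> poly A \<alpha> = 0 \<Longrightarrow> \<exists>U V. (U, V) \<in> polys R \<and> A = P * U \<and> B = Q * V"
    "coprime Q (pderiv Q)" "degree P > 0"
proof -
  define good where "good PQ \<longleftrightarrow> PQ \<in> polys R \<and> fst PQ \<noteq> 0 \<and> poly (fst PQ) \<alpha> = 0" for PQ
  obtain s where s: "s \<noteq> 0" "\<forall>i. coeff s i \<in> k" "coprime s (pderiv s)" "poly s \<alpha> = 0"
    using separable[of \<alpha>] unfolding separable_over_def by blast
  have "good (s, s)" using s polys_k by (simp add: good_def)
  then obtain PQ where PQ: "good PQ" and min: "\<And>AB. good AB \<Longrightarrow> degree (fst PQ) \<le> degree (fst AB)"
    using ex_has_least_nat[of good _ "\<lambda>PQ. degree (fst PQ)"] by blast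
  obtain P0 Q0 where PQ0: "PQ = (P0, Q0)" by (cases PQ)
  define P where "P = smult (inverse (lead_coeff P0)) P0"
  define Q where "Q = smult (inverse (coeff Q0 (degree P0))) Q0"
  have P0: "P0 \<noteq> 0" "poly P0 \<alpha> = 0" "(P0, Q0) \<in> polys R" using PQ by (auto simp: good_def PQ0)
  have pol: "(P, Q) \<in> polys R" using P0(3) unfolding P_def Q_def by (auto simp: polys_def intro!: R_mult R_inverse)
  have monic: "lead_coeff P = 1" using P0(1) by (simp add: P_def)
  have root: "poly P \<alpha> = 0" using P0(2) by (simp add: P_def)
  have deg: "degree P = degree P0" using P0(1) by (simp add: P_def)
  have dvd: "\<exists>U V. (U, V) \<in> polys R \<and> A = P * U \<and> B = Q * V" if AB: "(A, B) \<in> polys R" "poly A \<alpha> = 0" for A B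
  proof -
    obtain U V r t where *: "(U, V) \<in> polys R" "(r, t) \<in> polys R" "A = P * U + r" "B = Q * V + t"
      "r = 0 \<or> degree r < degree P" using polys_division[OF pol monic AB(1)] by blast
    have "poly r \<alpha> = 0" using AB(2) root unfolding *(3) by simp
    then have "r = 0" using *(2,5) min[of "(r, t)"] unfolding good_def PQ0 deg by force
    then have "t = 0" using *(2) polys_0 by blast
    then show ?thesis using * \<open>r = 0\<close> by auto
  qed
  have "\<exists>U V. (U, V) \<in> polys R \<and> s = P * U \<and> s = Q * V" using dvd[OF polys_k[OF s(2)] s(4)] .
  then obtain V where V: "s = Q * V" by blast
  have "coprime Q (pderiv Q)"
  proof (rule coprimeI)
    fix c assume c: "c dvd Q" "c dvd pderiv Q"
    then have "c dvd Q * V" "c dvd pderiv (Q * V)" unfolding pderiv_mult by (auto intro: dvd_add dvd_mult dvd_mult2)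
    then show "is_unit c" using s(3) unfolding V by (meson coprime_common_divisor)
  qed
  moreover have "degree P > 0"
  proof (rule ccontr)
    assume "\<not> degree P > 0"
    then obtain a where a: "P = [:a:]" by (metis degree_eq_zeroE neq0_conv)
    then show False using monic root by (simp add: a)
  qed
  ultimately show ?thesis using that[OF pol monic root dvd] by blast
qed

text \<open>The extension evaluates a pair of polynomials at \<open>\<alpha>\<close> and
  \<open>\<beta>\<close>. It is single-valued because whatever vanishes at \<open>\<alpha>\<close>
  is divisible by \<open>P\<close>, and its partner by \<open>Q\<close>.\<close>

lemma adjoin_rel_hom:
  assumes PQ: "(P, Q) \<in> polys R" "poly P \<alpha> = 0" "poly Q \<beta> = 0"
    and dvd: "\<And>A B. (A, B) \<in> polys R \<Longrightarrow> poly A \<alpha> = 0 \<Longrightarrow> \<exists>U V. (U, V) \<in> polys R \<and> A = P * U \<and> B = Q * V"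
  shows "\<exists>R'. rel_hom k R' \<and> R \<subseteq> R' \<and> (\<alpha>, \<beta>) \<in> R'"
proof (intro exI[of _ "(\<lambda>(A, B). (poly A \<alpha>, poly B \<beta>)) ` polys R"] conjI)
  let ?R = "(\<lambda>(A, B). (poly A \<alpha>, poly B \<beta>)) ` polys R"
  have mem: "(x, y) \<in> ?R \<longleftrightarrow> (\<exists>A B. (A, B) \<in> polys R \<and> x = poly A \<alpha> \<and> y = poly B \<beta>)" for x y by auto
  have const: "(x, y) \<in> R \<Longrightarrow> (x, y) \<in> ?R" for x y
    unfolding mem using polys_monom[of x y 0] by (intro exI[of _ "monom x 0"] exI[of _ "monom y 0"]) (simp add: poly_monom)
  then show "R \<subseteq> ?R" by auto
  show "(\<alpha>, \<beta>) \<in> ?R"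
    unfolding mem using polys_monom[OF R_k[OF k_closed(2)], of 1]
    by (intro exI[of _ "monom 1 1"]) (simp add: poly_monom)
  show "rel_hom k ?R"
    unfolding rel_hom_def
  proof (intro conjI ballI allI impI)
    fix y assume "(0, y) \<in> ?R"
    then obtain A B where AB: "(A, B) \<in> polys R" "poly A \<alpha> = 0" "y = poly B \<beta>" unfolding mem by metis
    then show "y = 0" using dvd[OF AB(1,2)] PQ(3) by auto
  next
    fix x y x' y' assume "(x, y) \<in> ?R" "(x', y') \<in> ?R"
    then obtain A B A' B' where *: "(A, B) \<in> polys R" "x = poly A \<alpha>" "y = poly B \<beta>"
      "(A', B') \<in> polys R" "x' = poly A' \<alpha>" "y' = poly B' \<beta>" unfolding mem by metis
    show "(x + x', y + y') \<in> ?R"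
      unfolding mem using polys_add[OF *(1,4)] *
      by (intro exI[of _ "A + A'"] exI[of _ "B + B'"]) simp
    show "(x * x', y * y') \<in> ?R"
      unfolding mem using polys_mult[OF *(1,4)] *
      by (intro exI[of _ "A * A'"] exI[of _ "B * B'"]) simp
  qed (use const R_k in blast)
qed

lemma rel_hom_extend1: "\<exists>R' \<beta>. rel_hom k R' \<and> R \<subseteq> R' \<and> (\<alpha>, \<beta>) \<in> R'"
proof -
  obtain P Q where PQ: "(P, Q) \<in> polys R" "lead_coeff P = 1" "poly P \<alpha> = 0"
    "\<And>A B. (A, B) \<in> polys R \<Longrightarrow> poly A \<alpha> = 0 \<Longrightarrow> \<exists>U V. (U, V) \<in> polys R \<and> A = P * U \<and> B = Q * V"
    "coprime Q (pderiv Q)" "degree P > 0" using min_poly_exists by blast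
  obtain \<beta> where "poly Q \<beta> = 0"
    using separable_poly_root[OF _ PQ(5)] polys_monic[OF PQ(1,2)] PQ(6) by auto
  then show ?thesis using adjoin_rel_hom[OF PQ(1,3) _ PQ(4)] by blast
qed

end

text \<open>Zorn's lemma gives a maximal partial homomorphism, and the one-step extension shows that
  it is total. Surjectivity comes from algebraicity: the finite root set of a polynomial over
  \<open>k\<close> is mapped injectively into itself.\<close>

theorem extend_to_Aut:
  assumes R: "rel_hom k R"
  obtains \<sigma> where "\<sigma> \<in> Aut k" "\<And>x y. (x, y) \<in> R \<Longrightarrow> \<sigma> x = y"
proof -
  define AA where "AA = {R'. rel_hom k R' \<and> R \<subseteq> R'}"
  have "\<exists>M\<in>AA. \<forall>Y\<in>AA. M \<subseteq> Y \<longrightarrow> Y = M"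
  proof (rule subset_Zorn_nonempty)
    show "AA \<noteq> {}" using R by (auto simp: AA_def)
    fix C assume C: "C \<noteq> {}" "subset.chain AA C"
    then have CA: "\<And>Y. Y \<in> C \<Longrightarrow> rel_hom k Y \<and> R \<subseteq> Y" by (auto simp: subset.chain_def AA_def)
    have two: "\<exists>Z\<in>C. u \<in> Z \<and> v \<in> Z" if uv: "u \<in> \<Union>C" "v \<in> \<Union>C" for u v
    proof -
      obtain Y where Y: "Y \<in> C" "u \<in> Y" using uv(1) by auto
      obtain Z where Z: "Z \<in> C" "v \<in> Z" using uv(2) by auto
      have "Y \<subseteq> Z \<or> Z \<subseteq> Y" using C(2) Y(1) Z(1) by (auto simp: subset_chain_def)
      then show ?thesis using Y Z by blast
    qed
    have "rel_hom k (\<Union>C)"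
      unfolding rel_hom_def
    proof (intro conjI ballI allI impI)
      fix a assume "a \<in> k"
      moreover obtain Z where "Z \<in> C" using C(1) by blast
      ultimately show "(a, a) \<in> \<Union>C" using CA[of Z] R_k[of Z a] by blast
    next
      fix y assume "(0, y) \<in> \<Union>C"
      then obtain Z where "Z \<in> C" "(0, y) \<in> Z" by blast
      then show "y = 0" using CA[of Z] R_0[of Z y] by blast
    next
      fix x y x' y' assume "(x, y) \<in> \<Union>C" "(x', y') \<in> \<Union>C"
      from two[OF this] obtain Z where "Z \<in> C" "(x, y) \<in> Z" "(x', y') \<in> Z" by blast
      then show "(x + x', y + y') \<in> \<Union>C" "(x * x', y * y') \<in> \<Union>C"
        using R_add[of Z x y x' y'] R_mult[of Z x y x' y'] CA[of Z] by blast+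
    qed
    moreover obtain Z where "Z \<in> C" using C(1) by blast
    ultimately show "\<Union>C \<in> AA" using CA[of Z] by (auto simp: AA_def)
  qed
  then obtain M where MA: "M \<in> AA" and max_M: "\<forall>Y\<in>AA. M \<subseteq> Y \<longrightarrow> Y = M" by (rule bexE)
  then have M: "rel_hom k M" "R \<subseteq> M" by (simp_all add: AA_def)
  have max: "Y = M" if "rel_hom k Y" "R \<subseteq> Y" "M \<subseteq> Y" for Y
    using bspec[OF max_M, of Y] that by (simp add: AA_def)
  have "\<exists>\<beta>. (\<alpha>, \<beta>) \<in> M" for \<alpha>
  proof -
    obtain R' \<beta> where "rel_hom k R'" "M \<subseteq> R'" "(\<alpha>, \<beta>) \<in> R'" using rel_hom_extend1[OF M(1)] by blast
    moreover from this have "R' = M" using M(2) by (intro max) auto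
    ultimately show ?thesis by blast
  qed
  then obtain \<sigma> where \<sigma>: "\<And>x. (x, \<sigma> x) \<in> M" by metis
  have \<sigma>_eq: "(x, y) \<in> M \<Longrightarrow> \<sigma> x = y" for x y by (rule R_unique[OF M(1) \<sigma>])
  have add: "\<sigma> (x + y) = \<sigma> x + \<sigma> y" and mult: "\<sigma> (x * y) = \<sigma> x * \<sigma> y" for x y
    using \<sigma>_eq[OF R_add[OF M(1) \<sigma> \<sigma>]] \<sigma>_eq[OF R_mult[OF M(1) \<sigma> \<sigma>]] .
  have fixed: "\<sigma> x = x" if "x \<in> k" for x by (rule \<sigma>_eq[OF R_k[OF M(1) that]])
  have inj: "inj \<sigma>"
  proof (rule injI)
    fix x y assume "\<sigma> x = \<sigma> y"
    then have "(x - y, 0) \<in> M" using R_diff[OF M(1) \<sigma>[of x] \<sigma>[of y]] by simp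
    from R_inj[OF M(1) this] show "x = y" by simp
  qed
  have "\<exists>x. \<sigma> x = y" for y
  proof -
    obtain s where s: "s \<noteq> 0" "\<forall>i. coeff s i \<in> k" "poly s y = 0"
      using separable[of y] unfolding separable_over_def by blast
    have "poly s (\<sigma> x) = 0" if "poly s x = 0" for x
      using polys_eval[OF M(1) polys_k[OF M(1) s(2)] \<sigma>[of x]] R_0[OF M(1)] that by simp
    then have "\<sigma> ` {x. poly s x = 0} \<subseteq> {x. poly s x = 0}" by auto
    from endo_inj_surj[OF poly_roots_finite[OF s(1)] this] inj
    have "\<sigma> ` {x. poly s x = 0} = {x. poly s x = 0}" by (simp add: inj_on_subset)
    then have "y \<in> \<sigma> ` {x. poly s x = 0}" using s(3) by simp
    then show ?thesis by blast
  qed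
  then have "y \<in> range \<sigma>" for y by (metis rangeI)
  then have "surj \<sigma>" by blast
  then have "\<sigma> \<in> Aut k" using inj add mult fixed by (simp add: Aut_def bij_def)
  moreover have "\<sigma> x = y" if "(x, y) \<in> R" for x y using \<sigma>_eq subsetD[OF M(2) that] .
  ultimately show ?thesis by (rule that)
qed

text \<open>The minimal polynomial of an element outside \<open>k\<close> is separable of degree at
  least 2 and has a second root; sending \<open>\<alpha>\<close> to that root extends to an
  automorphism.\<close>

theorem fixed_field_Aut:
  assumes "\<And>\<sigma>. \<sigma> \<in> Aut k \<Longrightarrow> \<sigma> \<alpha> = \<alpha>" shows "\<alpha> \<in> k"
proof (rule ccontr)
  assume \<alpha>: "\<alpha> \<notin> k"
  have R: "rel_hom k (Id_on k)" unfolding rel_hom_def using k_closed by auto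
  obtain P Q where PQ: "(P, Q) \<in> polys (Id_on k)" "lead_coeff P = 1" "poly P \<alpha> = 0"
    "\<And>A B. (A, B) \<in> polys (Id_on k) \<Longrightarrow> poly A \<alpha> = 0 \<Longrightarrow> \<exists>U V. (U, V) \<in> polys (Id_on k) \<and> A = P * U \<and> B = Q * V"
    "coprime Q (pderiv Q)" "degree P > 0" using min_poly_exists[OF R] by blast
  have PQ_eq: "P = Q" using PQ(1) by (intro poly_eqI) (auto simp: polys_def Id_on_iff)
  have Pk: "coeff P i \<in> k" for i
  proof -
    have "(coeff P i, coeff Q i) \<in> Id_on k" using PQ(1) by (simp add: polys_def)
    then show ?thesis by (rule Id_onE) simp
  qed
  obtain g where g: "P = [:- \<alpha>, 1:] * g" using PQ(3) by (auto simp: poly_eq_0_iff_dvd elim: dvdE)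
  have "g \<noteq> 0" using g PQ(6) by auto
  have "degree g > 0"
  proof (rule ccontr)
    assume "\<not> degree g > 0"
    then obtain c where c: "g = [:c:]" by (metis degree_eq_zeroE neq0_conv)
    then have "c = 1" using PQ(2) g \<open>g \<noteq> 0\<close> by (auto simp: g split: if_splits)
    then have "coeff P 0 = - \<alpha>" using g c by simp
    then show False using Pk[of 0] k_closed(5)[of "- \<alpha>"] \<alpha> by simp
  qed
  moreover have "coprime g (pderiv g)"
  proof (rule coprimeI)
    fix c assume c: "c dvd g" "c dvd pderiv g"
    then have "c dvd P" "c dvd pderiv P"
      unfolding g pderiv_mult by (blast intro: dvd_add dvd_mult dvd_mult2)+
    then show "is_unit c" using PQ(5) unfolding PQ_eq by (meson coprime_common_divisor)
  qed
  ultimately obtain \<beta> where \<beta>: "poly g \<beta> = 0" using separable_poly_root by blast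
  have "\<beta> \<noteq> \<alpha>"
  proof
    assume "\<beta> = \<alpha>"
    then have "[:- \<alpha>, 1:] dvd g" using \<beta> by (simp add: poly_eq_0_iff_dvd)
    then have "[:- \<alpha>, 1:] dvd P" "[:- \<alpha>, 1:] dvd pderiv P"
      unfolding g pderiv_mult by (blast intro: dvd_add dvd_mult dvd_mult2 dvd_refl)+
    then have "is_unit [:- \<alpha>, 1:]" using PQ(5) unfolding PQ_eq by (meson coprime_common_divisor)
    then show False by (simp add: is_unit_pCons_iff)
  qed
  have "poly Q \<beta> = 0" using \<beta> unfolding PQ_eq[symmetric] g by simp
  from adjoin_rel_hom[OF R PQ(1,3) this PQ(4)] obtain R' where R': "rel_hom k R'" "(\<alpha>, \<beta>) \<in> R'" by blast
  then obtain \<sigma> where "\<sigma> \<in> Aut k" "\<sigma> \<alpha> = \<beta>" using extend_to_Aut[OF R'(1)] R'(2) by metis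
  then show False using assms \<open>\<beta> \<noteq> \<alpha>\<close> by blast
qed

end

text \<open>Comparing a relation at \<open>m z x\<close> with its multiple by
  \<open>\<phi>\<^sub>0 z\<close> removes one function. The domain is an arbitrary set closed under
  a multiplication, since the lemma serves embeddings of fields as well as characters of the
  torus.\<close>

lemma dedekind_independence:
  fixes \<Phi> :: "('x \<Rightarrow> 'a::field) set"
  assumes "finite \<Phi>"
    and closed: "\<And>x y. x \<in> T \<Longrightarrow> y \<in> T \<Longrightarrow> m x y \<in> T"
    and hom: "\<And>\<phi> x y. \<phi> \<in> \<Phi> \<Longrightarrow> x \<in> T \<Longrightarrow> y \<in> T \<Longrightarrow> \<phi> (m x y) = \<phi> x * \<phi> y"
    and nonzero: "\<And>\<phi>. \<phi> \<in> \<Phi> \<Longrightarrow> \<exists>x\<in>T. \<phi> x \<noteq> 0"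
    and distinct: "\<And>\<phi> \<psi>. \<phi> \<in> \<Phi> \<Longrightarrow> \<psi> \<in> \<Phi> \<Longrightarrow> \<phi> \<noteq> \<psi> \<Longrightarrow> \<exists>x\<in>T. \<phi> x \<noteq> \<psi> x"
    and zero: "\<And>x. x \<in> T \<Longrightarrow> (\<Sum>\<phi>\<in>\<Phi>. c \<phi> * \<phi> x) = 0"
    and "\<phi> \<in> \<Phi>"
  shows "c \<phi> = 0"
  using assms(1,3-7)
proof (induction \<Phi> arbitrary: c \<phi> rule: finite_induct)
  case (insert \<phi>\<^sub>0 \<Phi>)
  have *: "c \<psi> = 0" if \<psi>: "\<psi> \<in> \<Phi>" for \<psi>
  proof -
    have "\<psi> \<noteq> \<phi>\<^sub>0" using \<psi> insert.hyps by auto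
    then obtain z where z: "z \<in> T" "\<psi> z \<noteq> \<phi>\<^sub>0 z" using insert.prems(3) \<psi> by blast
    have sum0: "(\<Sum>\<phi>\<in>\<Phi>. c \<phi> * (\<phi> z - \<phi>\<^sub>0 z) * \<phi> x) = 0" if x: "x \<in> T" for x
    proof -
      have 1: "c \<phi>\<^sub>0 * \<phi>\<^sub>0 x + (\<Sum>\<phi>\<in>\<Phi>. c \<phi> * \<phi> x) = 0"
        using insert.prems(4)[OF x] insert.hyps by simp
      have "c \<phi>\<^sub>0 * \<phi>\<^sub>0 (m z x) + (\<Sum>\<phi>\<in>\<Phi>. c \<phi> * \<phi> (m z x)) = 0"
        using insert.prems(4)[OF closed[OF z(1) x]] insert.hyps by simp
      moreover have "(\<Sum>\<phi>\<in>\<Phi>. c \<phi> * \<phi> (m z x)) = (\<Sum>\<phi>\<in>\<Phi>. c \<phi> * \<phi> z * \<phi> x)"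
        using insert.prems(1) z(1) x by (intro sum.cong) auto
      moreover have "\<phi>\<^sub>0 (m z x) = \<phi>\<^sub>0 z * \<phi>\<^sub>0 x" using insert.prems(1) z(1) x by simp
      ultimately have 2: "c \<phi>\<^sub>0 * (\<phi>\<^sub>0 z * \<phi>\<^sub>0 x) + (\<Sum>\<phi>\<in>\<Phi>. c \<phi> * \<phi> z * \<phi> x) = 0" by simp
      have "(\<Sum>\<phi>\<in>\<Phi>. c \<phi> * (\<phi> z - \<phi>\<^sub>0 z) * \<phi> x)
        = (\<Sum>\<phi>\<in>\<Phi>. c \<phi> * \<phi> z * \<phi> x) - \<phi>\<^sub>0 z * (\<Sum>\<phi>\<in>\<Phi>. c \<phi> * \<phi> x)"
        by (simp add: sum_distrib_left sum_subtractf[symmetric] algebra_simps)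
      also have "\<dots> = - (c \<phi>\<^sub>0 * (\<phi>\<^sub>0 z * \<phi>\<^sub>0 x)) - \<phi>\<^sub>0 z * (- (c \<phi>\<^sub>0 * \<phi>\<^sub>0 x))"
        using 1 2 by (simp only: add_eq_0_iff)
      finally show ?thesis by simp
    qed
    have "c \<psi> * (\<psi> z - \<phi>\<^sub>0 z) = 0"
      by (rule insert.IH[where c = "\<lambda>\<phi>. c \<phi> * (\<phi> z - \<phi>\<^sub>0 z)"]) (use sum0 insert.prems \<psi> in auto)
    then show ?thesis using z(2) by simp
  qed
  obtain x where x: "x \<in> T" "\<phi>\<^sub>0 x \<noteq> 0" using insert.prems(2) by blast
  have "(\<Sum>\<phi>\<in>\<Phi>. c \<phi> * \<phi> x) = 0" using * by simp
  then have "c \<phi>\<^sub>0 * \<phi>\<^sub>0 x = 0" using insert.prems(4)[OF x(1)] insert.hyps by simp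
  then show ?case using * x(2) insert.prems(5) by auto
qed simp

text \<open>One step of Gaussian elimination clears the last coordinate with the pivot
  \<open>t\<close>, whose coefficient is determined by the others.\<close>

lemma linear_dependence:
  fixes v :: "'x \<Rightarrow> nat \<Rightarrow> 'a::field"
  assumes "finite A" "card A > d"
  shows "\<exists>a. (\<exists>s\<in>A. a s \<noteq> 0) \<and> (\<forall>r<d. (\<Sum>s\<in>A. a s * v s r) = 0)"
  using assms
proof (induction d arbitrary: A v)
  case 0
  then obtain s where "s \<in> A" by (metis card_gt_0_iff equals0I)
  then show ?case by (intro exI[of _ "\<lambda>_. 1"]) auto
next
  case (Suc d)
  show ?case
  proof (cases "\<forall>s\<in>A. v s d = 0")
    case True
    obtain a where "\<exists>s\<in>A. a s \<noteq> 0" "\<forall>r<d. (\<Sum>s\<in>A. a s * v s r) = 0"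
      using Suc.IH[of A v] Suc.prems by auto
    then show ?thesis using True by (intro exI[of _ a]) (auto simp: less_Suc_eq)
  next
    case False
    then obtain t where t: "t \<in> A" "v t d \<noteq> 0" by blast
    let ?B = "A - {t}"
    define w where "w s r = v s r - v s d / v t d * v t r" for s r
    have "finite ?B" "card ?B > d" using Suc.prems t(1) by simp_all
    from Suc.IH[OF this, of w] obtain a where a: "\<exists>s\<in>?B. a s \<noteq> 0" "\<forall>r<d. (\<Sum>s\<in>?B. a s * w s r) = 0"
      by blast
    define a' where "a' s = (if s = t then - (\<Sum>s\<in>?B. a s * (v s d / v t d)) else a s)" for s
    have eq: "(\<Sum>s\<in>A. a' s * v s r) = (\<Sum>s\<in>?B. a s * w s r)" for r
    proof -
      have "(\<Sum>s\<in>A. a' s * v s r) = a' t * v t r + (\<Sum>s\<in>?B. a' s * v s r)"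
        using Suc.prems(1) t(1) by (simp add: sum.remove)
      also have "(\<Sum>s\<in>?B. a' s * v s r) = (\<Sum>s\<in>?B. a s * v s r)"
        by (intro sum.cong) (auto simp: a'_def)
      finally show ?thesis
        by (simp add: a'_def w_def sum_distrib_right sum_subtractf right_diff_distrib mult.assoc)
    qed
    have "(\<Sum>s\<in>?B. a s * w s d) = 0" using t(2) by (simp add: w_def)
    then have "\<forall>r<Suc d. (\<Sum>s\<in>A. a' s * v s r) = 0" using a(2) by (auto simp: eq less_Suc_eq)
    moreover have "\<exists>s\<in>A. a' s \<noteq> 0" using a(1) by (auto simp: a'_def)
    ultimately show ?thesis by blast
  qed
qed

section \<open>Galois groups of finite extensions and the absolute Galois group\<close>

lemma carrier_Gal:
  fixes F :: "'a::field set"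
  assumes "subfield F ks"
  shows "g \<in> carrier (Gal k F) \<longleftrightarrow> g \<in> extensional F \<and> bij_betw g F F \<and>
    (\<forall>x\<in>F. \<forall>y\<in>F. g (x + y) = g x + g y) \<and> (\<forall>x\<in>F. \<forall>y\<in>F. g (x * y) = g x * g y) \<and> (\<forall>x\<in>k. g x = x)"
    (is "_ \<longleftrightarrow> ?R")
proof
  assume R: ?R
  note F = subfield_ksD[OF assms]
  have g: "g x \<in> F" if "x \<in> F" for x using R that bij_betw_apply by fastforce
  have inj: "inj_on g F" using R bij_betw_imp_inj_on by blast
  have "g 0 + g 0 = g 0 + 0" using R F(1) by (metis add.right_neutral)
  then have g0: "g 0 = 0" by (rule add_left_imp_eq)
  have "g 1 * g 1 = g 1 * 1" using R F(2) by (metis mult.right_neutral)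
  moreover have "g 1 \<noteq> 0" using inj_onD[OF inj, of 1 0] F(1,2) g0 by auto
  ultimately have "g 1 = 1" by simp
  then show "g \<in> carrier (Gal k F)" using R g by (auto simp: Gal_def Bij_def Ring.ring_hom_def)
qed (auto simp: Gal_def Bij_def Ring.ring_hom_def)

lemma mult_Gal:
  "g \<in> carrier (Gal k F) \<Longrightarrow> h \<in> carrier (Gal k F) \<Longrightarrow> g \<otimes>\<^bsub>Gal k F\<^esub> h = (\<lambda>x\<in>F. g (h x))"
  by (auto simp: Gal_def BijGroup_def compose_def)

lemma one_Gal: "\<one>\<^bsub>Gal k F\<^esub> = (\<lambda>x\<in>F. x)"
  by (simp add: Gal_def BijGroup_def)

lemma Gal_closed: "g \<in> carrier (Gal k F) \<Longrightarrow> x \<in> F \<Longrightarrow> g x \<in> F"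
  by (auto simp: Gal_def Bij_def bij_betw_apply)

lemma group_Gal:
  fixes F :: "'a::field set"
  assumes F: "subfield F ks" "k \<subseteq> F"
  shows "group (Gal k F)"
proof -
  interpret B: group "BijGroup F" by (rule group_BijGroup)
  note c = subfield_ksD[OF F(1)]
  have B: "carrier (Gal k F) \<subseteq> Bij F" by (auto simp: Gal_def)
  have "subgroup (carrier (Gal k F)) (BijGroup F)"
  proof (rule B.subgroupI)
    show "carrier (Gal k F) \<subseteq> carrier (BijGroup F)" using B by (simp add: BijGroup_def)
    have "(\<lambda>x\<in>F. x) \<in> carrier (Gal k F)"
      unfolding carrier_Gal[OF F(1)] using F(2) c by (auto simp: bij_betw_def inj_on_def)
    then show "carrier (Gal k F) \<noteq> {}" by blast
  next
    fix g assume g: "g \<in> carrier (Gal k F)"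
    note g' = g[unfolded carrier_Gal[OF F(1)]]
    have inj: "inj_on g F" and img: "g ` F = F" using g' by (auto simp: bij_betw_def)
    let ?i = "\<lambda>x\<in>F. inv_into F g x"
    have i: "?i x \<in> F" "g (?i x) = x" if "x \<in> F" for x
      using that img by (auto simp: inv_into_into f_inv_into_f)
    have ig: "?i y = x" if "x \<in> F" "g x = y" for x y
      using that inj Gal_closed[OF g] by (auto simp: inv_into_f_f)
    have "?i \<in> carrier (Gal k F)"
      unfolding carrier_Gal[OF F(1)]
    proof (intro conjI ballI)
      show "bij_betw ?i F F" using g B restrict_inv_into_Bij by (auto simp: Bij_def)
      fix x y assume xy: "x \<in> F" "y \<in> F"
      show "?i (x + y) = ?i x + ?i y" using xy i c g' by (intro ig) auto
      show "?i (x * y) = ?i x * ?i y" using xy i c g' by (intro ig) auto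
    next
      fix x assume "x \<in> k" then show "?i x = x" using F(2) g' by (intro ig) auto
    qed simp
    then show "inv\<^bsub>BijGroup F\<^esub> g \<in> carrier (Gal k F)" using inv_BijGroup g B by (metis subsetD)
  next
    fix g h assume gh: "g \<in> carrier (Gal k F)" "h \<in> carrier (Gal k F)"
    have "g \<otimes>\<^bsub>BijGroup F\<^esub> h = compose F g h" using gh B by (auto simp: BijGroup_def)
    moreover have "compose F g h \<in> Bij F" using gh B compose_Bij by blast
    ultimately show "g \<otimes>\<^bsub>BijGroup F\<^esub> h \<in> carrier (Gal k F)"
      using gh Gal_closed[OF gh(2)] F(2) c
      unfolding carrier_Gal[OF F(1)] by (auto simp: Bij_def compose_def subset_iff)
  qed
  from subgroup.subgroup_is_group[OF this B.group_axioms] show ?thesis by (simp add: Gal_def)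
qed

context separable_closure
begin

text \<open>The graph of \<open>g\<close> is a partial homomorphism, to which the extension theorem
  applies.\<close>

lemma Gal_lift:
  assumes F: "subfield F ks" "k \<subseteq> F" and g: "g \<in> carrier (Gal k F)"
  obtains \<sigma> where "\<sigma> \<in> Aut k" "restrict \<sigma> F = g"
proof -
  note c = subfield_ksD[OF F(1)]
  note g' = g[unfolded carrier_Gal[OF F(1)]]
  have "bij_betw g F F" using g' by blast
  have "g 0 + g 0 = g 0 + 0" using g' c(1) by (metis add.right_neutral)
  then have "g 0 = 0" by (rule add_left_imp_eq)
  then have "rel_hom k ((\<lambda>x. (x, g x)) ` F)"
    unfolding rel_hom_def using g' c F(2) by (auto simp: image_iff intro!: bexI)
  from extend_to_Aut[OF this] obtain \<sigma> where \<sigma>: "\<sigma> \<in> Aut k" "\<And>x y. (x, y) \<in> (\<lambda>x. (x, g x)) ` F \<Longrightarrow> \<sigma> x = y"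
    by blast
  have "restrict \<sigma> F = g" using \<sigma>(2) g' by (auto simp: fun_eq_iff extensional_def)
  then show ?thesis using that \<sigma>(1) by blast
qed

lemma map_poly_Aut_mult:
  assumes "\<sigma> \<in> Aut k" shows "map_poly \<sigma> (f * g) = map_poly \<sigma> f * map_poly \<sigma> g"
  by (rule poly_eqI) (simp add: coeff_map_poly coeff_mult Aut_D[OF assms])

lemma finite_conjugates: "finite {\<sigma> x | \<sigma>. \<sigma> \<in> Aut k}"
proof -
  obtain s where s: "s \<noteq> 0" "\<forall>i. coeff s i \<in> k" "poly s x = 0"
    using separable[of x] unfolding separable_over_def by blast
  have "{\<sigma> x | \<sigma>. \<sigma> \<in> Aut k} \<subseteq> {y. poly s y = 0}"
    using Aut_poly[OF _ s(2), of _ x] s(3) Aut_D(5) by fastforce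
  then show ?thesis using poly_roots_finite[OF s(1)] finite_subset by blast
qed

text \<open>The product of the linear factors over the orbit of \<open>\<alpha>\<close> under
  \<open>Gal k F\<close> has invariant coefficients, hence coefficients in \<open>k\<close>. Every
  automorphism over \<open>k\<close> sends \<open>\<alpha>\<close> to a root of it, and all its
  roots lie in \<open>F\<close>.\<close>

lemma galois_stable:
  assumes F: "finite_galois_extension k F" and \<sigma>: "\<sigma> \<in> Aut k" and \<alpha>: "\<alpha> \<in> F"
  shows "\<sigma> \<alpha> \<in> F"
proof -
  have sub: "subfield F ks" "k \<subseteq> F"
    using F by (auto simp: finite_galois_extension_def finite_extension_def)
  note c = subfield_ksD[OF sub(1)]
  define orb where "orb = (\<lambda>g. g \<alpha>) ` carrier (Gal k F)"
  have lift: "\<exists>\<tau>\<in>Aut k. restrict \<tau> F = g" if "g \<in> carrier (Gal k F)" for g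
    using Gal_lift[OF sub that] by blast
  have "orb \<subseteq> {\<sigma> \<alpha> | \<sigma>. \<sigma> \<in> Aut k}"
  proof
    fix y assume "y \<in> orb"
    then obtain g where g: "g \<in> carrier (Gal k F)" "y = g \<alpha>" by (auto simp: orb_def)
    then obtain \<tau> where "\<tau> \<in> Aut k" "restrict \<tau> F = g" using lift by blast
    then show "y \<in> {\<sigma> \<alpha> | \<sigma>. \<sigma> \<in> Aut k}" using g(2) \<alpha> by auto
  qed
  then have fin: "finite orb" using finite_conjugates finite_subset by blast
  have orb_F: "orb \<subseteq> F" using Gal_closed \<alpha> by (auto simp: orb_def)
  define f where "f = (\<Prod>\<beta>\<in>orb. [:- \<beta>, 1:])"
  have diff: "x - y \<in> F" if "x \<in> F" "y \<in> F" for x y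
    using c(3)[OF that(1) c(5)[OF that(2)]] by simp
  have coeff_F: "\<forall>i. coeff (\<Prod>\<beta>\<in>B. [:- \<beta>, 1:]) i \<in> F" if "finite B" "B \<subseteq> F" for B
    using that
  proof (induction B rule: finite_induct)
    case empty then show ?case using c by (simp add: one_pCons coeff_pCons split: nat.split)
  next
    case (insert \<beta> B)
    then show ?case using c by (auto simp: coeff_pCons intro!: diff split: nat.split)
  qed
  have map_f: "map_poly \<tau> (\<Prod>\<beta>\<in>B. [:- \<beta>, 1:]) = (\<Prod>\<beta>\<in>B. [:- \<tau> \<beta>, 1:])" if "\<tau> \<in> Aut k" "finite B" for \<tau> B
    using that(2)
    by (induction B rule: finite_induct)
      (simp_all add: map_poly_Aut_mult[OF that(1)] Aut_D[OF that(1)] map_poly_pCons one_pCons del: mult_pCons_left)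
  have "coeff f i \<in> k" for i
  proof -
    have "g (coeff f i) = coeff f i" if g: "g \<in> carrier (Gal k F)" for g
    proof -
      obtain \<tau> where \<tau>: "\<tau> \<in> Aut k" "restrict \<tau> F = g" using lift[OF g] by blast
      have \<tau>g: "\<tau> x = g x" if "x \<in> F" for x using \<tau>(2) that by auto
      have "\<tau> ` orb \<subseteq> orb"
      proof
        fix y assume "y \<in> \<tau> ` orb"
        then obtain h where h: "h \<in> carrier (Gal k F)" "y = \<tau> (h \<alpha>)" by (auto simp: orb_def)
        have "y = (g \<otimes>\<^bsub>Gal k F\<^esub> h) \<alpha>"
          using h g \<alpha> Gal_closed[OF h(1) \<alpha>] by (simp add: mult_Gal \<tau>g)
        moreover have "g \<otimes>\<^bsub>Gal k F\<^esub> h \<in> carrier (Gal k F)"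
          using group_Gal[OF sub] g h(1) by (simp add: group.is_monoid monoid.m_closed)
        ultimately show "y \<in> orb" by (auto simp: orb_def)
      qed
      moreover have inj: "inj_on \<tau> orb" using Aut_D(1)[OF \<tau>(1)] by (meson bij_is_inj inj_on_subset subset_UNIV)
      ultimately have "\<tau> ` orb = orb" using endo_inj_surj[OF fin] by blast
      have "map_poly \<tau> f = (\<Prod>\<beta>\<in>orb. [:- \<tau> \<beta>, 1:])" unfolding f_def using map_f[OF \<tau>(1) fin] .
      also have "\<dots> = (\<Prod>\<beta>\<in>\<tau> ` orb. [:- \<beta>, 1:])" using inj by (simp add: prod.reindex)
      also have "\<dots> = f" unfolding \<open>\<tau> ` orb = orb\<close> f_def ..
      finally have "coeff (map_poly \<tau> f) i = coeff f i" by simp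
      then show ?thesis
        using coeff_F[OF fin orb_F] by (simp add: coeff_map_poly Aut_D[OF \<tau>(1)] \<tau>g f_def)
    qed
    then show ?thesis using F coeff_F[OF fin orb_F] unfolding finite_galois_extension_def f_def by blast
  qed
  then have "poly f (\<sigma> \<alpha>) = \<sigma> (poly f \<alpha>)" using Aut_poly[OF \<sigma>] by simp
  also have "poly f \<alpha> = 0"
  proof -
    have "(\<lambda>x\<in>F. x) \<in> carrier (Gal k F)"
      using carrier_Gal[OF sub(1)] sub c by (auto simp: bij_betw_def inj_on_def)
    then have "\<alpha> \<in> orb" using \<alpha> unfolding orb_def by (intro image_eqI[of _ _ "\<lambda>x\<in>F. x"]) auto
    then show ?thesis using fin by (auto simp: f_def poly_prod intro!: prod_zero)
  qed
  finally have "poly f (\<sigma> \<alpha>) = 0" using Aut_D(5)[OF \<sigma>] by simp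
  then have "\<sigma> \<alpha> \<in> orb" using fin by (auto simp: f_def poly_prod)
  then show ?thesis using orb_F by blast
qed

lemma restrict_Aut_Gal:
  assumes F: "finite_galois_extension k F" and \<sigma>: "\<sigma> \<in> Aut k"
  shows "restrict \<sigma> F \<in> carrier (Gal k F)"
proof -
  have sub: "subfield F ks" "k \<subseteq> F"
    using F by (auto simp: finite_galois_extension_def finite_extension_def)
  note c = subfield_ksD[OF sub(1)]
  have b: "bij \<sigma>" using Aut_D(1)[OF \<sigma>] .
  have "\<sigma> ` F = F"
  proof
    show "F \<subseteq> \<sigma> ` F"
    proof
      fix y assume "y \<in> F"
      then have "inv_into UNIV \<sigma> y \<in> F" using galois_stable[OF F Aut_inv[OF \<sigma>]] by blast
      moreover have "\<sigma> (inv_into UNIV \<sigma> y) = y" using b by (simp add: bij_is_surj surj_f_inv_f)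
      ultimately show "y \<in> \<sigma> ` F" by (metis imageI)
    qed
  qed (use galois_stable[OF F \<sigma>] in auto)
  then have "bij_betw \<sigma> F F" using b by (metis bij_betw_def bij_is_inj inj_on_subset subset_UNIV)
  then show ?thesis
    unfolding carrier_Gal[OF sub(1)] using sub(2) c Aut_D[OF \<sigma>] by auto
qed

lemma galois_image: "finite_galois_extension k F \<Longrightarrow> (\<lambda>\<sigma>. restrict \<sigma> F) ` Aut k = carrier (Gal k F)"
proof -
  assume F: "finite_galois_extension k F"
  then have sub: "subfield F ks" "k \<subseteq> F" by (auto simp: finite_galois_extension_def finite_extension_def)
  show ?thesis
  proof
    show "carrier (Gal k F) \<subseteq> (\<lambda>\<sigma>. restrict \<sigma> F) ` Aut k"
    proof
      fix g assume "g \<in> carrier (Gal k F)"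
      from Gal_lift[OF sub this] obtain \<sigma> where "\<sigma> \<in> Aut k" "restrict \<sigma> F = g" by blast
      then show "g \<in> (\<lambda>\<sigma>. restrict \<sigma> F) ` Aut k" by blast
    qed
  qed (use restrict_Aut_Gal[OF F] in blast)
qed

text \<open>The separable closure of \<open>k\<close> is also one of \<open>E\<close>, so the fixed
  field theorem over \<open>E\<close> applies; automorphisms over \<open>E\<close> restrict to
  elements of the Galois group fixing \<open>E\<close>.\<close>

lemma fixed_intermediate:
  assumes F: "finite_galois_extension k F" and E: "subfield E ks" "k \<subseteq> E" "E \<subseteq> F"
    and \<alpha>: "\<alpha> \<in> F" "\<And>g. g \<in> carrier (Gal k F) \<Longrightarrow> (\<forall>x\<in>E. g x = x) \<Longrightarrow> g \<alpha> = \<alpha>"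
  shows "\<alpha> \<in> E"
proof -
  interpret E: separable_closure E by (rule separable_closure_mono[OF E(1,2)])
  show ?thesis
  proof (rule E.fixed_field_Aut)
    fix \<sigma> assume \<sigma>: "\<sigma> \<in> Aut E"
    then have "restrict \<sigma> F \<in> carrier (Gal k F)" using restrict_Aut_Gal[OF F] Aut_mono[OF E(2)] by blast
    moreover have "\<forall>x\<in>E. restrict \<sigma> F x = x" using E(3) Aut_D(4)[OF \<sigma>] by (auto simp: subset_iff)
    ultimately have "restrict \<sigma> F \<alpha> = \<alpha>" by (rule \<alpha>(2))
    then show "\<sigma> \<alpha> = \<alpha>" using \<alpha>(1) by simp
  qed
qed

text \<open>For a field \<open>F\<close> containing \<open>k\<close> these are all the
  \<open>k\<close>-embeddings of \<open>F\<close>, since each one extends to an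
  automorphism.\<close>

definition Emb :: "'a set \<Rightarrow> ('a \<Rightarrow> 'a) set"
  where "Emb F = (\<lambda>\<sigma>. restrict \<sigma> F) ` Aut k"

lemma Emb_D:
  assumes "\<tau> \<in> Emb F" "subfield F ks"
  shows "x \<in> F \<Longrightarrow> y \<in> F \<Longrightarrow> \<tau> (x * y) = \<tau> x * \<tau> y" "x \<in> F \<Longrightarrow> y \<in> F \<Longrightarrow> \<tau> (x + y) = \<tau> x + \<tau> y"
    "\<tau> 1 = 1" "\<tau> 0 = 0" "x \<in> F \<Longrightarrow> x \<in> k \<Longrightarrow> \<tau> x = x" "\<tau> \<in> extensional F"
    "(\<And>a. a \<in> A \<Longrightarrow> f a \<in> F) \<Longrightarrow> \<tau> (sum f A) = (\<Sum>a\<in>A. \<tau> (f a))"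
proof -
  note c = subfield_ksD[OF assms(2)]
  obtain \<sigma> where \<sigma>: "\<sigma> \<in> Aut k" "\<tau> = restrict \<sigma> F" using assms(1) by (auto simp: Emb_def)
  show "x \<in> F \<Longrightarrow> y \<in> F \<Longrightarrow> \<tau> (x * y) = \<tau> x * \<tau> y" "x \<in> F \<Longrightarrow> y \<in> F \<Longrightarrow> \<tau> (x + y) = \<tau> x + \<tau> y"
    "\<tau> 1 = 1" "\<tau> 0 = 0" "x \<in> F \<Longrightarrow> x \<in> k \<Longrightarrow> \<tau> x = x" "\<tau> \<in> extensional F"
    using c Aut_D[OF \<sigma>(1)] by (simp_all add: \<sigma>(2))
  assume f: "\<And>a. a \<in> A \<Longrightarrow> f a \<in> F"
  then have "sum f A \<in> F" by (induction A rule: infinite_finite_induct) (auto simp: c)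
  then show "\<tau> (sum f A) = (\<Sum>a\<in>A. \<tau> (f a))"
    using f by (simp add: \<sigma>(2) Aut_D[OF \<sigma>(1)])
qed

end

section \<open>Characters of the norm-one torus\<close>

locale algebra_basis = separable_closure k
  for k :: "'a::field set" +
  fixes J :: "'j set" and F :: "'j \<Rightarrow> 'a set" and b :: "('j \<Rightarrow> 'a) list"
  assumes finite_J: "finite J"
    and F_sub: "j \<in> J \<Longrightarrow> subfield (F j) ks" and k_sub: "j \<in> J \<Longrightarrow> k \<subseteq> F j"
    and basis: "is_basis k J (\<Pi>\<^sub>E j\<in>J. F j) b"
begin

abbreviation (input) d where "d \<equiv> length b"

text \<open>The pairs are the \<open>k\<close>-algebra homomorphisms from \<open>L\<close> to the
  separable closure, each of which factors through a single component. They form the set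
  \<open>S\<close> of the abstract lattice.\<close>

definition embs :: "('j \<times> ('a \<Rightarrow> 'a)) set"
  where "embs = (SIGMA j:J. Emb (F j))"

definition val :: "'j \<times> ('a \<Rightarrow> 'a) \<Rightarrow> nat \<Rightarrow> 'a"
  where "val s r = snd s ((b ! r) (fst s))"

lemma b_in: "r < d \<Longrightarrow> j \<in> J \<Longrightarrow> (b ! r) j \<in> F j"
  using basis nth_mem unfolding is_basis_def by (metis PiE_mem subsetD)

lemma lincomb_exists:
  assumes "x \<in> (\<Pi>\<^sub>E j\<in>J. F j)"
  obtains c where "c \<in> {..<d} \<rightarrow>\<^sub>E k" "x = lincomb J b c"
  using assms basis unfolding is_basis_def by blast

lemma emb_lincomb:
  assumes "c \<in> {..<d} \<rightarrow>\<^sub>E k" "(j, \<tau>) \<in> embs"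
  shows "\<tau> (lincomb J b c j) = (\<Sum>r<d. c r * val (j, \<tau>) r)"
proof -
  have j: "j \<in> J" "\<tau> \<in> Emb (F j)" using assms(2) by (auto simp: embs_def)
  note e = Emb_D[OF j(2) F_sub[OF j(1)]] and f = subfield_ksD[OF F_sub[OF j(1)]]
  have c: "c r \<in> k" "c r \<in> F j" if "r < d" for r using assms(1) that k_sub[OF j(1)] by (auto simp: PiE_iff)
  have "\<tau> (lincomb J b c j) = \<tau> (\<Sum>r<d. c r * (b ! r) j)" using j(1) by (simp add: lincomb_def)
  also have "\<dots> = (\<Sum>r<d. \<tau> (c r * (b ! r) j))"
    using f(4) c(2) b_in[OF _ j(1)] by (intro e(7)) auto
  also have "\<dots> = (\<Sum>r<d. c r * val (j, \<tau>) r)"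
    using e(1)[OF c(2) b_in[OF _ j(1)]] e(5) c by (intro sum.cong) (auto simp: val_def)
  finally show ?thesis .
qed

text \<open>By linearity a relation between the rows holds on all of \<open>L\<close>. Elements
  supported on one factor isolate the embeddings of that factor, which are independent.\<close>

lemma rows_independent:
  assumes "finite A" "A \<subseteq> embs" and zero: "\<And>r. r < d \<Longrightarrow> (\<Sum>s\<in>A. a s * val s r) = 0" and "s \<in> A"
  shows "a s = 0"
proof -
  obtain j \<tau> where s: "s = (j, \<tau>)" by (cases s)
  have j: "j \<in> J" using assms(2,4) by (auto simp: embs_def s)
  note f = subfield_ksD[OF F_sub[OF j]]
  define B where "B = {\<tau>. (j, \<tau>) \<in> A}"
  have B: "finite B" unfolding B_def by (rule finite_subset[of _ "snd ` A"]) (use assms(1) in force)+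
  have BE: "\<And>\<tau>. \<tau> \<in> B \<Longrightarrow> \<tau> \<in> Emb (F j)" using assms(2) by (auto simp: B_def embs_def)
  note e = Emb_D[OF BE F_sub[OF j]]
  have "a (j, \<tau>) = 0"
  proof (rule dedekind_independence[where T = "F j" and m = "(*)" and \<Phi> = B and c = "\<lambda>\<tau>. a (j, \<tau>)"])
    fix y assume y: "y \<in> F j"
    define x where "x = (\<lambda>i\<in>J. if i = j then y else 0)"
    have "x \<in> (\<Pi>\<^sub>E j\<in>J. F j)"
      using y subfield_ksD(1)[OF F_sub] by (auto simp: x_def)
    then obtain c where c: "c \<in> {..<d} \<rightarrow>\<^sub>E k" "x = lincomb J b c" by (rule lincomb_exists)
    have "(\<Sum>s\<in>A. a s * snd s (x (fst s))) = (\<Sum>s\<in>A. \<Sum>r<d. c r * (a s * val s r))"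
      using emb_lincomb[OF c(1)] assms(2) unfolding c(2)
      by (intro sum.cong refl) (force simp: sum_distrib_left mult_ac)
    also have "\<dots> = (\<Sum>r<d. c r * (\<Sum>s\<in>A. a s * val s r))"
      by (subst sum.swap) (simp add: sum_distrib_left)
    also have "\<dots> = 0" using zero by simp
    finally have "(\<Sum>s\<in>A. a s * snd s (x (fst s))) = 0" .
    moreover have "(\<Sum>s\<in>A. a s * snd s (x (fst s))) = (\<Sum>s\<in>Pair j ` B. a s * snd s (x (fst s)))"
    proof (rule sum.mono_neutral_right[OF assms(1)])
      show "Pair j ` B \<subseteq> A" by (auto simp: B_def)
      show "\<forall>s\<in>A - Pair j ` B. a s * snd s (x (fst s)) = 0"
      proof
        fix s assume s: "s \<in> A - Pair j ` B"
        obtain i \<tau> where s_eq: "s = (i, \<tau>)" by (cases s)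
        have i: "i \<noteq> j" "i \<in> J" "\<tau> \<in> Emb (F i)" using s assms(2) by (auto simp: B_def embs_def s_eq)
        then have "\<tau> 0 = 0" using Emb_D(4)[OF i(3) F_sub[OF i(2)]] by blast
        then show "a s * snd s (x (fst s)) = 0" using i by (simp add: x_def s_eq)
      qed
    qed
    moreover have "\<dots> = (\<Sum>\<tau>\<in>B. a (j, \<tau>) * \<tau> y)"
      using j by (subst sum.reindex) (auto simp: inj_on_def x_def)
    ultimately show "(\<Sum>\<tau>\<in>B. a (j, \<tau>) * \<tau> y) = 0" by simp
  next
    fix \<tau> assume "\<tau> \<in> B"
    then have "\<tau> 1 \<noteq> 0" by (simp add: e(3))
    then show "\<exists>x\<in>F j. \<tau> x \<noteq> 0" using f(2) by blast
  next
    fix \<tau> \<tau>' assume *: "\<tau> \<in> B" "\<tau>' \<in> B" "\<tau> \<noteq> \<tau>'"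
    show "\<exists>x\<in>F j. \<tau> x \<noteq> \<tau>' x"
    proof (rule ccontr)
      assume "\<not> ?thesis"
      then have "\<tau> = \<tau>'" using e(6)[OF *(1)] e(6)[OF *(2)] by (intro extensionalityI[of _ "F j"]) auto
      then show False using *(3) by simp
    qed
  qed (use B f e assms(4) in \<open>auto simp: B_def s\<close>)
  then show ?thesis by (simp add: s)
qed

text \<open>Galois descent: a solution of minimal support, normalised to have a coefficient 1, is fixed by all
  automorphisms, hence a relation over \<open>k\<close> between the basis vectors.\<close>

lemma columns_independent:
  assumes zero: "\<And>s. s \<in> embs \<Longrightarrow> (\<Sum>r<d. c r * val s r) = 0" and "r < d"
  shows "c r = 0"
proof (rule ccontr)
  assume "c r \<noteq> 0"
  define sol where "sol c \<longleftrightarrow> (\<exists>r<d. c r \<noteq> 0) \<and> (\<forall>s\<in>embs. (\<Sum>r<d. c r * val s r) = 0)" for c :: "nat \<Rightarrow> 'a"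
  define supp where "supp c = {r. r < d \<and> c r \<noteq> 0}" for c :: "nat \<Rightarrow> 'a"
  have "sol c" using zero assms(2) \<open>c r \<noteq> 0\<close> by (auto simp: sol_def)
  then obtain c\<^sub>1 where c1: "sol c\<^sub>1" and min1: "\<And>c. sol c \<Longrightarrow> card (supp c\<^sub>1) \<le> card (supp c)"
    using ex_has_least_nat[of sol c "\<lambda>c. card (supp c)"] by blast
  obtain r0 where r0: "r0 < d" "c\<^sub>1 r0 \<noteq> 0" using c1 by (auto simp: sol_def)
  define c\<^sub>0 where "c\<^sub>0 r = c\<^sub>1 r / c\<^sub>1 r0" for r
  have "(\<Sum>r<d. c\<^sub>0 r * val s r) = (\<Sum>r<d. c\<^sub>1 r * val s r) / c\<^sub>1 r0" for s
    by (simp add: c\<^sub>0_def sum_divide_distrib)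
  then have c0: "sol c\<^sub>0" using c1 r0 by (auto simp: sol_def c\<^sub>0_def)
  have c0r0: "c\<^sub>0 r0 = 1" using r0 by (simp add: c\<^sub>0_def)
  have supp0: "supp c\<^sub>0 = supp c\<^sub>1" using r0 by (auto simp: supp_def c\<^sub>0_def)
  have c0_k: "c\<^sub>0 r \<in> k" if r: "r < d" for r
  proof (rule fixed_field_Aut)
    fix \<sigma> assume \<sigma>: "\<sigma> \<in> Aut k"
    define \<sigma>' where "\<sigma>' = inv_into UNIV \<sigma>"
    have \<sigma>': "\<sigma>' \<in> Aut k" using Aut_inv[OF \<sigma>] by (simp add: \<sigma>'_def)
    have \<sigma>\<sigma>': "\<sigma> (\<sigma>' x) = x" for x using Aut_D(1)[OF \<sigma>] by (simp add: \<sigma>'_def bij_is_surj surj_f_inv_f)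
    have zero': "(\<Sum>r<d. \<sigma> (c\<^sub>0 r) * val s r) = 0" if s: "s \<in> embs" for s
    proof -
      obtain j \<tau> where j: "s = (j, restrict \<tau> (F j))" "j \<in> J" "\<tau> \<in> Aut k"
        using s by (auto simp: embs_def Emb_def)
      \<comment> \<open>The relation at \<open>\<sigma>' \<circ> \<tau>\<close>, transformed by
        \<open>\<sigma>\<close>, becomes the relation at \<open>s\<close> with coefficients
        \<open>\<sigma> (c\<^sub>0 r)\<close>.\<close>
      have "(j, restrict (\<sigma>' \<circ> \<tau>) (F j)) \<in> embs"
        using Aut_comp[OF \<sigma>' j(3)] j(2) by (auto simp: embs_def Emb_def)
      then have "(\<Sum>r<d. c\<^sub>0 r * val (j, restrict (\<sigma>' \<circ> \<tau>) (F j)) r) = 0" using c0 by (auto simp: sol_def)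
      then have "\<sigma> (\<Sum>r<d. c\<^sub>0 r * val (j, restrict (\<sigma>' \<circ> \<tau>) (F j)) r) = 0" using Aut_D(5)[OF \<sigma>] by simp
      then have "(\<Sum>r<d. \<sigma> (c\<^sub>0 r * val (j, restrict (\<sigma>' \<circ> \<tau>) (F j)) r)) = 0" by (simp add: Aut_D(11)[OF \<sigma>])
      moreover have "\<sigma> (c\<^sub>0 r * val (j, restrict (\<sigma>' \<circ> \<tau>) (F j)) r) = \<sigma> (c\<^sub>0 r) * val s r" if "r < d" for r
        using b_in[OF that j(2)] by (simp add: val_def j(1) Aut_D(3)[OF \<sigma>] \<sigma>\<sigma>')
      ultimately show ?thesis by simp
    qed
    \<comment> \<open>The coefficient at \<open>r0\<close> is 1 and cancels in this difference;
      minimality of the support forces the difference to vanish.\<close>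
    define e where "e r = \<sigma> (c\<^sub>0 r) - c\<^sub>0 r" for r
    have e_zero: "(\<Sum>r<d. e r * val s r) = 0" if "s \<in> embs" for s
      using zero'[OF that] c0 that by (simp add: e_def left_diff_distrib sum_subtractf sol_def)
    have "supp e \<subset> supp c\<^sub>0"
    proof
      show "supp e \<subseteq> supp c\<^sub>0" using Aut_D(5)[OF \<sigma>] by (auto simp: supp_def e_def)
      have "r0 \<in> supp c\<^sub>0" "r0 \<notin> supp e" using r0 c0r0 Aut_D(6)[OF \<sigma>] by (auto simp: supp_def e_def)
      then show "supp e \<noteq> supp c\<^sub>0" by blast
    qed
    moreover have "finite (supp c\<^sub>0)" by (simp add: supp_def)
    ultimately have "card (supp e) < card (supp c\<^sub>1)" using psubset_card_mono supp0 by metis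
    then have "\<not> sol e" using min1[of e] by auto
    then have "e r = 0" using e_zero r by (auto simp: sol_def)
    then show "\<sigma> (c\<^sub>0 r) = c\<^sub>0 r" by (simp add: e_def)
  qed
  define c2 where "c2 = (\<lambda>r\<in>{..<d}. c\<^sub>0 r)"
  have c2: "c2 \<in> {..<d} \<rightarrow>\<^sub>E k" using c0_k by (auto simp: c2_def)
  have z: "(\<lambda>r\<in>{..<d}. 0) \<in> {..<d} \<rightarrow>\<^sub>E k" using k_closed(1) by auto
  have "lincomb J b c2 j = 0" if j: "j \<in> J" for j
  proof -
    have "id \<in> Aut k" by (simp add: Aut_def)
    then have "(j, restrict id (F j)) \<in> embs" using j by (auto simp: embs_def Emb_def)
    then have "(\<Sum>r<d. c\<^sub>0 r * val (j, restrict id (F j)) r) = 0" using c0 by (simp add: sol_def)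
    then show ?thesis using j b_in[OF _ j] by (simp add: lincomb_def c2_def val_def)
  qed
  then have zero0: "lincomb J b c2 = (\<lambda>j\<in>J. 0)" by (auto simp: fun_eq_iff lincomb_def)
  also have "\<dots> = lincomb J b (\<lambda>r\<in>{..<d}. 0)" by (auto simp: lincomb_def)
  finally have eq: "lincomb J b c2 = lincomb J b (\<lambda>r\<in>{..<d}. 0)" .
  have "lincomb J b c2 \<in> (\<Pi>\<^sub>E j\<in>J. F j)" unfolding zero0 using subfield_ksD(1)[OF F_sub] by auto
  then have "\<exists>!c. c \<in> {..<d} \<rightarrow>\<^sub>E k \<and> lincomb J b c2 = lincomb J b c" using basis unfolding is_basis_def by blast
  then have "c2 = (\<lambda>r\<in>{..<d}. 0)"
    using c2 z eq by blast
  then have "c2 r0 = 0" using r0 by simp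
  then show False using r0 c0r0 by (simp add: c2_def)
qed

text \<open>Independent rows bound the number of embeddings by \<open>d\<close>, and independent
  columns bound \<open>d\<close> by that number, so the matrix of the values \<open>val s r\<close>
  is square.\<close>

lemma finite_embs: "finite embs" and card_embs: "card embs = d"
proof -
  have le: "card A \<le> d" if A: "finite A" "A \<subseteq> embs" for A
  proof (rule ccontr)
    assume "\<not> card A \<le> d"
    then have "card A > d" by simp
    from linear_dependence[OF A(1) this, of val]
    obtain a where a: "\<exists>s\<in>A. a s \<noteq> 0" "\<forall>r<d. (\<Sum>s\<in>A. a s * val s r) = 0" by (elim exE conjE)
    from a(1) obtain s where "s \<in> A" "a s \<noteq> 0" by (elim bexE)
    moreover have "(\<Sum>s\<in>A. a s * val s r) = 0" if "r < d" for r using a(2) that by blast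
    ultimately show False using rows_independent[OF A, of a s] by simp
  qed
  show fin: "finite embs"
  proof (rule ccontr)
    assume "infinite embs"
    then obtain A where "A \<subseteq> embs" "finite A" "card A = Suc d" using infinite_arbitrarily_large by blast
    then show False using le[of A] by simp
  qed
  have "d \<le> card embs"
  proof (rule ccontr)
    assume less: "\<not> d \<le> card embs"
    obtain f where f: "bij_betw f {0..<card embs} embs" using ex_bij_betw_nat_finite[OF fin] by blast
    have "finite {..<d}" "card embs < card {..<d}" using less by simp_all
    from linear_dependence[OF this, of "\<lambda>r i. val (f i) r"]
    obtain c where c: "\<exists>r\<in>{..<d}. c r \<noteq> 0" "\<forall>i<card embs. (\<Sum>r<d. c r * val (f i) r) = 0"
      by (elim exE conjE)
    have "(\<Sum>r<d. c r * val s r) = 0" if "s \<in> embs" for s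
    proof -
      have "s \<in> f ` {0..<card embs}" using f that by (simp add: bij_betw_def)
      then obtain i where "i < card embs" "s = f i" by auto
      then show ?thesis using c(2) by blast
    qed
    moreover obtain r where "r < d" "c r \<noteq> 0" using c(1) by auto
    ultimately show False using columns_independent[of c r] by simp
  qed
  then show "card embs = d" using le[OF fin] by simp
qed

end

section \<open>Degrees as numbers of embeddings\<close>

context separable_closure
begin

lemma combine_ks:
  fixes Ks Us :: "'a list"
  assumes "length Ks = length Us"
  shows "ring.combine ks Ks Us = (\<Sum>r<length Us. Ks ! r * Us ! r)"
proof -
  interpret K: field "ks :: 'a ring" by (rule field_ks)
  show ?thesis using assms
    by (induction Ks Us rule: list_induct2) (simp_all add: sum.lessThan_Suc_shift del: sum.lessThan_Suc)
qed

text \<open>This is the count of embeddings for an algebra with a single factor: a basis of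
  \<open>F\<close> over \<open>k\<close> is read as a basis of functions on a one-point set.\<close>

theorem degree_eq_card_Emb:
  assumes F: "subfield F ks" "k \<subseteq> F" "ring.finite_dimension ks k F"
  shows "finite (Emb F)" "ring.dim ks k F = card (Emb F)"
proof -
  interpret K: field "ks :: 'a ring" by (rule field_ks)
  have dim: "K.dimension (ring.dim ks k F) k F"
    using K.finite_dimensionE[OF subfield_k F(3)] by (simp add: over_def)
  then obtain Us where Us: "set Us \<subseteq> carrier ks" "K.independent k Us" "length Us = ring.dim ks k F" "K.Span k Us = F"
    using K.exists_base[OF subfield_k] by blast
  define b where "b = map (\<lambda>u. \<lambda>j\<in>{()}. u) Us"
  have lin: "lincomb {()} b c = (\<lambda>j\<in>{()}. \<Sum>r<length Us. c r * Us ! r)" for c :: "nat \<Rightarrow> 'a"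
    by (simp add: lincomb_def b_def)
  have bas: "is_basis k {()} (\<Pi>\<^sub>E j\<in>{()}. F) b"
    unfolding is_basis_def
  proof (intro conjI ballI)
    have "set Us \<subseteq> F" using K.Span_base_incl[OF subfield_k Us(1)] Us(4) by simp
    then show "set b \<subseteq> (\<Pi>\<^sub>E j\<in>{()}. F)" by (auto simp: b_def)
    fix x assume x: "x \<in> (\<Pi>\<^sub>E j\<in>{()}. F)"
    then have "x () \<in> K.Span k Us" using Us(4) by auto
    then have ex1: "\<exists>!Ks. set Ks \<subseteq> k \<and> length Ks = length Us \<and> x () = K.combine Ks Us"
      using K.unique_decomposition[OF subfield_k Us(2)] by blast
    have x_eq: "x = lincomb {()} b c \<longleftrightarrow> x () = (\<Sum>r<length Us. c r * Us ! r)" for c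
      unfolding lin using x by (auto simp: fun_eq_iff)
    obtain Ks where Ks: "set Ks \<subseteq> k" "length Ks = length Us" "x () = K.combine Ks Us" using ex1 by blast
    show "\<exists>!c. c \<in> {..<length b} \<rightarrow>\<^sub>E k \<and> x = lincomb {()} b c"
    proof (rule ex1I[of _ "\<lambda>r\<in>{..<length b}. Ks ! r"])
      show "(\<lambda>r\<in>{..<length b}. Ks ! r) \<in> {..<length b} \<rightarrow>\<^sub>E k \<and> x = lincomb {()} b (\<lambda>r\<in>{..<length b}. Ks ! r)"
        using Ks combine_ks[OF Ks(2)] nth_mem[of _ Ks] by (auto simp: b_def x_eq[unfolded b_def])
      fix c assume c: "c \<in> {..<length b} \<rightarrow>\<^sub>E k \<and> x = lincomb {()} b c"
      define Ks' where "Ks' = map c [0..<length Us]"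
      have len: "length Ks' = length Us" by (simp add: Ks'_def)
      have "x () = (\<Sum>r<length Us. c r * Us ! r)" using iffD1[OF x_eq conjunct2[OF c]] .
      also have "\<dots> = (\<Sum>r<length Us. Ks' ! r * Us ! r)" by (intro sum.cong) (auto simp: Ks'_def)
      also have "\<dots> = K.combine Ks' Us" by (rule combine_ks[OF len, symmetric])
      finally have "x () = K.combine Ks' Us" .
      moreover have "set Ks' \<subseteq> k"
        using conjunct1[OF c] by (auto simp: b_def Ks'_def PiE_iff)
      ultimately have map_c: "map c [0..<length Us] = Ks" using ex1 Ks len unfolding Ks'_def by blast
      have "c r = Ks ! r" if "r < length Us" for r using that by (auto simp flip: map_c)
      then show "c = (\<lambda>r\<in>{..<length b}. Ks ! r)"
        using conjunct1[OF c] by (auto simp: fun_eq_iff b_def PiE_def extensional_def)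
    qed
  qed
  interpret A: algebra_basis k "{()}" "\<lambda>_. F" b
    by (intro algebra_basis.intro separable_closure_axioms algebra_basis_axioms.intro) (use F bas in simp_all)
  have embs: "A.embs = Pair () ` Emb F" by (auto simp: A.embs_def)
  show "finite (Emb F)" using A.finite_embs unfolding embs by (simp add: finite_image_iff inj_on_def)
  show "ring.dim ks k F = card (Emb F)"
    using A.card_embs Us(3) unfolding embs by (simp add: card_image inj_on_def b_def)
qed

lemma finite_dimension_mono:
  assumes "ring.finite_dimension ks k F" "subfield E ks" "k \<subseteq> E" "E \<subseteq> F"
  shows "ring.finite_dimension ks k E"
proof -
  interpret K: field "ks :: 'a ring" by (rule field_ks)
  have "subalgebra k E ks"
  proof -
    have "subgroup E (add_monoid ks)"
      using subring.axioms(1)[OF subfieldE(1)[OF assms(2)]] .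
    then show ?thesis
      using assms(2,3) subfield_ksD(4)[OF assms(2)] by (auto simp: subalgebra_def subalgebra_axioms_def)
  qed
  then show ?thesis using K.subalbegra_incl_imp_finite_dimension[OF subfield_k assms(1)] assms(4) by blast
qed

end

section \<open>Infinitude of the separable closure\<close>

context separable_closure
begin

text \<open>In a field with \<open>n\<close> elements, \<open>n\<close> is 0 and
  \<open>x ^ n = x\<close> throughout. The polynomial X^n - X + 1 then has derivative -1 and takes
  only the value 1: a separable polynomial without roots.\<close>

lemma infinite_field: "infinite (UNIV :: 'a set)"
proof
  assume fin: "finite (UNIV :: 'a set)"
  define n where "n = card (UNIV :: 'a set)"
  have "(\<Sum>x\<in>UNIV. x + (1::'a)) = (\<Sum>x\<in>UNIV. x)"
    by (rule sum.reindex_bij_witness[of _ "\<lambda>x. x - 1" "\<lambda>x. x + 1"]) auto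
  then have n0: "(of_nat n :: 'a) = 0" by (simp add: sum.distrib n_def)
  have pow: "x ^ n = x" for x :: 'a
  proof (cases "x = 0")
    case True
    then show ?thesis using fin by (simp add: n_def card_gt_0_iff)
  next
    case False
    let ?P = "\<Prod>y\<in>UNIV - {0}. y :: 'a"
    have "(\<Prod>y\<in>UNIV - {0}. x * y) = ?P"
      by (rule prod.reindex_bij_witness[of _ "\<lambda>y. y / x" "\<lambda>y. x * y"]) (use False in auto)
    then have "x ^ (n - 1) * ?P = 1 * ?P" using fin by (simp add: prod.distrib n_def card_Diff_singleton)
    moreover have "?P \<noteq> 0" using fin by (simp add: prod_zero_iff)
    ultimately have "x ^ (n - 1) = 1" by simp
    moreover have "n > 0" using fin by (simp add: n_def card_gt_0_iff)
    ultimately show ?thesis by (metis mult.right_neutral power_eq_if less_irrefl)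
  qed
  define f where "f = monom 1 n - monom 1 1 + (1 :: 'a poly)"
  have "pderiv f = - 1"
    unfolding f_def by (simp only: pderiv_add pderiv_diff pderiv_monom pderiv_1 n0) (simp add: monom_0 one_pCons)
  then have cop: "coprime f (pderiv f)" by (metis is_unit_right_imp_coprime dvd_minus_iff dvd_refl minus_minus one_dvd minus_dvd_iff)
  have ev: "poly f x = 1" for x by (simp add: f_def poly_monom pow)
  have "degree f > 0"
  proof (rule ccontr)
    assume "\<not> degree f > 0"
    then obtain a where "f = [:a:]" by (metis degree_eq_zeroE neq0_conv)
    then have "pderiv f = 0" by (simp add: pderiv_pCons)
    then show False using \<open>pderiv f = - 1\<close> by simp
  qed
  from separable_poly_root[OF this cop] show False using ev by simp
qed

lemma exists_power_ne_1: "n > 0 \<Longrightarrow> \<exists>z::'a. z \<noteq> 0 \<and> z ^ n \<noteq> 1"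
proof (rule ccontr)
  assume n: "n > 0" and "\<not> (\<exists>z::'a. z \<noteq> 0 \<and> z ^ n \<noteq> 1)"
  then have sub: "UNIV \<subseteq> insert 0 {z::'a. poly (monom 1 n - 1) z = 0}" by (auto simp: poly_monom)
  have "monom 1 n - 1 \<noteq> (0 :: 'a poly)"
  proof
    assume "monom 1 n - 1 = (0 :: 'a poly)"
    then have "poly (monom 1 n - 1) (0::'a) = 0" by simp
    then show False using n by (simp add: poly_monom zero_power)
  qed
  from poly_roots_finite[OF this]
  have "finite (insert 0 {z::'a. poly (monom 1 n - 1) z = 0})" by simp
  from finite_subset[OF sub this] show False using infinite_field by simp
qed

text \<open>A nonzero exponent would leave only finitely many possible \<open>z\<close>. This is
  what makes the exponents of a monomial character visible on points.\<close>

lemma power_int_eq_imp: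
  assumes "\<And>z::'a. z \<noteq> 0 \<Longrightarrow> z powi m = 1" shows "m = 0"
proof (rule ccontr)
  assume "m \<noteq> 0"
  then obtain z :: 'a where z: "z \<noteq> 0" "z ^ nat \<bar>m\<bar> \<noteq> 1" using exists_power_ne_1[of "nat \<bar>m\<bar>"] by auto
  have "z powi m = 1" using assms z(1) .
  then show False using z by (cases "m \<ge> 0") (auto simp: power_int_def power_inverse)
qed

end

section \<open>Simultaneous diagonalisation of the multiplication matrices\<close>

context algebra_basis
begin

definition unit_coords where "unit_coords = coords k J b (\<lambda>j\<in>J. 1)"

text \<open>A multiplication matrix is determined by the image of 1. The formula applies
  \<open>s\<close>, extended linearly, to that image; it expresses the eigenvalue at
  \<open>s\<close> as a linear form in the entries of \<open>A\<close>.\<close>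

definition eig :: "'j \<times> ('a \<Rightarrow> 'a) \<Rightarrow> 'a mat \<Rightarrow> 'a"
  where "eig s A = (\<Sum>u<d. (\<Sum>v<d. A $$ (u, v) * unit_coords v) * val s u)"

abbreviation (input) tmm where "tmm \<equiv> tensor_mult_matrix k J b"

text \<open>The value at \<open>s\<close>, extended linearly, of the element of \<open>L\<close>
  tensored with the separable closure that has coordinates \<open>c\<close>.\<close>

definition ev :: "(nat \<Rightarrow> 'a) \<Rightarrow> 'j \<times> ('a \<Rightarrow> 'a) \<Rightarrow> 'a"
  where "ev c s = (\<Sum>r<d. c r * val s r)"

lemma coords:
  assumes "x \<in> (\<Pi>\<^sub>E j\<in>J. F j)"
  shows "coords k J b x \<in> {..<d} \<rightarrow>\<^sub>E k" "x = lincomb J b (coords k J b x)"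
proof -
  have "\<exists>!c. c \<in> {..<d} \<rightarrow>\<^sub>E k \<and> x = lincomb J b c" using basis assms unfolding is_basis_def by blast
  from theI'[OF this] show "coords k J b x \<in> {..<d} \<rightarrow>\<^sub>E k" "x = lincomb J b (coords k J b x)"
    by (simp_all add: coords_def)
qed

lemma ev_coords:
  assumes "x \<in> (\<Pi>\<^sub>E j\<in>J. F j)" "(j, \<tau>) \<in> embs"
  shows "ev (coords k J b x) (j, \<tau>) = \<tau> (x j)"
  using emb_lincomb[OF coords(1)[OF assms(1)] assms(2)] coords(2)[OF assms(1)] by (simp add: ev_def)

lemma mult_matrix_dim [simp]: "mult_matrix k J b x \<in> carrier_mat d d"
  by (simp add: mult_matrix_def)

lemma tmm_carrier [simp]: "tmm c \<in> carrier_mat d d"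
  by (simp add: tensor_mult_matrix_def)

lemma prod_in:
  assumes "r < d" "v < d" shows "(\<lambda>j\<in>J. (b ! r) j * (b ! v) j) \<in> (\<Pi>\<^sub>E j\<in>J. F j)"
  using b_in[OF assms(1)] b_in[OF assms(2)] subfield_ksD(4)[OF F_sub] by auto

lemma mult_matrix_in_k:
  assumes "r < d" "u < d" "v < d" shows "mult_matrix k J b (b ! r) $$ (u, v) \<in> k"
  using coords(1)[OF prod_in[OF assms(1,3)]] assms by (auto simp: mult_matrix_def PiE_iff)

lemma val_mult:
  assumes "s \<in> embs" "r < d" "v < d"
  shows "(\<Sum>u<d. mult_matrix k J b (b ! r) $$ (u, v) * val s u) = val s r * val s v"
proof -
  obtain j \<tau> where s: "s = (j, \<tau>)" by (cases s)
  have j: "j \<in> J" "\<tau> \<in> Emb (F j)" using assms(1) by (auto simp: embs_def s)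
  have "(\<Sum>u<d. mult_matrix k J b (b ! r) $$ (u, v) * val s u) = ev (coords k J b (\<lambda>j\<in>J. (b ! r) j * (b ! v) j)) s"
    using assms by (simp add: ev_def mult_matrix_def)
  also have "\<dots> = \<tau> ((b ! r) j * (b ! v) j)"
    using ev_coords[OF prod_in[OF assms(2,3)], of j \<tau>] assms(1) j(1) by (simp add: s)
  also have "\<dots> = val s r * val s v"
    using Emb_D(1)[OF j(2) F_sub[OF j(1)]] b_in[OF _ j(1)] assms by (simp add: val_def s)
  finally show ?thesis .
qed

text \<open>Multiplicativity of \<open>s\<close> makes its row of values a left eigenvector of every
  multiplication matrix. Collecting the rows in \<open>Vm\<close> diagonalises the whole
  algebra.\<close>

lemma tmm_row:
  assumes "s \<in> embs" "v < d"
  shows "(\<Sum>u<d. tmm c $$ (u, v) * val s u) = ev c s * val s v"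
proof -
  have "(\<Sum>u<d. tmm c $$ (u, v) * val s u)
     = (\<Sum>u<d. \<Sum>r<d. c r * (mult_matrix k J b (b ! r) $$ (u, v) * val s u))"
    using assms(2) by (intro sum.cong) (auto simp: tensor_mult_matrix_def sum_distrib_right mult.assoc)
  also have "\<dots> = (\<Sum>r<d. c r * (\<Sum>u<d. mult_matrix k J b (b ! r) $$ (u, v) * val s u))"
    by (subst sum.swap) (simp add: sum_distrib_left)
  also have "\<dots> = (\<Sum>r<d. c r * (val s r * val s v))"
    using val_mult[OF assms(1) _ assms(2)] by (intro sum.cong) auto
  also have "\<dots> = ev c s * val s v" by (simp add: ev_def sum_distrib_right mult.assoc)
  finally show ?thesis .
qed

lemma ev_unit: "s \<in> embs \<Longrightarrow> ev unit_coords s = 1"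
proof -
  assume s: "s \<in> embs"
  obtain j \<tau> where s_eq: "s = (j, \<tau>)" by (cases s)
  have j: "j \<in> J" "\<tau> \<in> Emb (F j)" using s by (auto simp: embs_def s_eq)
  have "(\<lambda>j\<in>J. 1) \<in> (\<Pi>\<^sub>E j\<in>J. F j)" using subfield_ksD(2)[OF F_sub] by auto
  from ev_coords[OF this, of j \<tau>] show ?thesis
    using s j Emb_D(3)[OF j(2) F_sub[OF j(1)]] by (simp add: s_eq unit_coords_def)
qed

lemma eig_tmm: assumes "s \<in> embs" shows "eig s (tmm c) = ev c s"
proof -
  have "eig s (tmm c) = (\<Sum>u<d. \<Sum>v<d. unit_coords v * (tmm c $$ (u, v) * val s u))"
    by (simp add: eig_def sum_distrib_left sum_distrib_right mult_ac)
  also have "\<dots> = (\<Sum>v<d. unit_coords v * (\<Sum>u<d. tmm c $$ (u, v) * val s u))"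
    by (subst sum.swap) (simp add: sum_distrib_left)
  also have "\<dots> = (\<Sum>v<d. unit_coords v * (ev c s * val s v))"
    using tmm_row[OF assms] by (intro sum.cong) auto
  also have "\<dots> = ev c s * ev unit_coords s"
    by (simp add: ev_def[of unit_coords] sum_distrib_left mult_ac)
  finally show ?thesis using ev_unit[OF assms] by simp
qed

definition enum where "enum = (SOME f. bij_betw f {..<d} embs)"

lemma enum: "bij_betw enum {..<d} embs"
proof -
  have "\<exists>f. bij_betw f {..<d} embs"
    using ex_bij_betw_nat_finite[OF finite_embs] card_embs by (simp add: lessThan_atLeast0)
  then show ?thesis unfolding enum_def by (rule someI_ex)
qed

lemma enum_in: "i < d \<Longrightarrow> enum i \<in> embs" using enum by (auto simp: bij_betw_def)

lemma prod_enum: "(\<Prod>i<d. g (enum i)) = (\<Prod>s\<in>embs. g s)"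
  using prod.reindex_bij_betw[OF enum] .

definition Vm where "Vm = mat d d (\<lambda>(i, r). val (enum i) r)"

lemma Vm_carrier [simp]: "Vm \<in> carrier_mat d d" by (simp add: Vm_def)

lemma det_Vm: "det Vm \<noteq> 0"
proof
  assume "det Vm = 0"
  then obtain v where v: "v \<in> carrier_vec d" "v \<noteq> 0\<^sub>v d" "Vm *\<^sub>v v = 0\<^sub>v d"
    using det_0_iff_vec_prod_zero_field[OF Vm_carrier] by blast
  have "v $ r = 0" if "r < d" for r
  proof (rule columns_independent[OF _ that])
    fix s assume "s \<in> embs"
    then obtain i where i: "i < d" "s = enum i" using enum by (auto simp: bij_betw_def)
    have "(Vm *\<^sub>v v) $ i = 0" using v(3) i(1) by simp
    then show "(\<Sum>r<d. v $ r * val s r) = 0"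
      using v(1) i by (simp add: Vm_def scalar_prod_def lessThan_atLeast0 mult.commute)
  qed
  then have "v = 0\<^sub>v d" using v(1) by (intro eq_vecI) auto
  then show False using v(2) by blast
qed

lemma Vm_inverse: obtains V' where "V' \<in> carrier_mat d d" "V' * Vm = 1\<^sub>m d" "Vm * V' = 1\<^sub>m d"
proof -
  from det_non_zero_imp_unit[OF Vm_carrier det_Vm, of "()"] show ?thesis
    using that by (auto simp: Units_def ring_mat_def)
qed

definition diagm where "diagm t = mat d d (\<lambda>(i, j). if i = j then t (enum i) else 0)"

lemma diagm_carrier [simp]: "diagm t \<in> carrier_mat d d" by (simp add: diagm_def)

lemma Vm_tmm: "Vm * tmm c = diagm (ev c) * Vm"
proof (rule eq_matI)
  fix i v assume "i < dim_row (diagm (ev c) * Vm)" "v < dim_col (diagm (ev c) * Vm)"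
  then have iv: "i < d" "v < d" by (simp_all add: diagm_def Vm_def)
  have "(Vm * tmm c) $$ (i, v) = (\<Sum>u<d. tmm c $$ (u, v) * val (enum i) u)"
    using iv by (simp add: Vm_def scalar_prod_def lessThan_atLeast0 mult.commute tensor_mult_matrix_def)
  also have "\<dots> = ev c (enum i) * val (enum i) v" using tmm_row[OF enum_in[OF iv(1)] iv(2)] .
  also have "\<dots> = (diagm (ev c) * Vm) $$ (i, v)"
  proof -
    have "(diagm (ev c) * Vm) $$ (i, v) = (\<Sum>u\<in>{0..<d}. (if i = u then ev c (enum i) else 0) * val (enum u) v)"
      using iv by (simp add: diagm_def Vm_def scalar_prod_def)
    also have "\<dots> = (\<Sum>u\<in>{0..<d}. if u = i then ev c (enum i) * val (enum i) v else 0)"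
      by (intro sum.cong) auto
    finally show ?thesis using iv by simp
  qed
  finally show "(Vm * tmm c) $$ (i, v) = (diagm (ev c) * Vm) $$ (i, v)" .
qed (simp_all add: diagm_def Vm_def tensor_mult_matrix_def)

lemma Vm_cancel:
  assumes "A \<in> carrier_mat d d" "B \<in> carrier_mat d d" "Vm * A = Vm * B" shows "A = B"
proof -
  obtain V' where V': "V' \<in> carrier_mat d d" "V' * Vm = 1\<^sub>m d" by (rule Vm_inverse)
  have "V' * (Vm * A) = V' * (Vm * B)" using assms(3) by simp
  then show ?thesis
    using V' assms(1,2) assoc_mult_mat[OF V'(1) Vm_carrier assms(1)] assoc_mult_mat[OF V'(1) Vm_carrier assms(2)]
    by simp
qed

lemma det_diagm: "det (diagm t) = (\<Prod>s\<in>embs. t s)"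
proof -
  have "det (diagm t) = prod_list (diag_mat (diagm t))"
    by (rule det_upper_triangular[of _ d]) (auto simp: diagm_def upper_triangular_def)
  also have "\<dots> = (\<Prod>i<d. t (enum i))"
    by (simp add: prod_list_diag_prod diagm_def lessThan_atLeast0)
  finally show ?thesis by (simp add: prod_enum)
qed

lemma det_tmm: "det (tmm c) = (\<Prod>s\<in>embs. ev c s)"
proof -
  have "det Vm * det (tmm c) = det (diagm (ev c)) * det Vm"
    using arg_cong[OF Vm_tmm[of c], of det] det_mult[OF Vm_carrier tmm_carrier] det_mult[OF diagm_carrier Vm_carrier]
    by simp
  then show ?thesis using det_Vm by (simp add: det_diagm)
qed

text \<open>Invertibility of \<open>Vm\<close> identifies the algebra over the separable closure
  with the functions on \<open>embs\<close>, so the eigenvalues can be prescribed freely.\<close>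

lemma ev_surj: obtains c where "\<And>s. s \<in> embs \<Longrightarrow> ev c s = t s"
proof -
  obtain V' where V': "V' \<in> carrier_mat d d" "Vm * V' = 1\<^sub>m d" by (rule Vm_inverse)
  define w where "w = V' *\<^sub>v vec d (\<lambda>i. t (enum i))"
  have w: "w \<in> carrier_vec d" using V'(1) by (simp add: w_def)
  have "Vm *\<^sub>v w = (Vm * V') *\<^sub>v vec d (\<lambda>i. t (enum i))"
    unfolding w_def by (rule assoc_mult_mat_vec[OF Vm_carrier V'(1), symmetric]) simp
  then have Vw: "Vm *\<^sub>v w = vec d (\<lambda>i. t (enum i))" using V'(2) by simp
  have "ev (\<lambda>r. w $ r) s = t s" if "s \<in> embs" for s
  proof -
    obtain i where i: "i < d" "s = enum i" using enum \<open>s \<in> embs\<close> by (auto simp: bij_betw_def)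
    have "(Vm *\<^sub>v w) $ i = t s" using Vw i by simp
    then show ?thesis
      using w i by (simp add: ev_def Vm_def scalar_prod_def lessThan_atLeast0 mult.commute)
  qed
  then show ?thesis using that by blast
qed

lemma tmm_mult: assumes "\<And>s. s \<in> embs \<Longrightarrow> ev c'' s = ev c s * ev c' s" shows "tmm c * tmm c' = tmm c''"
proof (rule Vm_cancel)
  have "diagm (ev c) * diagm (ev c') = diagm (ev c'')"
  proof (rule eq_matI)
    fix i j assume "i < dim_row (diagm (ev c''))" "j < dim_col (diagm (ev c''))"
    then have ij: "i < d" "j < d" by (simp_all add: diagm_def)
    have "(diagm (ev c) * diagm (ev c')) $$ (i, j)
       = (\<Sum>u\<in>{0..<d}. (if i = u then ev c (enum i) else 0) * (if u = j then ev c' (enum u) else 0))"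
      using ij by (simp add: diagm_def scalar_prod_def)
    also have "\<dots> = (\<Sum>u\<in>{0..<d}. if u = i then (if i = j then ev c (enum i) * ev c' (enum i) else 0) else 0)"
      by (intro sum.cong) auto
    also have "\<dots> = diagm (ev c'') $$ (i, j)" using ij assms[OF enum_in[OF ij(1)]] by (cases "i = j") (simp_all add: diagm_def)
    finally show "(diagm (ev c) * diagm (ev c')) $$ (i, j) = diagm (ev c'') $$ (i, j)" .
  qed (simp_all add: diagm_def)
  moreover have "Vm * (tmm c * tmm c') = Vm * tmm c * tmm c'"
    by (rule assoc_mult_mat[OF Vm_carrier tmm_carrier tmm_carrier, symmetric])
  moreover have "diagm (ev c) * Vm * tmm c' = diagm (ev c) * (Vm * tmm c')"
    by (rule assoc_mult_mat[OF diagm_carrier Vm_carrier tmm_carrier])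
  moreover have "diagm (ev c) * (diagm (ev c') * Vm) = diagm (ev c) * diagm (ev c') * Vm"
    by (rule assoc_mult_mat[OF diagm_carrier diagm_carrier Vm_carrier, symmetric])
  ultimately show "Vm * (tmm c * tmm c') = Vm * tmm c''" by (simp add: Vm_tmm)
qed (use mult_carrier_mat[OF tmm_carrier tmm_carrier] in simp_all)

abbreviation (input) T where "T \<equiv> norm_one_torus k J b"

text \<open>The determinant is the product of the eigenvalues, so in these coordinates the torus is
  the kernel of the product map on tuples indexed by \<open>embs\<close>.\<close>

lemma carrier_T: "carrier T = {tmm c | c. (\<Prod>s\<in>embs. ev c s) = 1}"
  by (auto simp: norm_one_torus_def weil_Gm_def kernel_def det_tmm)

lemma mult_T: "A \<otimes>\<^bsub>T\<^esub> B = A * B"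
  by (simp add: norm_one_torus_def weil_Gm_def)

lemma eig_prod: "A \<in> carrier T \<Longrightarrow> (\<Prod>s\<in>embs. eig s A) = 1"
  by (auto simp: carrier_T eig_tmm)

lemma eig_nonzero: "A \<in> carrier T \<Longrightarrow> s \<in> embs \<Longrightarrow> eig s A \<noteq> 0"
  using eig_prod[of A] prod_zero[OF finite_embs, of "\<lambda>s. eig s A"] by force

lemma T_point:
  assumes "(\<Prod>s\<in>embs. t s) = 1"
  obtains A where "A \<in> carrier T" "\<And>s. s \<in> embs \<Longrightarrow> eig s A = t s"
proof -
  obtain c where c: "\<And>s. s \<in> embs \<Longrightarrow> ev c s = t s" using ev_surj[of t] by blast
  then have "(\<Prod>s\<in>embs. ev c s) = 1" using assms by (simp cong: prod.cong)
  then have "tmm c \<in> carrier T" unfolding carrier_T by blast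
  then show ?thesis using that[of "tmm c"] c eig_tmm by simp
qed

lemma T_mult:
  assumes "A \<in> carrier T" "B \<in> carrier T"
  shows "A * B \<in> carrier T" and "s \<in> embs \<Longrightarrow> eig s (A * B) = eig s A * eig s B"
proof -
  obtain c where c: "A = tmm c" "(\<Prod>s\<in>embs. ev c s) = 1" using assms(1) by (auto simp: carrier_T)
  obtain c' where c': "B = tmm c'" "(\<Prod>s\<in>embs. ev c' s) = 1" using assms(2) by (auto simp: carrier_T)
  obtain c'' where c'': "\<And>s. s \<in> embs \<Longrightarrow> ev c'' s = ev c s * ev c' s"
    using ev_surj[of "\<lambda>s. ev c s * ev c' s"] by blast
  have eq: "A * B = tmm c''" unfolding c(1) c'(1) by (rule tmm_mult[OF c''])
  have "(\<Prod>s\<in>embs. ev c'' s) = 1" using c(2) c'(2) by (simp add: c'' prod.distrib)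
  then show "A * B \<in> carrier T" by (auto simp: eq carrier_T)
  show "s \<in> embs \<Longrightarrow> eig s (A * B) = eig s A * eig s B"
    unfolding eq by (simp add: c(1) c'(1) eig_tmm c'')
qed

end

section \<open>Monomial characters and the character lattice\<close>

lemma regular_GL_sum: "(\<And>i. i \<in> A \<Longrightarrow> f i \<in> regular_GL d) \<Longrightarrow> (\<lambda>Y. \<Sum>i\<in>A. f i Y) \<in> regular_GL d"
  by (induction A rule: infinite_finite_induct) (auto intro: regular_GL.intros)

lemma regular_GL_prod: "(\<And>i. i \<in> A \<Longrightarrow> f i \<in> regular_GL d) \<Longrightarrow> (\<lambda>Y. \<Prod>i\<in>A. f i Y) \<in> regular_GL d"
  by (induction A rule: infinite_finite_induct) (auto intro: regular_GL.intros)

lemma regular_GL_power: "f \<in> regular_GL d \<Longrightarrow> (\<lambda>Y. f Y ^ n) \<in> regular_GL d"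
  by (induction n) (auto intro: regular_GL.intros)

context algebra_basis
begin

text \<open>This map is the \<open>q\<close> of the abstract lattice. Exponents may be negative, as
  eigenvalues of torus elements are units.\<close>

definition qc :: "('j \<times> ('a \<Rightarrow> 'a) \<Rightarrow> int) \<Rightarrow> 'a mat \<Rightarrow> 'a"
  where "qc a = (\<lambda>A\<in>carrier T. \<Prod>s\<in>embs. eig s A powi (a s))"

abbreviation (input) M where "M \<equiv> characters d T"

lemma mult_M: "x \<otimes>\<^bsub>M\<^esub> y = (\<lambda>A\<in>carrier T. x A * y A)"
  by (simp add: characters_def)

lemma one_M: "\<one>\<^bsub>M\<^esub> = (\<lambda>A\<in>carrier T. 1)"
  by (simp add: characters_def)

lemma carrier_M: "\<chi> \<in> carrier M \<longleftrightarrow> \<chi> \<in> hom T (mult_of ks) \<and> (\<exists>f\<in>regular_GL d. \<chi> = restrict f (carrier T))"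
  by (simp add: characters_def)

lemma qc_add: "qc (\<lambda>s. a s + c s) = qc a \<otimes>\<^bsub>M\<^esub> qc c"
  unfolding mult_M qc_def
  by (intro restrict_ext) (auto simp: prod.distrib[symmetric] power_int_add eig_nonzero intro!: prod.cong)

lemma qc_const: "qc (\<lambda>s. n) = \<one>\<^bsub>M\<^esub>"
  unfolding one_M qc_def
proof (intro restrict_ext)
  fix A assume A: "A \<in> carrier T"
  have "(\<Prod>s\<in>B. eig s A powi n) = (\<Prod>s\<in>B. eig s A) powi n" for B
    by (induction B rule: infinite_finite_induct) (simp_all add: power_int_mult_distrib)
  then show "(\<Prod>s\<in>embs. eig s A powi n) = 1" using eig_prod[OF A] by simp
qed

lemma qc_shift: "qc (\<lambda>s. a s + n) = qc a"
  unfolding qc_add qc_const by (auto simp: mult_M one_M qc_def)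

lemma qc_mult:
  assumes "A \<in> carrier T" "B \<in> carrier T" shows "qc a (A * B) = qc a A * qc a B"
proof -
  have "(\<Prod>s\<in>embs. eig s (A * B) powi a s) = (\<Prod>s\<in>embs. eig s A powi a s * eig s B powi a s)"
    by (intro prod.cong refl) (simp only: T_mult(2)[OF assms] power_int_mult_distrib)
  then show ?thesis using assms T_mult(1)[OF assms] by (simp add: qc_def prod.distrib)
qed

lemma qc_nonzero: assumes "A \<in> carrier T" shows "qc a A \<noteq> 0"
proof -
  have "(\<Prod>s\<in>embs. eig s A powi a s) \<noteq> 0"
  proof
    assume "(\<Prod>s\<in>embs. eig s A powi a s) = 0"
    then obtain s where s: "s \<in> embs" "eig s A powi a s = 0"
      unfolding prod_zero_iff[OF finite_embs] by (elim bexE)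
    from s(2) have "eig s A = 0" by (simp add: power_int_eq_0_iff)
    then show False using eig_nonzero[OF assms s(1)] by (rule notE[rotated])
  qed
  moreover have "qc a A = (\<Prod>s\<in>embs. eig s A powi a s)" unfolding qc_def by (rule restrict_apply'[OF assms])
  ultimately show ?thesis by (simp only: simp_thms)
qed

lemma eig_regular: "eig s \<in> regular_GL d"
  unfolding eig_def[abs_def]
  by (intro regular_GL_sum regular_GL.mult regular_GL.entry regular_GL.const) auto

lemma qc_closed: "qc a \<in> carrier M"
  unfolding carrier_M
proof
  show "qc a \<in> hom T (mult_of ks)"
    using qc_mult qc_nonzero by (intro homI) (auto simp: mult_T)
  \<comment> \<open>Adding a constant to all exponents does not change the character, as the
    eigenvalues have product 1. A large constant makes the monomial a polynomial in the entries,
    hence regular.\<close>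
  define n where "n = (\<Sum>s\<in>embs. \<bar>a s\<bar>)"
  have n: "a s + n \<ge> 0" if "s \<in> embs" for s
  proof -
    have "\<bar>a s\<bar> \<le> n" unfolding n_def by (rule member_le_sum[OF that]) (use finite_embs in auto)
    then show ?thesis by linarith
  qed
  have "qc a = restrict (\<lambda>A. \<Prod>s\<in>embs. eig s A ^ nat (a s + n)) (carrier T)"
    unfolding qc_shift[of a n, symmetric] unfolding qc_def
    by (intro restrict_ext prod.cong refl) (use n in \<open>simp add: power_int_def\<close>)
  then show "\<exists>f\<in>regular_GL d. qc a = restrict f (carrier T)"
    by (intro bexI[of _ "\<lambda>A. \<Prod>s\<in>embs. eig s A ^ nat (a s + n)"] regular_GL_prod regular_GL_power eig_regular)
qed

lemma qc_single:
  assumes "s \<in> embs" "A \<in> carrier T" shows "qc (\<lambda>s'. if s' = s then 1 else 0) A = eig s A"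
proof -
  have "qc (\<lambda>s'. if s' = s then 1 else 0) A = (\<Prod>s'\<in>embs. if s' = s then eig s A else 1)"
    using assms(2) by (auto simp: qc_def intro!: prod.cong)
  then show ?thesis using assms(1) finite_embs by simp
qed

text \<open>These linear combinations are closed under products because monomial characters multiply
  by adding exponents; they will turn out to contain all regular functions on the torus.\<close>

definition spanned :: "('a mat \<Rightarrow> 'a) \<Rightarrow> bool"
  where "spanned f \<longleftrightarrow> (\<exists>\<Phi> c. finite \<Phi> \<and> \<Phi> \<subseteq> range qc \<and> (\<forall>A\<in>carrier T. f A = (\<Sum>\<phi>\<in>\<Phi>. c \<phi> * \<phi> A)))"

text \<open>The family \<open>g\<close> may repeat characters, as happens for sums and products; the
  coefficients of equal ones are collected.\<close>

lemma spannedI: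
  assumes "finite Y" "\<And>i. i \<in> Y \<Longrightarrow> g i \<in> range qc" "\<And>A. A \<in> carrier T \<Longrightarrow> f A = (\<Sum>i\<in>Y. c i * g i A)"
  shows "spanned f"
  unfolding spanned_def
proof (intro exI conjI ballI)
  show "finite (g ` Y)" "g ` Y \<subseteq> range qc" using assms(1,2) by auto
  fix A assume A: "A \<in> carrier T"
  have "(\<Sum>i\<in>Y. c i * g i A) = (\<Sum>\<phi>\<in>g ` Y. \<Sum>i\<in>{i \<in> Y. g i = \<phi>}. c i * g i A)"
    by (rule sum.image_gen[OF assms(1)])
  also have "\<dots> = (\<Sum>\<phi>\<in>g ` Y. (\<Sum>i\<in>{i \<in> Y. g i = \<phi>}. c i) * \<phi> A)"
    by (intro sum.cong) (auto simp: sum_distrib_right)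
  finally show "f A = (\<Sum>\<phi>\<in>g ` Y. (\<Sum>i\<in>{i \<in> Y. g i = \<phi>}. c i) * \<phi> A)" using assms(3)[OF A] by simp
qed

lemma one_in_range: "\<one>\<^bsub>M\<^esub> \<in> range qc"
  using qc_const[of 0] by (metis rangeI)

lemma spanned_const: "spanned (\<lambda>_. c)"
  by (rule spannedI[of "{()}" "\<lambda>_. \<one>\<^bsub>M\<^esub>" _ "\<lambda>_. c"]) (use one_in_range in \<open>auto simp: one_M\<close>)

lemma spanned_eig: "s \<in> embs \<Longrightarrow> spanned (eig s)"
  by (rule spannedI[of "{()}" "\<lambda>_. qc (\<lambda>s'. if s' = s then 1 else 0)" _ "\<lambda>_. 1"]) (auto simp: qc_single)

lemma spanned_add:
  assumes "spanned f" "spanned g" shows "spanned (\<lambda>A. f A + g A)"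
proof -
  obtain \<Phi> c where f: "finite \<Phi>" "\<Phi> \<subseteq> range qc" "\<And>A. A \<in> carrier T \<Longrightarrow> f A = (\<Sum>\<phi>\<in>\<Phi>. c \<phi> * \<phi> A)"
    using assms(1) unfolding spanned_def by blast
  obtain \<Psi> e where g: "finite \<Psi>" "\<Psi> \<subseteq> range qc" "\<And>A. A \<in> carrier T \<Longrightarrow> g A = (\<Sum>\<phi>\<in>\<Psi>. e \<phi> * \<phi> A)"
    using assms(2) unfolding spanned_def by blast
  show ?thesis
    by (rule spannedI[of "\<Phi> <+> \<Psi>" "case_sum id id" _ "case_sum c e"])
      (use f g in \<open>auto simp: sum.Plus\<close>)
qed

lemma spanned_mult:
  assumes "spanned f" "spanned g" shows "spanned (\<lambda>A. f A * g A)"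
proof -
  obtain \<Phi> c where f: "finite \<Phi>" "\<Phi> \<subseteq> range qc" "\<And>A. A \<in> carrier T \<Longrightarrow> f A = (\<Sum>\<phi>\<in>\<Phi>. c \<phi> * \<phi> A)"
    using assms(1) unfolding spanned_def by blast
  obtain \<Psi> e where g: "finite \<Psi>" "\<Psi> \<subseteq> range qc" "\<And>A. A \<in> carrier T \<Longrightarrow> g A = (\<Sum>\<phi>\<in>\<Psi>. e \<phi> * \<phi> A)"
    using assms(2) unfolding spanned_def by blast
  show ?thesis
  proof (rule spannedI[of "\<Phi> \<times> \<Psi>" "\<lambda>p. fst p \<otimes>\<^bsub>M\<^esub> snd p" _ "\<lambda>p. c (fst p) * e (snd p)"])
    show "finite (\<Phi> \<times> \<Psi>)" using f g by simp
    fix p assume "p \<in> \<Phi> \<times> \<Psi>"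
    then have p: "fst p \<in> range qc" "snd p \<in> range qc" using f(2) g(2) by auto
    obtain a a' where "fst p = qc a" "snd p = qc a'" using p(1) p(2) by (elim rangeE)
    then show "fst p \<otimes>\<^bsub>M\<^esub> snd p \<in> range qc" by (simp flip: qc_add)
  next
    fix A assume A: "A \<in> carrier T"
    have "f A * g A = (\<Sum>\<phi>\<in>\<Phi>. \<Sum>\<psi>\<in>\<Psi>. (c \<phi> * \<phi> A) * (e \<psi> * \<psi> A))"
      using A by (simp add: f(3) g(3) sum_product)
    also have "\<dots> = (\<Sum>p\<in>\<Phi> \<times> \<Psi>. c (fst p) * e (snd p) * (fst p \<otimes>\<^bsub>M\<^esub> snd p) A)"
      unfolding sum.cartesian_product using A by (intro sum.cong) (auto simp: mult_M mult_ac)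
    finally show "f A * g A = (\<Sum>p\<in>\<Phi> \<times> \<Psi>. c (fst p) * e (snd p) * (fst p \<otimes>\<^bsub>M\<^esub> snd p) A)" .
  qed
qed

lemma spanned_sum: "(\<And>i. i \<in> Y \<Longrightarrow> spanned (f i)) \<Longrightarrow> spanned (\<lambda>A. \<Sum>i\<in>Y. f i A)"
  by (induction Y rule: infinite_finite_induct) (auto intro: spanned_const spanned_add)

lemma spanned_cong: "(\<And>A. A \<in> carrier T \<Longrightarrow> f A = g A) \<Longrightarrow> spanned g \<Longrightarrow> spanned f"
  unfolding spanned_def by simp

text \<open>Conjugation by \<open>Vm\<close> writes a torus element as a diagonal matrix of
  eigenvalues between two constant matrices, so its entries are linear in the eigenvalues.\<close>

lemma spanned_entry:
  assumes "u < d" "v < d" shows "spanned (\<lambda>A. A $$ (u, v))"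
proof -
  obtain V' where V': "V' \<in> carrier_mat d d" "V' * Vm = 1\<^sub>m d" by (rule Vm_inverse)
  have entry: "A $$ (u, v) = (\<Sum>i<d. V' $$ (u, i) * eig (enum i) A * Vm $$ (i, v))" if A: "A \<in> carrier T" for A
  proof -
    obtain c where c: "A = tmm c" using A by (auto simp: carrier_T)
    have "A = V' * Vm * A" using V'(2) c left_mult_one_mat[OF tmm_carrier] by simp
    also have "\<dots> = V' * (diagm (ev c) * Vm)"
      unfolding c using assoc_mult_mat[OF V'(1) Vm_carrier tmm_carrier] by (simp add: Vm_tmm)
    also have "\<dots> $$ (u, v) = (\<Sum>i\<in>{0..<d}. V' $$ (u, i) * (diagm (ev c) * Vm) $$ (i, v))"
      using V'(1) assms by (simp add: scalar_prod_def diagm_def Vm_def)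
    also have "\<dots> = (\<Sum>i<d. V' $$ (u, i) * eig (enum i) A * Vm $$ (i, v))"
      unfolding lessThan_atLeast0
    proof (intro sum.cong refl)
      fix i assume "i \<in> {0..<d}"
      then have i: "i < d" by simp
      have "(diagm (ev c) * Vm) $$ (i, v) = (\<Sum>l\<in>{0..<d}. (if i = l then ev c (enum i) else 0) * Vm $$ (l, v))"
        using i assms by (simp add: diagm_def Vm_def scalar_prod_def)
      also have "\<dots> = (\<Sum>l\<in>{0..<d}. if l = i then ev c (enum i) * Vm $$ (i, v) else 0)"
        by (intro sum.cong) auto
      also have "\<dots> = eig (enum i) A * Vm $$ (i, v)"
        using i by (simp add: c eig_tmm enum_in)
      finally show "V' $$ (u, i) * (diagm (ev c) * Vm) $$ (i, v) = V' $$ (u, i) * eig (enum i) A * Vm $$ (i, v)"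
        by simp
    qed
    finally show ?thesis .
  qed
  have sp: "spanned (\<lambda>A. \<Sum>i<d. V' $$ (u, i) * eig (enum i) A * Vm $$ (i, v))"
    by (intro spanned_sum spanned_mult spanned_const spanned_eig enum_in) auto
  show ?thesis by (rule spanned_cong[OF entry sp])
qed

lemma det_T: "A \<in> carrier T \<Longrightarrow> det A = 1"
  by (auto simp: carrier_T det_tmm)

lemma regular_spanned: "f \<in> regular_GL d \<Longrightarrow> spanned f"
proof (induction rule: regular_GL.induct)
  case inv_det
  show ?case by (rule spanned_cong[OF _ spanned_const[of 1]]) (simp add: det_T)
qed (auto intro: spanned_const spanned_entry spanned_add spanned_mult)

lemma T_nonempty: "carrier T \<noteq> {}"
proof -
  obtain A where "A \<in> carrier T" by (rule T_point[of "\<lambda>_. 1"]) simp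
  then show ?thesis by (rule ex_in_conv[THEN iffD1, OF exI])
qed

text \<open>A character is the restriction of a regular function, hence a linear combination of
  monomial characters; if it differed from all of them, independence of characters would be
  violated.\<close>

lemma qc_surj:
  assumes \<chi>: "\<chi> \<in> carrier M" shows "\<exists>a. \<chi> = qc a"
proof (rule ccontr)
  assume not: "\<not> ?thesis"
  obtain f where f: "f \<in> regular_GL d" "\<chi> = restrict f (carrier T)" using \<chi> unfolding carrier_M by blast
  obtain \<Phi> c where \<Phi>: "finite \<Phi>" "\<Phi> \<subseteq> range qc" "\<And>A. A \<in> carrier T \<Longrightarrow> f A = (\<Sum>\<phi>\<in>\<Phi>. c \<phi> * \<phi> A)"
    using regular_spanned[OF f(1)] unfolding spanned_def by blast
  have "\<chi> \<notin> \<Phi>" using not \<Phi>(2) by auto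
  have ext: "\<phi> \<in> extensional (carrier T)" if "\<phi> \<in> insert \<chi> \<Phi>" for \<phi>
  proof (cases "\<phi> = \<chi>")
    case True
    then show ?thesis by (simp add: f(2))
  next
    case False
    then have "\<phi> \<in> range qc" using that \<Phi>(2) by (elim insertE) (simp_all add: subset_iff)
    then show ?thesis by (elim rangeE) (simp add: qc_def)
  qed
  have chi: "\<chi> (A * B) = \<chi> A * \<chi> B" "\<chi> A \<noteq> 0" if "A \<in> carrier T" "B \<in> carrier T" for A B
    using \<chi> that unfolding carrier_M by (auto simp: hom_def mult_T)
  have "(if \<chi> = \<chi> then - 1 else c \<chi>) = 0"
  proof (rule dedekind_independence[where T = "carrier T" and m = "(*)" and \<Phi> = "insert \<chi> \<Phi>"
        and c = "\<lambda>\<phi>. if \<phi> = \<chi> then - 1 else c \<phi>"])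
    fix A assume A: "A \<in> carrier T"
    have "(\<Sum>\<phi>\<in>\<Phi>. (if \<phi> = \<chi> then - 1 else c \<phi>) * \<phi> A) = (\<Sum>\<phi>\<in>\<Phi>. c \<phi> * \<phi> A)"
      using \<open>\<chi> \<notin> \<Phi>\<close> by (intro sum.cong) auto
    then show "(\<Sum>\<phi>\<in>insert \<chi> \<Phi>. (if \<phi> = \<chi> then - 1 else c \<phi>) * \<phi> A) = 0"
      using \<Phi>(1,3) \<open>\<chi> \<notin> \<Phi>\<close> A f(2) by simp
  next
    fix \<phi> \<psi> assume *: "\<phi> \<in> insert \<chi> \<Phi>" "\<psi> \<in> insert \<chi> \<Phi>" "\<phi> \<noteq> \<psi>"
    show "\<exists>A\<in>carrier T. \<phi> A \<noteq> \<psi> A"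
    proof (rule ccontr)
      assume "\<not> ?thesis"
      then have "\<phi> = \<psi>" by (intro extensionalityI[OF ext[OF *(1)] ext[OF *(2)]]) simp
      then show False using *(3) by simp
    qed
  next
    fix \<phi> assume "\<phi> \<in> insert \<chi> \<Phi>"
    then have nz: "\<phi> A \<noteq> 0" if "A \<in> carrier T" for A
      using chi(2)[OF that that] qc_nonzero[OF that] \<Phi>(2) by auto
    obtain A where "A \<in> carrier T" using T_nonempty unfolding ex_in_conv[symmetric] by (elim exE)
    then show "\<exists>A\<in>carrier T. \<phi> A \<noteq> 0" using nz by (intro bexI)
  next
    fix \<phi> A B assume "\<phi> \<in> insert \<chi> \<Phi>" "A \<in> carrier T" "B \<in> carrier T"
    then show "\<phi> (A * B) = \<phi> A * \<phi> B" using chi(1)[of A B] qc_mult[of A B] \<Phi>(2) by auto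
  qed (simp_all add: \<Phi>(1) T_mult(1))
  then show False by simp
qed

lemma comm_group_M: "comm_group M"
proof (rule comm_groupI)
  fix x y assume x: "x \<in> carrier M" and y: "y \<in> carrier M"
  obtain a where "x = qc a" using qc_surj[OF x] by (elim exE)
  moreover obtain c where "y = qc c" using qc_surj[OF y] by (elim exE)
  ultimately show "x \<otimes>\<^bsub>M\<^esub> y \<in> carrier M" by (simp only: qc_add[symmetric] qc_closed)
next
  show "\<one>\<^bsub>M\<^esub> \<in> carrier M" using qc_closed[of "\<lambda>_. 0"] by (simp add: qc_const)
next
  fix x assume x: "x \<in> carrier M"
  obtain a where a: "x = qc a" using qc_surj[OF x] by (elim exE)
  have "\<one>\<^bsub>M\<^esub> \<otimes>\<^bsub>M\<^esub> x = qc (\<lambda>s. 0 + a s)" unfolding a qc_add qc_const ..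
  then show "\<one>\<^bsub>M\<^esub> \<otimes>\<^bsub>M\<^esub> x = x" by (simp add: a)
  have "qc (\<lambda>s. - a s) \<otimes>\<^bsub>M\<^esub> x = qc (\<lambda>s. - a s + a s)" unfolding a by (simp only: qc_add)
  also have "\<dots> = \<one>\<^bsub>M\<^esub>" using qc_const[of 0] by simp
  finally show "\<exists>y\<in>carrier M. y \<otimes>\<^bsub>M\<^esub> x = \<one>\<^bsub>M\<^esub>" using qc_closed by (rule bexI)
qed (auto simp: mult_M mult_ac)

text \<open>Tuples with \<open>z\<close> and its inverse at two embeddings and 1 elsewhere are
  eigenvalues of torus points. There the character takes the value \<open>z\<close> raised to the
  difference of the two exponents; as \<open>z\<close> is arbitrary in an infinite field, the
  difference vanishes.\<close>

lemma qc_eq_one: "qc a = \<one>\<^bsub>M\<^esub> \<longleftrightarrow> (\<exists>c. \<forall>s\<in>embs. a s = c)"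
proof
  assume eq: "qc a = \<one>\<^bsub>M\<^esub>"
  have ne: "a s = a s'" if s: "s \<in> embs" "s' \<in> embs" "s \<noteq> s'" for s s'
  proof -
    have "z powi (a s - a s') = 1" if z: "z \<noteq> 0" for z :: 'a
    proof -
      define t where "t r = (if r = s then z else if r = s' then inverse z else 1)" for r
      have fin: "finite (embs - {s})" "finite (embs - {s} - {s'})" using finite_embs by auto
      have split: "(\<Prod>r\<in>embs. g r) = g s * (g s' * (\<Prod>r\<in>embs - {s} - {s'}. g r))" for g :: "_ \<Rightarrow> 'a"
        using prod.remove[OF finite_embs s(1), of g] prod.remove[OF fin(1), of s' g] s by auto
      have "(\<Prod>r\<in>embs. t r) = 1" unfolding split[of t] using z s(3) by (simp add: t_def)
      then obtain A where A: "A \<in> carrier T" "\<And>r. r \<in> embs \<Longrightarrow> eig r A = t r" using T_point by blast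
      have "1 = qc a A" using eq A(1) by (simp add: one_M)
      also have "\<dots> = (\<Prod>r\<in>embs. t r powi a r)" using A by (simp add: qc_def)
      also have "\<dots> = z powi a s * inverse z powi a s'" unfolding split[of "\<lambda>r. t r powi a r"] using s(3) by (simp add: t_def)
      also have "\<dots> = z powi (a s - a s')" using z by (simp add: power_int_diff power_int_inverse divide_inverse)
      finally show ?thesis by simp
    qed
    then have "a s - a s' = 0" by (rule power_int_eq_imp)
    then show ?thesis by simp
  qed
  have eq_all: "a s = a s'" if "s \<in> embs" "s' \<in> embs" for s s'
    by (cases "s = s'") (simp, rule ne[OF that])
  show "\<exists>c. \<forall>s\<in>embs. a s = c"
  proof (cases "embs = {}")
    case False
    then obtain s0 where "s0 \<in> embs" by (auto simp: ex_in_conv[symmetric])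
    then show ?thesis by (intro exI[of _ "a s0"] ballI eq_all)
  qed simp
next
  assume "\<exists>c. \<forall>s\<in>embs. a s = c"
  then obtain c where "\<forall>s\<in>embs. a s = c" by blast
  then have "qc a = qc (\<lambda>_. c)" by (auto simp: qc_def intro!: restrict_ext prod.cong)
  then show "qc a = \<one>\<^bsub>M\<^esub>" by (simp add: qc_const)
qed

end

section \<open>The Galois action on characters\<close>

locale galois_extension = separable_closure k for k :: "'a::field set" +
  fixes \<K> :: "'a set"
  assumes gal: "finite_galois_extension k \<K>"
begin

abbreviation (input) G where "G \<equiv> Gal k \<K>"

lemma K_sub: "subfield \<K> ks" "k \<subseteq> \<K>" "ring.finite_dimension ks k \<K>"
  using gal by (auto simp: finite_galois_extension_def finite_extension_def)

sublocale G: group "Gal k \<K>" by (rule group_Gal[OF K_sub(1,2)])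

lemma finite_G: "finite (carrier G)"
  using degree_eq_card_Emb(1)[OF K_sub] unfolding Emb_def galois_image[OF gal] .

end

locale galois_algebra = algebra_basis k J F b + galois_extension k \<K>
  for k :: "'a::field set" and J :: "'j set" and F :: "'j \<Rightarrow> 'a set" and b :: "('j \<Rightarrow> 'a) list"
    and \<K> :: "'a set" +
  assumes F_K: "j \<in> J \<Longrightarrow> F j \<subseteq> \<K>"
begin

text \<open>Composition with \<open>g\<close> makes sense because the embeddings take values in
  \<open>\<K>\<close>, where \<open>g\<close> is defined.\<close>

definition star :: "('a \<Rightarrow> 'a) \<Rightarrow> 'j \<times> ('a \<Rightarrow> 'a) \<Rightarrow> 'j \<times> ('a \<Rightarrow> 'a)"
  where "star g s = (fst s, \<lambda>x\<in>F (fst s). g (snd s x))"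

lemma embs_in_K: "(j, \<tau>) \<in> embs \<Longrightarrow> x \<in> F j \<Longrightarrow> \<tau> x \<in> \<K>"
proof -
  assume *: "(j, \<tau>) \<in> embs" "x \<in> F j"
  then obtain \<sigma> where \<sigma>: "\<sigma> \<in> Aut k" "\<tau> = restrict \<sigma> (F j)" "j \<in> J" by (auto simp: embs_def Emb_def)
  have "x \<in> \<K>" using F_K[OF \<sigma>(3)] *(2) by (rule subsetD)
  from galois_stable[OF gal \<sigma>(1) this] show ?thesis using *(2) by (simp add: \<sigma>(2))
qed

lemma star_closed: assumes "g \<in> carrier G" "s \<in> embs" shows "star g s \<in> embs"
proof -
  obtain \<sigma> where \<sigma>: "\<sigma> \<in> Aut k" "restrict \<sigma> \<K> = g" by (rule Gal_lift[OF K_sub(1,2) assms(1)])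
  obtain j \<tau> where s: "s = (j, restrict \<tau> (F j))" "j \<in> J" "\<tau> \<in> Aut k" using assms(2) by (auto simp: embs_def Emb_def)
  have "(\<lambda>x\<in>F j. g (restrict \<tau> (F j) x)) = restrict (\<sigma> \<circ> \<tau>) (F j)"
    using embs_in_K[of j "restrict \<tau> (F j)"] assms(2) unfolding s(1) by (auto simp: \<sigma>(2)[symmetric])
  then show ?thesis using Aut_comp[OF \<sigma>(1) s(3)] s(2) by (auto simp: star_def s(1) embs_def Emb_def)
qed

lemma star_one: "s \<in> embs \<Longrightarrow> star \<one>\<^bsub>G\<^esub> s = s"
proof -
  assume s: "s \<in> embs"
  obtain j \<tau> where s_eq: "s = (j, \<tau>)" by (cases s)
  have "j \<in> J" "\<tau> \<in> Emb (F j)" using s by (auto simp: embs_def s_eq)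
  then have ext: "\<tau> \<in> extensional (F j)" using Emb_D(6) F_sub by blast
  have "(\<lambda>x\<in>F j. \<one>\<^bsub>G\<^esub> (\<tau> x)) = restrict \<tau> (F j)"
    using embs_in_K[of j \<tau>] s unfolding s_eq by (intro restrict_ext) (simp add: one_Gal)
  then show ?thesis using ext by (simp add: star_def s_eq extensional_restrict)
qed

lemma star_mult:
  assumes "g \<in> carrier G" "h \<in> carrier G" "s \<in> embs" shows "star (g \<otimes>\<^bsub>G\<^esub> h) s = star g (star h s)"
  using assms embs_in_K by (cases s) (auto simp: star_def mult_Gal fun_eq_iff)

text \<open>The structure constants of \<open>L\<close> lie in \<open>k\<close>, so an automorphism
  only acts on the coordinates \<open>c\<close>.\<close>

lemma map_mat_tmm:
  assumes "\<sigma> \<in> Aut k" shows "map_mat \<sigma> (tmm c) = tmm (\<lambda>r. \<sigma> (c r))"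
  by (rule eq_matI)
    (use mult_matrix_in_k in \<open>auto simp: tensor_mult_matrix_def Aut_D[OF assms] intro!: sum.cong\<close>)

lemma ev_Aut:
  assumes \<sigma>: "\<sigma> \<in> Aut k" "restrict \<sigma> \<K> = g" and s: "s \<in> embs"
  shows "\<sigma> (ev (\<lambda>r. inv_into UNIV \<sigma> (c r)) s) = ev c (star g s)"
proof -
  obtain j \<tau> where s_eq: "s = (j, \<tau>)" by (cases s)
  have j: "j \<in> J" using s by (auto simp: embs_def s_eq)
  have \<sigma>\<sigma>': "\<sigma> (inv_into UNIV \<sigma> x) = x" for x using Aut_D(1)[OF \<sigma>(1)] by (simp add: bij_is_surj surj_f_inv_f)
  have "\<sigma> (val s r) = val (star g s) r" if "r < d" for r
    using b_in[OF that j] embs_in_K[of j \<tau>] s \<sigma>(2)[symmetric] by (simp add: val_def star_def s_eq)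
  then show ?thesis by (simp add: ev_def Aut_D[OF \<sigma>(1)] \<sigma>\<sigma>')
qed

lemma bij_star: "g \<in> carrier G \<Longrightarrow> bij_betw (star g) embs embs"
  by (rule bij_betwI[of _ _ _ "star (inv\<^bsub>G\<^esub> g)"]) (auto simp: star_closed star_one simp flip: star_mult)

text \<open>Applying the inverse of the lift to a torus point and the lift to the eigenvalues
  permutes the latter through \<open>star\<close>; reindexing the product moves the permutation to
  the exponents. The result involves only \<open>g\<close>, so the chosen lift does not
  matter.\<close>

lemma act_qc:
  assumes g: "g \<in> carrier G"
  shows "character_action k \<K> T g (qc a) = qc (\<lambda>s. a (star (inv\<^bsub>G\<^esub> g) s))"
proof -
  define \<sigma> where "\<sigma> = (SOME \<sigma>. \<sigma> \<in> carrier (Gal k UNIV) \<and> restrict \<sigma> \<K> = g)"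
  obtain \<sigma>0 where "\<sigma>0 \<in> Aut k" "restrict \<sigma>0 \<K> = g" by (rule Gal_lift[OF K_sub(1,2) g])
  then have "\<exists>\<sigma>. \<sigma> \<in> carrier (Gal k UNIV) \<and> restrict \<sigma> \<K> = g" unfolding Gal_UNIV by blast
  then have "\<sigma> \<in> carrier (Gal k UNIV) \<and> restrict \<sigma> \<K> = g" unfolding \<sigma>_def by (rule someI_ex)
  then have \<sigma>: "\<sigma> \<in> Aut k" "restrict \<sigma> \<K> = g" by (simp_all add: Gal_UNIV)
  define \<sigma>' where "\<sigma>' = inv_into UNIV \<sigma>"
  have \<sigma>': "\<sigma>' \<in> Aut k" using Aut_inv[OF \<sigma>(1)] by (simp add: \<sigma>'_def)
  have bij: "bij_betw (star g) embs embs" using bij_star[OF g] .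
  have act: "character_action k \<K> T g (qc a) = (\<lambda>A\<in>carrier T. \<sigma> (qc a (map_mat \<sigma>' A)))"
    by (simp add: character_action_def \<sigma>_def \<sigma>'_def Let_def)
  have "\<sigma> (qc a (map_mat \<sigma>' A)) = (\<Prod>s\<in>embs. eig s A powi a (star (inv\<^bsub>G\<^esub> g) s))" if A: "A \<in> carrier T" for A
  proof -
    obtain c where c: "A = tmm c" "(\<Prod>s\<in>embs. ev c s) = 1" using A by (auto simp: carrier_T)
    define c' where "c' = (\<lambda>r. \<sigma>' (c r))"
    have map: "map_mat \<sigma>' A = tmm c'" using map_mat_tmm[OF \<sigma>', of c] by (simp add: c(1) c'_def)
    have ev': "\<sigma> (ev c' s) = ev c (star g s)" if "s \<in> embs" for s
      using ev_Aut[OF \<sigma> that, of c] by (simp add: c'_def \<sigma>'_def)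
    have "\<sigma> (\<Prod>s\<in>embs. ev c' s) = (\<Prod>s\<in>embs. ev c (star g s))"
      using ev' by (simp add: Aut_D[OF \<sigma>(1)])
    also have "\<dots> = 1" using prod.reindex_bij_betw[OF bij, of "ev c"] c(2) by simp
    finally have "\<sigma> (\<Prod>s\<in>embs. ev c' s) = \<sigma> 1" by (simp add: Aut_D(6)[OF \<sigma>(1)])
    then have "(\<Prod>s\<in>embs. ev c' s) = 1" using Aut_D(1)[OF \<sigma>(1)] by (meson bij_is_inj injD)
    then have "tmm c' \<in> carrier T" unfolding carrier_T by blast
    then have "\<sigma> (qc a (map_mat \<sigma>' A)) = (\<Prod>s\<in>embs. \<sigma> (ev c' s powi a s))"
      unfolding map by (simp add: qc_def eig_tmm Aut_D(12)[OF \<sigma>(1)])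
    also have "\<dots> = (\<Prod>s\<in>embs. ev c (star g s) powi a s)"
    proof (intro prod.cong refl)
      fix s assume "s \<in> embs"
      have pow: "\<sigma> (x ^ n) = \<sigma> x ^ n" for x n by (induction n) (auto simp: Aut_D[OF \<sigma>(1)])
      have "\<sigma> (x powi n) = \<sigma> x powi n" for x n
        by (simp add: power_int_def pow Aut_D(9)[OF \<sigma>(1)])
      then show "\<sigma> (ev c' s powi a s) = ev c (star g s) powi a s" using ev'[OF \<open>s \<in> embs\<close>] by simp
    qed
    also have "\<dots> = (\<Prod>s\<in>embs. ev c (star g s) powi a (star (inv\<^bsub>G\<^esub> g) (star g s)))"
      using g by (intro prod.cong refl) (simp add: star_one flip: star_mult)
    also have "\<dots> = (\<Prod>s\<in>embs. ev c s powi a (star (inv\<^bsub>G\<^esub> g) s))"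
      using prod.reindex_bij_betw[OF bij, of "\<lambda>s. ev c s powi a (star (inv\<^bsub>G\<^esub> g) s)"] .
    finally show ?thesis by (simp add: c(1) eig_tmm)
  qed
  then show ?thesis unfolding act by (auto simp: qc_def)
qed

end

section \<open>Characters modulo a prime power and cyclic towers\<close>

locale prime_power_character = mod_character G lam "int (p ^ n)"
  for G :: "'g monoid" (structure) and lam :: "'g \<Rightarrow> int" and p n :: nat +
  assumes prime_p: "Factorial_Ring.prime p"
begin

abbreviation (input) N where "N \<equiv> int (p ^ n)"

lemma p_dvd_N: "m \<le> n \<Longrightarrow> int (p ^ m) dvd N"
  by (simp add: le_imp_power_dvd)

text \<open>An element of least valuation has \<open>lam\<close> equal to \<open>p ^ f\<close> times
  a unit modulo \<open>p\<close>, unless it lies in the kernel; a suitable power of it removes the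
  unit.\<close>

lemma level_exists:
  assumes H: "subgroup H G"
  obtains f h\<^sub>0 where "f \<le> n" "\<And>h. h \<in> H \<Longrightarrow> int (p ^ f) dvd lam h" "h\<^sub>0 \<in> H" "N dvd lam h\<^sub>0 - int (p ^ f)"
proof -
  \<comment> \<open>Capping at \<open>n\<close> gives the elements of the kernel the valuation
    \<open>n\<close>, even where \<open>lam\<close> is 0.\<close>
  define v where "v h = (GREATEST m. m \<le> n \<and> int (p ^ m) dvd lam h)" for h
  have v: "v h \<le> n" "int (p ^ v h) dvd lam h" for h
    using GreatestI_nat[of "\<lambda>m. m \<le> n \<and> int (p ^ m) dvd lam h" 0 n] unfolding v_def by auto
  have v_max: "m \<le> v h" if "m \<le> n" "int (p ^ m) dvd lam h" for m h
    using Greatest_le_nat[of "\<lambda>m. m \<le> n \<and> int (p ^ m) dvd lam h" m n] that unfolding v_def by auto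
  have "\<one> \<in> H" using subgroup.one_closed[OF H] .
  then obtain h1 where h1: "h1 \<in> H" and min: "\<And>h. h \<in> H \<Longrightarrow> v h1 \<le> v h"
    using ex_has_least_nat[of "\<lambda>h. h \<in> H" \<one> v] by blast
  have HG: "h \<in> carrier G" if "h \<in> H" for h using H that by (rule subgroup.mem_carrier)
  define f where "f = v h1"
  have f: "f \<le> n" using v by (simp add: f_def)
  have all: "int (p ^ f) dvd lam h" if "h \<in> H" for h
    using dvd_trans[OF _ v(2)[of h]] min[OF that] by (simp add: f_def le_imp_power_dvd)
  show ?thesis
  proof (cases "f = n")
    case True
    then show ?thesis using that[of n \<one>] all \<open>\<one> \<in> H\<close> lam_one by simp
  next
    case False
    then have fn: "f < n" using f by simp
    obtain u where u: "lam h1 = int (p ^ f) * u" using all[OF h1] by (elim dvdE)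
    have "\<not> int p dvd u"
    proof
      assume "int p dvd u"
      then have "int (p ^ Suc f) dvd lam h1" unfolding u by (simp add: mult.commute mult_dvd_mono)
      then show False using v_max[of "Suc f" h1] fn by (simp add: f_def)
    qed
    then have "coprime (int p) u" using prime_p by (intro prime_imp_coprime) simp_all
    then have "coprime u N" by (simp add: coprime_commute)
    \<comment> \<open>\<open>w\<close> inverts the unit part of \<open>lam h1\<close> modulo
      \<open>N\<close>; its residue serves as the exponent.\<close>
    then obtain w x where wx: "w * u + x * N = 1" using bezout_int[of u N] by (auto simp: coprime_iff_gcd_eq_1)
    define t where "t = nat (w mod N)"
    have t: "int t = w mod N" using N_pos by (simp add: t_def)
    have wu: "w * u - 1 = - x * N" using wx by linarith
    have "w * lam h1 - int (p ^ f) = int (p ^ f) * (w * u - 1)" by (simp add: u right_diff_distrib mult_ac)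
    also have "\<dots> = N * (int (p ^ f) * - x)" unfolding wu by simp
    finally have 1: "N dvd w * lam h1 - int (p ^ f)" by simp
    have "N dvd - (w - w mod N)" unfolding dvd_minus_iff by (rule dvd_minus_mod)
    then have 2: "N dvd (int t - w) * lam h1" unfolding t by (intro dvd_mult2) simp
    have "N dvd (lam (h1 [^] t) - int t * lam h1) + (int t - w) * lam h1 + (w * lam h1 - int (p ^ f))"
      by (rule dvd_add[OF dvd_add[OF lam_pow[OF HG[OF h1]] 2] 1])
    then have "N dvd lam (h1 [^] t) - int (p ^ f)" by (simp add: left_diff_distrib)
    moreover have "h1 [^] t \<in> H"
      by (induction t) (simp_all add: h1 subgroup.m_closed[OF H] subgroup.one_closed[OF H])
    ultimately show ?thesis using that[OF f all] by blast
  qed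
qed

text \<open>The image of \<open>H\<close> in \<open>\<int>/p\<^sup>n\<close> is generated by \<open>p ^ level H\<close>.\<close>

definition level :: "'g set \<Rightarrow> nat"
  where "level H = (SOME f. f \<le> n \<and> (\<forall>h\<in>H. int (p ^ f) dvd lam h) \<and> (\<exists>h\<in>H. N dvd lam h - int (p ^ f)))"

lemma level:
  assumes "subgroup H G"
  shows "level H \<le> n" "h \<in> H \<Longrightarrow> int (p ^ level H) dvd lam h" "\<exists>h\<in>H. N dvd lam h - int (p ^ level H)"
proof -
  have "\<exists>f. f \<le> n \<and> (\<forall>h\<in>H. int (p ^ f) dvd lam h) \<and> (\<exists>h\<in>H. N dvd lam h - int (p ^ f))"
    by (rule level_exists[OF assms]) blast
  from someI_ex[OF this]
  show "level H \<le> n" "h \<in> H \<Longrightarrow> int (p ^ level H) dvd lam h" "\<exists>h\<in>H. N dvd lam h - int (p ^ level H)"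
    unfolding level_def[symmetric] by blast+
qed

lemma level_multiple:
  assumes "subgroup H G" "t \<ge> 0"
  obtains h where "h \<in> H" "N dvd lam h - t * int (p ^ level H)"
proof -
  obtain h where h: "h \<in> H" "N dvd lam h - int (p ^ level H)" using level(3)[OF assms(1)] by blast
  have hG: "h \<in> carrier G" using assms(1) h(1) by (rule subgroup.mem_carrier)
  have "N dvd lam (h [^] nat t) - t * lam h" using lam_pow[OF hG, of "nat t"] assms(2) by simp
  from dvd_add[OF this dvd_mult[OF h(2), of t]]
  have "N dvd lam (h [^] nat t) - t * int (p ^ level H)" by (simp add: algebra_simps)
  moreover have "h [^] k \<in> H" for k :: nat
    by (induction k) (simp_all add: h(1) subgroup.m_closed[OF assms(1)] subgroup.one_closed[OF assms(1)])
  ultimately show ?thesis using that by blast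
qed

lemma p_gt_0: "p > 0" using prime_p by (simp add: prime_gt_0_nat)

text \<open>The image of \<open>H\<close> in Z/p^m is generated by \<open>p ^ level H\<close>;
  truncated subtraction covers the case where this power already vanishes.\<close>

lemma card_image_level:
  assumes H: "subgroup H G" and m: "m \<le> n"
  shows "card ((\<lambda>h. lam h mod int (p ^ m)) ` H) = p ^ (m - level H)"
proof (cases "m \<le> level H")
  case True
  have "lam h mod int (p ^ m) = 0" if "h \<in> H" for h
    using dvd_trans[OF _ level(2)[OF H that]] True by (simp add: le_imp_power_dvd)
  moreover have "H \<noteq> {}" using subgroup.one_closed[OF H] by blast
  ultimately have "(\<lambda>h. lam h mod int (p ^ m)) ` H = {0}" by auto
  then show ?thesis using True by simp
next
  case False
  let ?f = "level H"
  have pm: "int (p ^ m) = int (p ^ ?f) * int (p ^ (m - ?f))"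
    using False by (simp flip: of_nat_mult power_add)
  have "(\<lambda>h. lam h mod int (p ^ m)) ` H = (\<lambda>t. int (p ^ ?f) * t) ` {0..<int (p ^ (m - ?f))}" (is "?A = ?B")
  proof
    show "?A \<subseteq> ?B"
    proof
      fix y assume "y \<in> ?A"
      then obtain h where h: "h \<in> H" "y = lam h mod int (p ^ m)" by blast
      obtain a where a: "lam h = int (p ^ ?f) * a" using level(2)[OF H h(1)] by (elim dvdE)
      have "y = int (p ^ ?f) * (a mod int (p ^ (m - ?f)))"
        unfolding h(2) a pm by (rule mult_mod_right[symmetric])
      then show "y \<in> ?B" using p_gt_0 by (intro image_eqI[of _ _ "a mod int (p ^ (m - ?f))"]) auto
    qed
    show "?B \<subseteq> ?A"
    proof
      fix y assume "y \<in> ?B"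
      then obtain t where t: "t \<ge> 0" "t < int (p ^ (m - ?f))" "y = int (p ^ ?f) * t" by auto
      obtain h where h: "h \<in> H" "N dvd lam h - t * int (p ^ ?f)" using level_multiple[OF H t(1)] by blast
      have "int (p ^ m) dvd lam h - y"
        using dvd_trans[OF p_dvd_N[OF m] h(2)] by (simp add: t(3) mult.commute)
      then have "lam h mod int (p ^ m) = y mod int (p ^ m)" by (simp add: mod_eq_dvd_iff)
      also have "\<dots> = y"
      proof -
        have "y < int (p ^ m)" unfolding t(3) pm using t(2) p_gt_0 by (intro mult_strict_left_mono) auto
        moreover have "0 \<le> y" using t by simp
        ultimately show ?thesis by simp
      qed
      finally show "y \<in> ?A" using h(1) by force
    qed
  qed
  moreover have "inj_on (\<lambda>t. int (p ^ ?f) * t) {0..<int (p ^ (m - ?f))}" using p_gt_0 by (auto simp: inj_on_def)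
  ultimately show ?thesis by (simp add: card_image nat_power_eq)
qed

text \<open>All values of \<open>lam\<close> on \<open>H\<close> are multiples of
  \<open>p ^ level H\<close>, and this power itself is attained modulo \<open>N\<close>.\<close>

lemma level_trivial_iff:
  assumes "subgroup H G"
  shows "(\<forall>h\<in>H. N dvd lam h * z) \<longleftrightarrow> int (p ^ (n - level H)) dvd z"
proof
  have N: "N = int (p ^ level H) * int (p ^ (n - level H))"
    using level(1)[OF assms] by (simp flip: of_nat_mult power_add)
  {
    assume "int (p ^ (n - level H)) dvd z"
    then show "\<forall>h\<in>H. N dvd lam h * z" unfolding N using level(2)[OF assms] by (auto intro: mult_dvd_mono)
  next
    assume *: "\<forall>h\<in>H. N dvd lam h * z"
    obtain h where h: "h \<in> H" "N dvd lam h - int (p ^ level H)" using level(3)[OF assms] by blast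
    have "N dvd lam h * z - (lam h - int (p ^ level H)) * z"
      by (rule dvd_diff[OF bspec[OF * h(1)] dvd_mult2[OF h(2)]])
    then have "N dvd int (p ^ level H) * z" by (simp add: algebra_simps)
    then show "int (p ^ (n - level H)) dvd z" unfolding N using p_gt_0 by simp
  }
qed

lemma exact_multiplicity:
  assumes "int (p ^ f) dvd a" "\<not> int (p ^ Suc f) dvd a" "f \<le> n"
  shows "N dvd a * z \<longleftrightarrow> int (p ^ (n - f)) dvd z"
proof -
  obtain u where u: "a = int (p ^ f) * u" using assms(1) by (elim dvdE)
  have "\<not> int p dvd u"
    using assms(2) unfolding u by (auto simp: mult.commute mult_dvd_mono)
  then have "coprime (int p) u" using prime_p by (intro prime_imp_coprime) simp_all
  then have cop: "coprime (int (p ^ (n - f))) u" by simp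
  have N: "N = int (p ^ f) * int (p ^ (n - f))"
    using assms(3) by (simp flip: of_nat_mult power_add)
  have "N dvd a * z \<longleftrightarrow> int (p ^ (n - f)) dvd u * z"
    unfolding N u using p_gt_0 by (simp add: mult.assoc)
  also have "\<dots> \<longleftrightarrow> int (p ^ (n - f)) dvd z"
    using cop by (simp add: coprime_dvd_mult_right_iff)
  finally show ?thesis .
qed

end

section \<open>Degrees and fixing subgroups of intermediate fields\<close>

context separable_closure
begin

lemma finite_dimension_over:
  assumes "ring.finite_dimension ks k F" "subfield E ks" "k \<subseteq> E" "E \<subseteq> F" "subfield F ks"
  shows "ring.finite_dimension ks E F"
proof -
  interpret K: field "ks :: 'a ring" by (rule field_ks)
  obtain Us where Us: "set Us \<subseteq> carrier ks" "K.Span k Us = F"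
    using K.exists_base[OF subfield_k K.finite_dimensionE[OF subfield_k assms(1)]] by blast
  have "K.Span E Us = F"
  proof
    have "K.Span k Us \<subseteq> K.Span E Us"
      unfolding K.Span_eq_combine_set[OF subfield_k Us(1)] K.Span_eq_combine_set[OF assms(2) Us(1)] using assms(3) by blast
    then show "F \<subseteq> K.Span E Us" using Us(2) by simp
    have "set Us \<subseteq> F" using K.Span_base_incl[OF subfield_k Us(1)] Us(2) by simp
    then have "E <#>\<^bsub>ks\<^esub> set Us \<subseteq> F"
      using assms(4) subfield_ksD(4)[OF assms(5)] by (auto simp: set_mult_def)
    then show "K.Span E Us \<subseteq> F"
      by (rule K.Span_min[OF assms(2) Us(1) subring.axioms(1)[OF subfieldE(1)[OF assms(5)]]])
  qed
  then show ?thesis using K.Span_finite_dimension[OF assms(2) Us(1)] by simp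
qed

end

context galois_extension
begin

lemma G_hom:
  assumes "g \<in> carrier G" "x \<in> \<K>" "y \<in> \<K>"
  shows "g (x + y) = g x + g y" "g (x * y) = g x * g y" "g (- x) = - g x" "g (inverse x) = inverse (g x)" "g 1 = 1" "g 0 = 0"
proof -
  obtain \<sigma> where \<sigma>: "\<sigma> \<in> Aut k" "restrict \<sigma> \<K> = g" by (rule Gal_lift[OF K_sub(1,2) assms(1)])
  note c = subfield_ksD[OF K_sub(1)]
  show "g (x + y) = g x + g y" "g (x * y) = g x * g y" "g (- x) = - g x" "g (inverse x) = inverse (g x)" "g 1 = 1" "g 0 = 0"
    unfolding \<sigma>(2)[symmetric] using assms(2,3) c by (simp_all add: Aut_D[OF \<sigma>(1)])
qed

lemmas G_hom1 = G_hom(3-6)[OF _ _ K_sub(2)[THEN subsetD, OF k_closed(1)]]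

lemma mult_apply: "g \<in> carrier G \<Longrightarrow> h \<in> carrier G \<Longrightarrow> x \<in> \<K> \<Longrightarrow> (g \<otimes>\<^bsub>G\<^esub> h) x = g (h x)"
  by (simp add: mult_Gal)

lemma one_apply: "x \<in> \<K> \<Longrightarrow> \<one>\<^bsub>G\<^esub> x = x"
  by (simp add: one_Gal)

lemma inv_apply: "g \<in> carrier G \<Longrightarrow> x \<in> \<K> \<Longrightarrow> (inv\<^bsub>G\<^esub> g) (g x) = x"
  by (simp flip: mult_apply add: one_apply)

lemma inv_apply': "g \<in> carrier G \<Longrightarrow> x \<in> \<K> \<Longrightarrow> g ((inv\<^bsub>G\<^esub> g) x) = x"
  by (simp flip: mult_apply add: one_apply)

lemma fixed_subfield:
  assumes "H \<subseteq> carrier G" "subfield E ks" "E \<subseteq> \<K>"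
  shows "subfield {x \<in> E. \<forall>g\<in>H. g x = x} ks"
proof -
  note c = subfield_ksD[OF assms(2)]
  show ?thesis
    by (rule subfield_ksI) (use assms(1,3) c in \<open>auto simp: subset_iff G_hom(1,2) G_hom1\<close>)
qed

lemma subgroup_fixing: "F \<subseteq> \<K> \<Longrightarrow> subgroup (fixing_subgroup G F) G"
proof (rule G.subgroupI)
  assume F: "F \<subseteq> \<K>"
  have "\<one>\<^bsub>G\<^esub> \<in> fixing_subgroup G F" using F by (auto simp: fixing_subgroup_def one_apply)
  then show "fixing_subgroup G F \<noteq> {}" by blast
  fix g assume g: "g \<in> fixing_subgroup G F"
  have gG: "g \<in> carrier G" using g by (simp add: fixing_subgroup_def)
  have "(inv\<^bsub>G\<^esub> g) x = x" if x: "x \<in> F" for x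
  proof -
    have "x \<in> \<K>" "g x = x" using x F g by (auto simp: fixing_subgroup_def)
    then show ?thesis using inv_apply[OF gG, of x] by simp
  qed
  then show "inv\<^bsub>G\<^esub> g \<in> fixing_subgroup G F" using gG by (simp add: fixing_subgroup_def)
  fix h assume h: "h \<in> fixing_subgroup G F"
  have hG: "h \<in> carrier G" using h by (simp add: fixing_subgroup_def)
  have "(g \<otimes>\<^bsub>G\<^esub> h) x = x" if x: "x \<in> F" for x
    using x F g h mult_apply[OF gG hG, of x] by (auto simp: fixing_subgroup_def)
  then show "g \<otimes>\<^bsub>G\<^esub> h \<in> fixing_subgroup G F" using gG hG by (simp add: fixing_subgroup_def)
qed (auto simp: fixing_subgroup_def)

lemma restrict_eq_iff:
  assumes "F \<subseteq> \<K>" "g \<in> carrier G" "h \<in> carrier G"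
  shows "restrict g F = restrict h F \<longleftrightarrow> inv\<^bsub>G\<^esub> h \<otimes>\<^bsub>G\<^esub> g \<in> fixing_subgroup G F"
proof -
  have gK: "g x \<in> \<K>" if "x \<in> \<K>" for x using Gal_closed[OF assms(2) that] .
  have "restrict g F = restrict h F \<longleftrightarrow> (\<forall>x\<in>F. g x = h x)"
    by (metis restrict_apply' restrict_ext)
  also have "\<dots> \<longleftrightarrow> (\<forall>x\<in>F. (inv\<^bsub>G\<^esub> h \<otimes>\<^bsub>G\<^esub> g) x = x)"
  proof (intro ball_cong refl)
    fix x assume "x \<in> F"
    then have x: "x \<in> \<K>" using assms(1) by blast
    have "(inv\<^bsub>G\<^esub> h \<otimes>\<^bsub>G\<^esub> g) x = (inv\<^bsub>G\<^esub> h) (g x)" using mult_apply[OF _ assms(2) x] assms(3) by simp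
    moreover have "(inv\<^bsub>G\<^esub> h) (g x) = x \<longleftrightarrow> g x = h x"
      using inv_apply[OF assms(3) x] inv_apply'[OF assms(3) gK[OF x]] by metis
    ultimately show "g x = h x \<longleftrightarrow> (inv\<^bsub>G\<^esub> h \<otimes>\<^bsub>G\<^esub> g) x = x" by simp
  qed
  also have "\<dots> \<longleftrightarrow> inv\<^bsub>G\<^esub> h \<otimes>\<^bsub>G\<^esub> g \<in> fixing_subgroup G F"
    using assms by (simp add: fixing_subgroup_def)
  finally show ?thesis .
qed

text \<open>Elements of the Galois group fixing \<open>E\<close> are the restrictions of
  automorphisms over \<open>E\<close>, so restricting them to \<open>F\<close> gives exactly the
  \<open>E\<close>-embeddings of \<open>F\<close>, whose number is the degree.\<close>

lemma degree_eq_card_restrict: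
  assumes E: "subfield E ks" "k \<subseteq> E" and F: "subfield F ks" "E \<subseteq> F" "F \<subseteq> \<K>"
  shows "ring.dim ks E F = card ((\<lambda>g. restrict g F) ` fixing_subgroup G E)"
proof -
  interpret E: separable_closure E by (rule separable_closure_mono[OF E])
  have "ring.finite_dimension ks k F"
    using finite_dimension_mono[OF K_sub(3) F(1) _ F(3)] E(2) F(2) by blast
  then have "ring.finite_dimension ks E F"
    using finite_dimension_over[OF _ E F(2,1)] by blast
  then have "ring.dim ks E F = card (E.Emb F)" by (rule E.degree_eq_card_Emb(2)[OF F(1,2)])
  also have "E.Emb F = (\<lambda>g. restrict g F) ` fixing_subgroup G E"
  proof
    show "E.Emb F \<subseteq> (\<lambda>g. restrict g F) ` fixing_subgroup G E"
    proof
      fix \<tau> assume "\<tau> \<in> E.Emb F"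
      then obtain \<sigma> where \<sigma>: "\<sigma> \<in> Aut E" "\<tau> = restrict \<sigma> F" by (auto simp: E.Emb_def)
      have "restrict \<sigma> \<K> \<in> carrier G" using restrict_Aut_Gal[OF gal] Aut_mono[OF E(2)] \<sigma>(1) by blast
      then have "restrict \<sigma> \<K> \<in> fixing_subgroup G E"
        using F(2,3) Aut_D(4)[OF \<sigma>(1)] by (auto simp: fixing_subgroup_def)
      moreover have "\<tau> = restrict (restrict \<sigma> \<K>) F" unfolding \<sigma>(2) using F(3) by (intro restrict_ext) auto
      ultimately show "\<tau> \<in> (\<lambda>g. restrict g F) ` fixing_subgroup G E" by blast
    qed
    show "(\<lambda>g. restrict g F) ` fixing_subgroup G E \<subseteq> E.Emb F"
    proof
      fix \<tau> assume "\<tau> \<in> (\<lambda>g. restrict g F) ` fixing_subgroup G E"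
      then obtain g where g: "g \<in> fixing_subgroup G E" "\<tau> = restrict g F" by blast
      then have gG: "g \<in> carrier G" by (simp add: fixing_subgroup_def)
      obtain \<sigma> where \<sigma>: "\<sigma> \<in> Aut k" "restrict \<sigma> \<K> = g" by (rule Gal_lift[OF K_sub(1,2) gG])
      have val: "\<sigma> x = g x" if "x \<in> \<K>" for x using \<sigma>(2) that by auto
      have "\<sigma> \<in> Aut E"
        using \<sigma>(1) g(1) val F(2,3) by (auto simp: Aut_def fixing_subgroup_def subset_iff)
      moreover have "\<tau> = restrict \<sigma> F" unfolding g(2) using F(3) val by (intro restrict_ext) auto
      ultimately show "\<tau> \<in> E.Emb F" by (auto simp: E.Emb_def)
    qed
  qed
  finally show ?thesis .
qed

lemma fixing_generate_field:
  assumes "A \<subseteq> \<K>" "B \<subseteq> \<K>"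
  shows "fixing_subgroup G (generate_field ks (A \<union> B)) = fixing_subgroup G A \<inter> fixing_subgroup G B"
    and "generate_field ks (A \<union> B) \<subseteq> \<K>" and "subfield (generate_field ks (A \<union> B)) ks"
    and "A \<union> B \<subseteq> generate_field ks (A \<union> B)"
proof -
  interpret K: field "ks :: 'a ring" by (rule field_ks)
  show sub: "subfield (generate_field ks (A \<union> B)) ks" by (rule K.generate_field_is_subfield) simp
  show incl: "A \<union> B \<subseteq> generate_field ks (A \<union> B)" by (auto intro: generate_field.incl)
  show genK: "generate_field ks (A \<union> B) \<subseteq> \<K>"
    by (rule K.generate_field_min_subfield1[OF _ K_sub(1)]) (use assms in auto)
  show "fixing_subgroup G (generate_field ks (A \<union> B)) = fixing_subgroup G A \<inter> fixing_subgroup G B"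
  proof
    show "fixing_subgroup G A \<inter> fixing_subgroup G B \<subseteq> fixing_subgroup G (generate_field ks (A \<union> B))"
    proof
      fix g assume g: "g \<in> fixing_subgroup G A \<inter> fixing_subgroup G B"
      then have gG: "g \<in> carrier G" by (simp add: fixing_subgroup_def)
      have "subfield {x \<in> \<K>. \<forall>h\<in>{g}. h x = x} ks" using fixed_subfield[of "{g}" \<K>] gG K_sub(1) by simp
      then have "generate_field ks (A \<union> B) \<subseteq> {x \<in> \<K>. \<forall>h\<in>{g}. h x = x}"
        using g assms by (intro K.generate_field_min_subfield1) (auto simp: fixing_subgroup_def)
      then show "g \<in> fixing_subgroup G (generate_field ks (A \<union> B))" using gG by (auto simp: fixing_subgroup_def)
    qed
  qed (use incl in \<open>auto simp: fixing_subgroup_def\<close>)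
qed

end

lemma subfield_ks_sum:
  assumes "subfield F ks" "\<And>a. a \<in> A \<Longrightarrow> f a \<in> F" shows "sum f A \<in> F"
  using assms(2) by (induction A rule: infinite_finite_induct) (auto simp: subfield_ksD[OF assms(1)])

lemma card_image_eq_if_same_kernel:
  assumes "\<And>x y. x \<in> A \<Longrightarrow> y \<in> A \<Longrightarrow> f x = f y \<longleftrightarrow> g x = g y"
  shows "card (f ` A) = card (g ` A)"
proof (rule bij_betw_same_card[of "\<lambda>y. g (inv_into A f y)"])
  have i: "inv_into A f (f x) \<in> A" "f (inv_into A f (f x)) = f x" if "x \<in> A" for x
    using that by (auto intro: inv_into_into f_inv_into_f)
  then have g: "g (inv_into A f (f x)) = g x" if "x \<in> A" for x using assms that by blast
  show "bij_betw (\<lambda>y. g (inv_into A f y)) (f ` A) (g ` A)"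
    unfolding bij_betw_def by (auto simp: inj_on_def g assms image_image)
qed

section \<open>The character of a cyclic extension and its intermediate fields\<close>

locale cyclic_tower = galois_extension k \<K> for k :: "'a::field set" and \<K> +
  fixes K :: "'a set" and p n :: nat
  assumes prime_p: "Factorial_Ring.prime p" and cyclic_K: "cyclic_extension k K (p ^ n)"
    and K_sub_KK: "K \<subseteq> \<K>"
begin

lemma galois_K: "finite_galois_extension k K" and dim_K: "ring.dim ks k K = p ^ n"
  and cyclic_Gal_K: "cyclic_group (Gal k K)"
  using cyclic_K by (simp_all add: cyclic_extension_def)

lemma K_field: "subfield K ks" "k \<subseteq> K" "ring.finite_dimension ks k K"
  using galois_K by (auto simp: finite_galois_extension_def finite_extension_def)

sublocale Q: group "Gal k K" by (rule group_Gal[OF K_field(1,2)])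

lemma card_Gal_K: "card (carrier (Gal k K)) = p ^ n"
  using degree_eq_card_Emb(2)[OF K_field] dim_K unfolding Emb_def galois_image[OF galois_K] by simp

definition gen :: "'a \<Rightarrow> 'a"
  where "gen = (SOME x. x \<in> carrier (Gal k K) \<and> carrier (Gal k K) = range (\<lambda>i::int. x [^]\<^bsub>Gal k K\<^esub> i))"

lemma gen: "gen \<in> carrier (Gal k K)" "carrier (Gal k K) = range (\<lambda>i::int. gen [^]\<^bsub>Gal k K\<^esub> i)"
proof -
  have "\<exists>x. x \<in> carrier (Gal k K) \<and> carrier (Gal k K) = range (\<lambda>i::int. x [^]\<^bsub>Gal k K\<^esub> i)"
    using cyclic_Gal_K Q.cyclic_group by blast
  from someI_ex[OF this] show "gen \<in> carrier (Gal k K)" "carrier (Gal k K) = range (\<lambda>i::int. gen [^]\<^bsub>Gal k K\<^esub> i)"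
    unfolding gen_def[symmetric] by blast+
qed

lemma ord_gen: "Q.ord gen = p ^ n"
proof -
  have "generate (Gal k K) {gen} = carrier (Gal k K)"
    unfolding Q.generate_pow[OF gen(1)] gen(2) by blast
  then show ?thesis using Q.generate_pow_card[OF gen(1)] card_Gal_K by simp
qed

text \<open>The discrete logarithm of the restriction to \<open>K\<close> with respect to
  \<open>gen\<close>. The exponent is determined only modulo \<open>p ^ n\<close>, whence additivity
  modulo \<open>p ^ n\<close>.\<close>

definition lam :: "('a \<Rightarrow> 'a) \<Rightarrow> int"
  where "lam g = (SOME i. gen [^]\<^bsub>Gal k K\<^esub> i = restrict g K)"

lemma restrict_G_K: assumes "g \<in> carrier G" shows "restrict g K \<in> carrier (Gal k K)"
proof -
  obtain \<sigma> where \<sigma>: "\<sigma> \<in> Aut k" "restrict \<sigma> \<K> = g" by (rule Gal_lift[OF K_sub(1,2) assms])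
  have "restrict g K = restrict \<sigma> K" unfolding \<sigma>(2)[symmetric] using K_sub_KK by (intro restrict_ext) auto
  then show ?thesis using restrict_Aut_Gal[OF galois_K \<sigma>(1)] by simp
qed

lemma gen_lam: "g \<in> carrier G \<Longrightarrow> gen [^]\<^bsub>Gal k K\<^esub> lam g = restrict g K"
proof -
  assume "g \<in> carrier G"
  then have "restrict g K \<in> range (\<lambda>i::int. gen [^]\<^bsub>Gal k K\<^esub> i)" using restrict_G_K gen(2) by simp
  then have "\<exists>i. gen [^]\<^bsub>Gal k K\<^esub> (i::int) = restrict g K" by (metis rangeE)
  then show ?thesis unfolding lam_def by (rule someI_ex)
qed

lemma gen_pow_eq: "gen [^]\<^bsub>Gal k K\<^esub> (i::int) = gen [^]\<^bsub>Gal k K\<^esub> j \<longleftrightarrow> int (p ^ n) dvd j - i"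
  using Q.int_pow_eq[OF gen(1), of i j] by (simp add: ord_gen)

lemma restrict_mult_K:
  assumes "g \<in> carrier G" "h \<in> carrier G"
  shows "restrict (g \<otimes>\<^bsub>G\<^esub> h) K = restrict g K \<otimes>\<^bsub>Gal k K\<^esub> restrict h K"
proof -
  have "restrict (g \<otimes>\<^bsub>G\<^esub> h) K = (\<lambda>x\<in>K. restrict g K (restrict h K x))"
    using Gal_closed[OF restrict_G_K[OF assms(2)]] K_sub_KK mult_apply[OF assms]
    by (intro restrict_ext) (auto simp: subset_iff)
  then show ?thesis using mult_Gal[OF restrict_G_K[OF assms(1)] restrict_G_K[OF assms(2)]] by simp
qed

sublocale L: prime_power_character "Gal k \<K>" lam p n
proof (unfold_locales)
  show "int (p ^ n) > 0" using prime_p by (simp add: prime_gt_0_nat)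
  show "Factorial_Ring.prime p" by (rule prime_p)
  fix g h assume gh: "g \<in> carrier G" "h \<in> carrier G"
  have "gen [^]\<^bsub>Gal k K\<^esub> (lam g + lam h) = gen [^]\<^bsub>Gal k K\<^esub> lam (g \<otimes>\<^bsub>G\<^esub> h)"
    using restrict_mult_K[OF gh] gh by (simp add: Q.int_pow_mult[OF gen(1)] gen_lam)
  then show "int (p ^ n) dvd lam (g \<otimes>\<^bsub>G\<^esub> h) - (lam g + lam h)" using gen_pow_eq by simp
qed

abbreviation (input) N where "N \<equiv> int (p ^ n)"

lemma restrict_K_eq_iff:
  assumes "g \<in> carrier G" "h \<in> carrier G"
  shows "restrict g K = restrict h K \<longleftrightarrow> N dvd lam h - lam g"
  using gen_pow_eq[of "lam g" "lam h"] assms by (simp add: gen_lam)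

lemma lam_kernel: assumes "g \<in> carrier G" shows "N dvd lam g \<longleftrightarrow> (\<forall>x\<in>K. g x = x)"
proof -
  have "restrict g K = restrict \<one>\<^bsub>G\<^esub> K \<longleftrightarrow> (\<forall>x\<in>K. g x = \<one>\<^bsub>G\<^esub> x)"
    by (metis restrict_apply' restrict_ext)
  also have "\<dots> \<longleftrightarrow> (\<forall>x\<in>K. g x = x)" using K_sub_KK by (intro ball_cong refl) (simp add: one_apply subset_iff)
  finally have "(\<forall>x\<in>K. g x = x) \<longleftrightarrow> N dvd lam \<one>\<^bsub>G\<^esub> - lam g"
    using restrict_K_eq_iff[OF assms G.one_closed] by simp
  also have "\<dots> \<longleftrightarrow> N dvd lam g" by (rule dvd_diff_right_iff[OF L.lam_one])
  finally show ?thesis by simp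
qed

lemma lam_surj: obtains g where "g \<in> carrier G" "N dvd lam g - i"
proof -
  have "gen [^]\<^bsub>Gal k K\<^esub> i \<in> carrier (Gal k K)" using gen(1) by (rule Q.int_pow_closed)
  then obtain \<sigma> where \<sigma>: "\<sigma> \<in> Aut k" "restrict \<sigma> K = gen [^]\<^bsub>Gal k K\<^esub> i"
    using galois_image[OF galois_K] by (metis (no_types, lifting) imageE)
  let ?g = "restrict \<sigma> \<K>"
  have g: "?g \<in> carrier G" using restrict_Aut_Gal[OF gal \<sigma>(1)] .
  have "restrict ?g K = restrict \<sigma> K" using K_sub_KK by (intro restrict_ext) auto
  then have "gen [^]\<^bsub>Gal k K\<^esub> i = gen [^]\<^bsub>Gal k K\<^esub> lam ?g" using gen_lam[OF g] \<sigma>(2) by simp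
  then show ?thesis using that[OF g] gen_pow_eq by blast
qed

lemma lam_diff: "g \<in> carrier G \<Longrightarrow> h \<in> carrier G \<Longrightarrow> N dvd lam (inv\<^bsub>G\<^esub> h \<otimes>\<^bsub>G\<^esub> g) - (lam g - lam h)"
  using dvd_add[OF L.lam_mult[of "inv\<^bsub>G\<^esub> h" g] L.lam_inv[of h]] by (simp add: algebra_simps)

lemma dvd_lam_diff_iff:
  assumes "g \<in> carrier G" "h \<in> carrier G" "m \<le> n"
  shows "int (p ^ m) dvd lam (inv\<^bsub>G\<^esub> h \<otimes>\<^bsub>G\<^esub> g) \<longleftrightarrow> lam g mod int (p ^ m) = lam h mod int (p ^ m)"
proof -
  let ?a = "lam (inv\<^bsub>G\<^esub> h \<otimes>\<^bsub>G\<^esub> g)"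
  have d: "int (p ^ m) dvd ?a - (lam g - lam h)"
    using dvd_trans[OF L.p_dvd_N[OF assms(3)] lam_diff[OF assms(1,2)]] .
  have "int (p ^ m) dvd ?a \<longleftrightarrow> int (p ^ m) dvd lam g - lam h"
    using dvd_add[OF d, of "lam g - lam h"] dvd_diff[of "int (p ^ m)" ?a "?a - (lam g - lam h)"] d by auto
  then show ?thesis by (simp add: mod_eq_dvd_iff)
qed

definition multiples :: "nat \<Rightarrow> ('a \<Rightarrow> 'a) set"
  where "multiples m = {g \<in> carrier G. int (p ^ m) dvd lam g}"

text \<open>The candidate for \<open>K(m)\<close> when \<open>m \<le> n\<close>: the field fixed by
  the elements whose \<open>lam\<close> vanishes modulo \<open>p ^ m\<close>.\<close>

definition layer :: "nat \<Rightarrow> 'a set"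
  where "layer m = {x \<in> K. \<forall>g\<in>multiples m. g x = x}"

lemma layer_subfield: "subfield (layer m) ks" "k \<subseteq> layer m" "layer m \<subseteq> K"
proof -
  show "subfield (layer m) ks"
    unfolding layer_def by (rule fixed_subfield) (use K_field K_sub_KK in \<open>auto simp: multiples_def\<close>)
  show "k \<subseteq> layer m"
    using K_field(2) carrier_Gal[OF K_sub(1)] by (auto simp: layer_def multiples_def)
qed (auto simp: layer_def)

lemma subgroup_multiples: assumes m: "m \<le> n" shows "subgroup (multiples m) G"
proof (rule G.subgroupI)
  show "multiples m \<noteq> {}"
    using dvd_trans[OF L.p_dvd_N[OF m] L.lam_one] by (auto simp: multiples_def)
next
  fix g assume "g \<in> multiples m"
  then show "inv\<^bsub>G\<^esub> g \<in> multiples m"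
    using dvd_trans[OF L.p_dvd_N[OF m] L.lam_inv[of g]]
    by (auto simp: multiples_def dvd_add_left_iff)
next
  fix g h assume gh: "g \<in> multiples m" "h \<in> multiples m"
  then have "int (p ^ m) dvd lam (g \<otimes>\<^bsub>G\<^esub> h) - (lam g + lam h)" "int (p ^ m) dvd lam g + lam h"
    using dvd_trans[OF L.p_dvd_N[OF m] L.lam_mult[of g h]] by (auto simp: multiples_def)
  then have "int (p ^ m) dvd (lam (g \<otimes>\<^bsub>G\<^esub> h) - (lam g + lam h)) + (lam g + lam h)" by (rule dvd_add)
  then show "g \<otimes>\<^bsub>G\<^esub> h \<in> multiples m" using gh by (auto simp: multiples_def)
qed (auto simp: multiples_def)

text \<open>The trace of \<open>K\<close> over the fixed field of a subgroup is invariant under every automorphism fixing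
  that field; by independence of automorphisms such an automorphism permutes the subgroup.\<close>

lemma fixing_layer: assumes m: "m \<le> n" shows "fixing_subgroup G (layer m) = multiples m"
proof
  show "multiples m \<subseteq> fixing_subgroup G (layer m)"
    by (auto simp: multiples_def layer_def fixing_subgroup_def)
  show "fixing_subgroup G (layer m) \<subseteq> multiples m"
  proof (rule ccontr)
    assume "\<not> ?thesis"
    then obtain \<delta> where \<delta>: "\<delta> \<in> carrier G" "\<And>x. x \<in> layer m \<Longrightarrow> \<delta> x = x" "\<not> int (p ^ m) dvd lam \<delta>"
      by (auto simp: multiples_def fixing_subgroup_def)
    define r where "r g = restrict g K" for g :: "'a \<Rightarrow> 'a"
    define U where "U = r ` multiples m"
    \<comment> \<open>The translate by \<open>\<delta>\<close> is disjoint from \<open>U\<close>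
      because \<open>lam \<delta>\<close> is not divisible by \<open>p ^ m\<close>.\<close>
    define U' where "U' = (\<lambda>g. r (\<delta> \<otimes>\<^bsub>G\<^esub> g)) ` multiples m"
    have mG: "g \<in> carrier G" if "g \<in> multiples m" for g using that by (simp add: multiples_def)
    have fin: "finite U" "finite U'" unfolding U_def U'_def multiples_def using finite_G by auto
    have disj: "U \<inter> U' = {}"
    proof (rule ccontr)
      assume "U \<inter> U' \<noteq> {}"
      then obtain g h where gh: "g \<in> multiples m" "h \<in> multiples m" "r g = r (\<delta> \<otimes>\<^bsub>G\<^esub> h)"
        by (auto simp: U_def U'_def)
      have "N dvd lam (\<delta> \<otimes>\<^bsub>G\<^esub> h) - lam g"
        using restrict_K_eq_iff[OF mG[OF gh(1)] G.m_closed[OF \<delta>(1) mG[OF gh(2)]]] gh(3) by (simp add: r_def)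
      from dvd_diff[OF this L.lam_mult[OF \<delta>(1) mG[OF gh(2)]]]
      have "N dvd lam \<delta> + lam h - lam g" by (simp add: algebra_simps)
      then have "int (p ^ m) dvd lam \<delta> + lam h - lam g" using dvd_trans[OF L.p_dvd_N[OF m]] by blast
      moreover have gh_dvd: "int (p ^ m) dvd lam g" "int (p ^ m) dvd lam h" using gh by (auto simp: multiples_def)
      ultimately have "int (p ^ m) dvd (lam \<delta> + lam h - lam g) + lam g - lam h"
        using dvd_diff[OF dvd_add[OF _ gh_dvd(1)] gh_dvd(2)] by blast
      then show False using \<delta>(3) by simp
    qed
    define t where "t x = (\<Sum>u\<in>U. u x)" for x
    have UK: "u x \<in> K" if "u \<in> U" "x \<in> K" for u x
      using that Gal_closed[OF restrict_G_K[OF mG]] by (auto simp: U_def r_def)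
    have t_K: "t x \<in> K" if "x \<in> K" for x
      unfolding t_def using UK[OF _ that] by (rule subfield_ks_sum[OF K_field(1)])
    have apply_sum: "g (\<Sum>u\<in>V. u x) = (\<Sum>u\<in>V. g (u x))" if "g \<in> carrier G" "finite V" "\<And>u. u \<in> V \<Longrightarrow> u x \<in> \<K>" for g V x
      using that(2,3)
    proof (induction V rule: finite_induct)
      case empty
      then show ?case using G_hom(6)[OF that(1), of 0 0] subfield_ksD(1)[OF K_sub(1)] by simp
    next
      case (insert u V)
      have "(\<Sum>u\<in>V. u x) \<in> \<K>"
        using insert.prems by (intro subfield_ks_sum[OF K_sub(1)]) simp
      then show ?case using insert G_hom(1)[OF that(1)] by simp
    qed
    have comp: "g (r h x) = r (g \<otimes>\<^bsub>G\<^esub> h) x" if "g \<in> carrier G" "h \<in> carrier G" "x \<in> K" for g h x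
      using that mult_apply[OF that(1,2)] K_sub_KK by (auto simp: r_def)
    have inj: "r (g \<otimes>\<^bsub>G\<^esub> h) = r (g \<otimes>\<^bsub>G\<^esub> h') \<longleftrightarrow> r h = r h'"
      if "g \<in> carrier G" "h \<in> carrier G" "h' \<in> carrier G" for g h h'
      using restrict_mult_K restrict_G_K Q.l_cancel that by (simp add: r_def)
    have transl: "g (t x) = (\<Sum>u\<in>(\<lambda>h. r (g \<otimes>\<^bsub>G\<^esub> h)) ` multiples m. u x)" if g: "g \<in> carrier G" and x: "x \<in> K" for g x
    proof -
      have "g (t x) = (\<Sum>u\<in>U. g (u x))"
        unfolding t_def using UK[OF _ x] K_sub_KK by (intro apply_sum[OF g fin(1)]) auto
      also have "\<dots> = (\<Sum>u\<in>(\<lambda>h. r (g \<otimes>\<^bsub>G\<^esub> h)) ` multiples m. u x)"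
      proof (rule sum.reindex_bij_betw[of "\<lambda>u. \<lambda>y\<in>K. g (u y)" U, of _ "\<lambda>u. u x", THEN trans[rotated]])
        have eq: "(\<lambda>y\<in>K. g (r h y)) = r (g \<otimes>\<^bsub>G\<^esub> h)" if "h \<in> carrier G" for h
          using comp[OF g that] by (auto simp: fun_eq_iff r_def)
        show "bij_betw (\<lambda>u. \<lambda>y\<in>K. g (u y)) U ((\<lambda>h. r (g \<otimes>\<^bsub>G\<^esub> h)) ` multiples m)"
          unfolding bij_betw_def
        proof
          show "inj_on (\<lambda>u. \<lambda>y\<in>K. g (u y)) U"
          proof (rule inj_onI)
            fix u u' assume "u \<in> U" "u' \<in> U" and e: "(\<lambda>y\<in>K. g (u y)) = (\<lambda>y\<in>K. g (u' y))"
            then obtain h h' where h: "h \<in> multiples m" "h' \<in> multiples m" "u = r h" "u' = r h'" by (auto simp: U_def)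
            then show "u = u'" using e inj[OF g mG mG, OF h(1,2)] by (simp only: h(3,4) eq[OF mG[OF h(1)]] eq[OF mG[OF h(2)]])
          qed
          show "(\<lambda>u. \<lambda>y\<in>K. g (u y)) ` U = (\<lambda>h. r (g \<otimes>\<^bsub>G\<^esub> h)) ` multiples m"
            unfolding U_def image_image using eq[OF mG] by (intro image_cong) auto
        qed
        show "(\<Sum>u\<in>U. g (u x)) = (\<Sum>u\<in>U. (\<lambda>y\<in>K. g (u y)) x)" using x by simp
      qed
      finally show ?thesis .
    qed
    have "t x \<in> layer m" if x: "x \<in> K" for x
    proof -
      have "g (t x) = t x" if g: "g \<in> multiples m" for g
      proof -
        note sub = subgroup_multiples[OF m]
        have "(\<lambda>h. r (g \<otimes>\<^bsub>G\<^esub> h)) ` multiples m = U"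
        proof
          show "(\<lambda>h. r (g \<otimes>\<^bsub>G\<^esub> h)) ` multiples m \<subseteq> U"
            using subgroup.m_closed[OF sub g] by (auto simp: U_def)
          show "U \<subseteq> (\<lambda>h. r (g \<otimes>\<^bsub>G\<^esub> h)) ` multiples m"
          proof
            fix u assume "u \<in> U"
            then obtain h where h: "h \<in> multiples m" "u = r h" by (auto simp: U_def)
            have "inv\<^bsub>G\<^esub> g \<otimes>\<^bsub>G\<^esub> h \<in> multiples m"
              using subgroup.m_closed[OF sub subgroup.m_inv_closed[OF sub g] h(1)] .
            moreover have "g \<otimes>\<^bsub>G\<^esub> (inv\<^bsub>G\<^esub> g \<otimes>\<^bsub>G\<^esub> h) = h"
              using mG[OF g] mG[OF h(1)] by (simp flip: G.m_assoc)
            ultimately show "u \<in> (\<lambda>h. r (g \<otimes>\<^bsub>G\<^esub> h)) ` multiples m"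
              using h(2) by (intro image_eqI[of _ _ "inv\<^bsub>G\<^esub> g \<otimes>\<^bsub>G\<^esub> h"]) auto
          qed
        qed
        then show ?thesis using transl[OF mG[OF g] x] by (simp add: t_def)
      qed
      then show ?thesis using t_K[OF x] by (simp add: layer_def)
    qed
    then have eq: "(\<Sum>u\<in>U'. u x) = (\<Sum>u\<in>U. u x)" if "x \<in> K" for x
      using \<delta>(2)[of "t x"] transl[OF \<delta>(1) that] that by (simp add: U'_def t_def)
    have "\<one>\<^bsub>G\<^esub> \<in> multiples m" using dvd_trans[OF L.p_dvd_N[OF m] L.lam_one] by (simp add: multiples_def)
    then have r1: "r \<one>\<^bsub>G\<^esub> \<in> U" by (simp add: U_def)
    have UU': "u \<in> carrier (Gal k K)" if "u \<in> U \<union> U'" for u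
      using that restrict_G_K mG \<delta>(1) by (auto simp: U_def U'_def r_def)
    note cG = carrier_Gal[OF K_field(1)]
    have "(if r \<one>\<^bsub>G\<^esub> \<in> U then - 1 else 1 :: 'a) = 0"
    proof (rule dedekind_independence[where T = K and m = "(*)" and \<Phi> = "U \<union> U'"
          and c = "\<lambda>u. if u \<in> U then - 1 else 1"])
      fix x assume x: "x \<in> K"
      have "(\<Sum>u\<in>U \<union> U'. (if u \<in> U then - 1 else 1) * u x)
         = (\<Sum>u\<in>U. (if u \<in> U then - 1 else 1) * u x) + (\<Sum>u\<in>U'. (if u \<in> U then - 1 else 1) * u x)"
        using fin disj by (rule sum.union_disjoint)
      also have "(\<Sum>u\<in>U'. (if u \<in> U then - 1 else 1) * u x) = (\<Sum>u\<in>U'. u x)"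
        using disj by (intro sum.cong) auto
      finally show "(\<Sum>u\<in>U \<union> U'. (if u \<in> U then - 1 else 1) * u x) = 0"
        using eq[OF x] by (simp add: sum_negf)
    next
      fix u assume "u \<in> U \<union> U'"
      then have "bij_betw u K K" using UU' cG by blast
      then have "1 \<in> u ` K" using subfield_ksD(2)[OF K_field(1)] by (simp add: bij_betw_def)
      then show "\<exists>x\<in>K. u x \<noteq> 0" by force
    next
      fix u u' assume *: "u \<in> U \<union> U'" "u' \<in> U \<union> U'" "u \<noteq> u'"
      show "\<exists>x\<in>K. u x \<noteq> u' x"
      proof (rule ccontr)
        assume "\<not> ?thesis"
        then have "u = u'" using UU'[OF *(1)] UU'[OF *(2)] cG by (intro extensionalityI[of _ K]) auto
        then show False using *(3) by simp
      qed
    next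
      fix u x y assume "u \<in> U \<union> U'" "x \<in> K" "y \<in> K"
      then show "u (x * y) = u x * u y" using UU' cG by blast
    qed (use fin r1 subfield_ksD(4)[OF K_field(1)] in auto)
    then show False using r1 by simp
  qed
qed

text \<open>On \<open>H\<close> two elements agree on \<open>F\<close> exactly when their
  \<open>lam\<close> agree modulo \<open>p ^ m\<close>, so the restrictions are counted by the image
  of \<open>lam\<close>. This serves both the degree of \<open>K(m)\<close> over \<open>k\<close>
  and the degrees of the composita.\<close>

lemma card_restrict:
  assumes H: "subgroup H G" and m: "m \<le> n" and F: "F \<subseteq> \<K>"
    and fix_iff: "\<And>g. g \<in> H \<Longrightarrow> g \<in> fixing_subgroup G F \<longleftrightarrow> int (p ^ m) dvd lam g"
  shows "card ((\<lambda>g. restrict g F) ` H) = p ^ (m - L.level H)"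
proof -
  have "restrict g F = restrict h F \<longleftrightarrow> lam g mod int (p ^ m) = lam h mod int (p ^ m)"
    if gh: "g \<in> H" "h \<in> H" for g h
  proof -
    have G: "g \<in> carrier G" "h \<in> carrier G" using gh H by (auto intro: subgroup.mem_carrier)
    have "inv\<^bsub>G\<^esub> h \<otimes>\<^bsub>G\<^esub> g \<in> H" using gh by (simp add: subgroup.m_closed[OF H] subgroup.m_inv_closed[OF H])
    then show ?thesis
      using restrict_eq_iff[OF F G] fix_iff dvd_lam_diff_iff[OF G m] by simp
  qed
  then have "card ((\<lambda>g. restrict g F) ` H) = card ((\<lambda>g. lam g mod int (p ^ m)) ` H)"
    by (rule card_image_eq_if_same_kernel)
  then show ?thesis using L.card_image_level[OF H m] by simp
qed

lemma level_G: "L.level (carrier G) = 0"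
proof -
  let ?f = "L.level (carrier G)"
  obtain g where g: "g \<in> carrier G" "N dvd lam g - 1" by (rule lam_surj)
  have "int (p ^ ?f) dvd lam g - 1"
    using dvd_trans[OF L.p_dvd_N[OF L.level(1)[OF G.subgroup_self]] g(2)] .
  moreover have "int (p ^ ?f) dvd lam g" using L.level(2)[OF G.subgroup_self g(1)] .
  ultimately have "int (p ^ ?f) dvd int 1" using dvd_diff_right_iff[of "int (p ^ ?f)" "lam g" 1] by simp
  then have "p ^ ?f dvd 1" unfolding int_dvd_int_iff .
  then have "p ^ ?f = p ^ 0" by simp
  then show ?thesis using prime_gt_1_nat[OF prime_p] power_inject_exp by blast
qed

lemma dim_layer: assumes m: "m \<le> n" shows "ring.dim ks k (layer m) = p ^ m"
proof -
  have fix_k: "fixing_subgroup G k = carrier G"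
    using carrier_Gal[OF K_sub(1)] by (auto simp: fixing_subgroup_def)
  have lK: "layer m \<subseteq> \<K>" using layer_subfield(3) K_sub_KK by (rule subset_trans)
  have "ring.dim ks k (layer m) = card ((\<lambda>g. restrict g (layer m)) ` carrier G)"
    using degree_eq_card_restrict[OF subfield_k subset_refl layer_subfield(1,2) lK] by (simp add: fix_k)
  also have "\<dots> = p ^ (m - L.level (carrier G))"
    by (rule card_restrict[OF G.subgroup_self m lK]) (simp add: fixing_layer[OF m] multiples_def)
  finally show ?thesis by (simp add: level_G)
qed

text \<open>A group containing the kernel of \<open>lam\<close> is determined by its image in Z/p^n,
  a cyclic group with one subgroup for each level.\<close>

lemma fixing_eq_multiples:
  assumes F: "F \<subseteq> K"
  shows "fixing_subgroup G F = multiples (L.level (fixing_subgroup G F))"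
proof -
  define H where "H = fixing_subgroup G F"
  define f where "f = L.level H"
  have H: "subgroup H G" unfolding H_def using subgroup_fixing F K_sub_KK by blast
  have "g \<in> H" if g: "g \<in> carrier G" "int (p ^ f) dvd lam g" for g
  proof -
    obtain a where a: "lam g = int (p ^ f) * a" using g(2) by (elim dvdE)
    \<comment> \<open>Reduction modulo \<open>N\<close> provides a nonnegative multiplier, as
      multiples of the level are obtained from natural powers of one element.\<close>
    have "a mod N \<ge> 0" using L.N_pos by simp
    from L.level_multiple[OF H this] obtain h where h: "h \<in> H" "N dvd lam h - (a mod N) * int (p ^ f)"
      unfolding f_def by blast
    have hG: "h \<in> carrier G" using h(1) by (simp add: H_def fixing_subgroup_def)
    have "N dvd (a - a mod N) * int (p ^ f)" by (intro dvd_mult2 dvd_minus_mod)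
    from dvd_diff[OF h(2) this] have "N dvd lam h - ((a mod N) * int (p ^ f) + (a - a mod N) * int (p ^ f))"
      by (simp only: diff_diff_eq)
    moreover have "(a mod N) * int (p ^ f) + (a - a mod N) * int (p ^ f) = lam g"
      unfolding distrib_right[symmetric] by (simp add: a mult.commute)
    ultimately have "N dvd lam h - lam g" by simp
    then have eq: "restrict g K = restrict h K" using restrict_K_eq_iff[OF g(1) hG] by simp
    have "g x = h x" if "x \<in> K" for x using fun_cong[OF eq, of x] that by simp
    then show ?thesis using h(1) g(1) F by (auto simp: H_def fixing_subgroup_def subset_iff)
  qed
  then show ?thesis
    using L.level(2)[OF H] unfolding f_def H_def multiples_def by (auto simp: fixing_subgroup_def)
qed

text \<open>Besides the degree, the description by \<open>THE\<close> demands uniqueness: an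
  intermediate field is recovered from its fixing group, this group is some
  \<open>multiples f\<close>, and the degree determines \<open>f\<close>.\<close>

lemma subext_eq_layer: assumes m: "m \<le> n" shows "subext k K p m = layer m"
  unfolding subext_def
proof (rule the_equality)
  show "subfield (layer m) ks \<and> k \<subseteq> layer m \<and> layer m \<subseteq> K \<and> ring.dim ks k (layer m) = p ^ m"
    using layer_subfield dim_layer[OF m] by simp
next
  fix F assume F: "subfield F ks \<and> k \<subseteq> F \<and> F \<subseteq> K \<and> ring.dim ks k F = p ^ m"
  then have FK: "F \<subseteq> K" by blast
  define f where "f = L.level (fixing_subgroup G F)"
  have H: "fixing_subgroup G F = multiples f" unfolding f_def by (rule fixing_eq_multiples[OF FK])
  have f: "f \<le> n" unfolding f_def using L.level(1) subgroup_fixing FK K_sub_KK by blast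
  have "F = layer f"
  proof
    show "F \<subseteq> layer f" using FK unfolding layer_def H[symmetric] by (auto simp: fixing_subgroup_def)
    show "layer f \<subseteq> F"
    proof
      fix x assume x: "x \<in> layer f"
      show "x \<in> F"
      proof (rule fixed_intermediate[OF gal])
        show "x \<in> \<K>" using x K_sub_KK by (auto simp: layer_def)
        fix g assume "g \<in> carrier G" "\<forall>x\<in>F. g x = x"
        then have "g \<in> multiples f" unfolding H[symmetric] by (simp add: fixing_subgroup_def)
        then show "g x = x" using x by (simp add: layer_def)
      qed (use F K_sub_KK in auto)
    qed
  qed
  moreover have "f = m"
  proof -
    have "p ^ m = p ^ f" using F dim_layer[OF f] calculation by simp
    then show ?thesis using prime_gt_1_nat[OF prime_p] by (simp add: power_inject_exp)
  qed
  ultimately show "F = layer m" by simp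
qed

section \<open>Composita with an intermediate field\<close>

context
  fixes F assumes F: "subfield F ks" "k \<subseteq> F" "F \<subseteq> \<K>"
begin

lemma fixing_compositum:
  assumes "m \<le> n"
  shows "fixing_subgroup G (compositum k K p F m) = {g \<in> fixing_subgroup G F. int (p ^ m) dvd lam g}"
proof -
  have lK: "layer m \<subseteq> \<K>" using layer_subfield(3) K_sub_KK by (rule subset_trans)
  show ?thesis
    unfolding compositum_def subext_eq_layer[OF assms] fixing_generate_field(1)[OF lK F(3)] fixing_layer[OF assms]
    by (auto simp: multiples_def fixing_subgroup_def)
qed

text \<open>The degree is the size of the image of the fixing group of \<open>F\<close> in Z/p^m. If
  the level is at least \<open>m\<close>, then \<open>K(m)\<close> lies in \<open>F\<close>, and
  truncated subtraction gives the exponent 0.\<close>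

lemma e_exp_eq:
  assumes m: "m \<le> n" shows "e_exp k K p F m = m - L.level (fixing_subgroup G F)"
proof -
  have lK: "layer m \<subseteq> \<K>" using layer_subfield(3) K_sub_KK by (rule subset_trans)
  let ?E = "compositum k K p F m"
  have E: "?E \<subseteq> \<K>" "subfield ?E ks" "F \<subseteq> ?E"
    unfolding compositum_def subext_eq_layer[OF m] using fixing_generate_field(2-4)[OF lK F(3)] by auto
  have "ring.dim ks F ?E = card ((\<lambda>g. restrict g ?E) ` fixing_subgroup G F)"
    by (rule degree_eq_card_restrict[OF F(1,2) E(2,3,1)])
  also have "\<dots> = p ^ (m - L.level (fixing_subgroup G F))"
    by (rule card_restrict[OF subgroup_fixing[OF F(3)] m E(1)]) (simp add: fixing_compositum[OF m])
  finally have dim: "ring.dim ks F ?E = p ^ (m - L.level (fixing_subgroup G F))" .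
  show ?thesis unfolding e_exp_def dim using prime_gt_1_nat[OF prime_p]
    by (intro the_equality) (simp_all add: power_inject_exp)
qed

text \<open>Lying in the difference of the two fixing groups means to fix \<open>F\<close> and to
  have \<open>lam\<close> divisible by \<open>p\<close> exactly \<open>n - m\<close> times. So
  \<open>Gam\<close> records valuations of \<open>lam\<close> on cyclic groups.\<close>

lemma Gam_iff:
  assumes "1 \<le> m" "m \<le> n"
  shows "C \<in> Gam k \<K> K p n F m \<longleftrightarrow> (\<exists>g\<in>carrier G. C = conj_class G g \<and>
    (\<exists>h\<in>generate G {g} \<inter> fixing_subgroup G F. int (p ^ (n - m)) dvd lam h \<and> \<not> int (p ^ Suc (n - m)) dvd lam h))"
proof -
  have "n - m \<le> n" "n - m + 1 \<le> n" using assms by simp_all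
  then show ?thesis
    unfolding Gam_def Let_def using fixing_compositum[of "n - m"] fixing_compositum[of "n - m + 1"]
    by (auto simp: disjoint_iff)
qed

end

end

section \<open>The multinorm torus of a cyclic extension\<close>

context group
begin

lemma conj_generate:
  assumes "w \<in> carrier G" "g \<in> carrier G" "h \<in> generate G {w \<otimes> g \<otimes> inv w}"
  shows "inv w \<otimes> h \<otimes> w \<in> generate G {g}"
proof -
  have "inv w \<otimes> (w \<otimes> g \<otimes> inv w) \<otimes> w = g" using assms(1,2) by (simp add: m_assoc) (simp flip: m_assoc)
  have cl: "generate G {w \<otimes> g \<otimes> inv w} \<subseteq> carrier G" using assms(1,2) by (intro generate_incl) simp
  note sub = generate_is_subgroup[of "{g}"]
  show ?thesis using assms(3)
  proof (induction rule: generate.induct)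
    case one
    then show ?case using assms(1) generate.one by simp
  next
    case (incl h)
    then show ?case using \<open>inv w \<otimes> (w \<otimes> g \<otimes> inv w) \<otimes> w = g\<close> generate.incl[of g "{g}"] by simp
  next
    case (inv h)
    then have h: "h = w \<otimes> g \<otimes> inv w" by simp
    then have "h \<in> carrier G" using assms(1,2) by simp
    then have "inv w \<otimes> inv h \<otimes> w = inv (inv w \<otimes> h \<otimes> w)"
      using assms(1) by (simp add: inv_mult_group m_assoc)
    then have "inv w \<otimes> inv h \<otimes> w = inv (inv w \<otimes> (w \<otimes> g \<otimes> inv w) \<otimes> w)" unfolding h .
    then show ?case unfolding \<open>inv w \<otimes> (w \<otimes> g \<otimes> inv w) \<otimes> w = g\<close> using generate.inv[of g "{g}"] by simp
  next
    case (eng h1 h2)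
    then have "h1 \<in> carrier G" "h2 \<in> carrier G" using cl by auto
    then have "inv w \<otimes> (h1 \<otimes> h2) \<otimes> w = (inv w \<otimes> h1 \<otimes> w) \<otimes> (inv w \<otimes> h2 \<otimes> w)"
      using assms(1) by (simp add: m_assoc) (simp flip: m_assoc)
    then show ?case using generate.eng[OF eng.IH] by simp
  qed
qed

lemma conj_inverse: "w \<in> carrier G \<Longrightarrow> h \<in> carrier G \<Longrightarrow> w \<otimes> (inv w \<otimes> h \<otimes> w) \<otimes> inv w = h"
  by (simp add: m_assoc) (simp flip: m_assoc)

end

lemma conj_class_conj:
  fixes G (structure)
  assumes "group G" and w: "w \<in> carrier G" "g \<in> carrier G"
  shows "conj_class G (w \<otimes> g \<otimes> inv w) = conj_class G g"
proof -
  interpret group G by fact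
  have sub: "conj_class G (w \<otimes> g \<otimes> inv w) \<subseteq> conj_class G g" if "w \<in> carrier G" "g \<in> carrier G" for w g
  proof
    fix x assume "x \<in> conj_class G (w \<otimes> g \<otimes> inv w)"
    then obtain h where h: "h \<in> carrier G" "x = h \<otimes> (w \<otimes> g \<otimes> inv w) \<otimes> inv h" by (auto simp: conj_class_def)
    then have "x = (h \<otimes> w) \<otimes> g \<otimes> inv (h \<otimes> w)" using that by (simp add: inv_mult_group m_assoc)
    then show "x \<in> conj_class G g" using h(1) that(1) by (auto simp: conj_class_def)
  qed
  have "inv w \<otimes> (w \<otimes> g \<otimes> inv w) \<otimes> inv (inv w) = g"
    using w by (simp add: m_assoc) (simp flip: m_assoc)
  then have "conj_class G g \<subseteq> conj_class G (w \<otimes> g \<otimes> inv w)"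
    using sub[of "inv w" "w \<otimes> g \<otimes> inv w"] w by simp
  then show ?thesis using sub[OF w] by blast
qed

lemma self_conj_class:
  assumes "group G" "g \<in> carrier G" shows "g \<in> conj_class G g"
proof -
  interpret group G by fact
  show ?thesis unfolding conj_class_def by (rule image_eqI[of _ _ "\<one>\<^bsub>G\<^esub>"]) (use assms in simp_all)
qed

locale multinorm = cyclic_tower k \<K> K p n for k :: "'a::field set" and \<K> K p n +
  fixes I :: "'i set" and Ki :: "'i \<Rightarrow> 'a set" and b :: "('i option \<Rightarrow> 'a) list"
  assumes n_ge_1: "n \<ge> 1" and finite_I: "finite I"
    and Ki: "i \<in> I \<Longrightarrow> subfield (Ki i) ks" "i \<in> I \<Longrightarrow> k \<subseteq> Ki i" "i \<in> I \<Longrightarrow> Ki i \<subseteq> \<K>"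
    and basis: "is_basis k (insert None (Some ` I)) (\<Pi>\<^sub>E j\<in>insert None (Some ` I). case_option K Ki j) b"
begin

abbreviation (input) J where "J \<equiv> insert None (Some ` I)"
abbreviation (input) T where "T \<equiv> norm_one_torus k J b"
abbreviation (input) F where "F \<equiv> case_option K Ki"

sublocale T: galois_algebra k J F b \<K>
proof (intro galois_algebra.intro algebra_basis.intro separable_closure_axioms algebra_basis_axioms.intro
    galois_extension_axioms galois_algebra_axioms.intro basis)
  show "finite J" using finite_I by simp
  fix j assume "j \<in> J"
  then have "j = None \<or> (\<exists>i\<in>I. j = Some i)" by auto
  then show "subfield (F j) ks" "k \<subseteq> F j" "F j \<subseteq> \<K>"
    using K_field(1,2) K_sub_KK Ki by (elim disjE bexE; simp)+
qed

text \<open>The inclusion of the factor \<open>j\<close> is the chosen point of its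
  \<open>G\<close>-orbit; \<open>None\<close> stands for \<open>K\<close>.\<close>

definition base :: "'i option \<Rightarrow> 'i option \<times> ('a \<Rightarrow> 'a)"
  where "base j = (j, \<lambda>x\<in>F j. x)"

lemma F_sub_KK: assumes "j \<in> J" shows "F j \<subseteq> \<K>"
proof -
  have "j = None \<or> (\<exists>i\<in>I. j = Some i)" using assms by auto
  then show ?thesis using Ki(3) K_sub_KK by (elim disjE bexE; simp)
qed

lemma base_in: "j \<in> J \<Longrightarrow> base j \<in> T.embs"
proof -
  have "id \<in> Aut k" by (simp add: Aut_def)
  moreover have "(\<lambda>x\<in>F j. x) = restrict id (F j)" by auto
  ultimately show "j \<in> J \<Longrightarrow> base j \<in> T.embs" unfolding base_def T.embs_def Emb_def by blast
qed

lemma embs_cases: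
  assumes "s \<in> T.embs"
  obtains j g where "j \<in> J" "g \<in> carrier G" "s = T.star g (base j)"
proof -
  obtain j \<sigma> where s: "s = (j, restrict \<sigma> (F j))" "j \<in> J" "\<sigma> \<in> Aut k"
    using assms by (auto simp: T.embs_def Emb_def)
  have "restrict \<sigma> \<K> \<in> carrier G" using restrict_Aut_Gal[OF gal s(3)] .
  moreover have "s = T.star (restrict \<sigma> \<K>) (base j)"
  proof -
    note [simp] = subsetD[OF F_sub_KK[OF s(2)]]
    show ?thesis unfolding s(1) T.star_def base_def by (simp cong: restrict_cong)
  qed
  ultimately show ?thesis by (rule that[OF s(2)])
qed

lemma stabilizer_base:
  assumes "j \<in> J" "g \<in> carrier G"
  shows "T.star g (base j) = base j \<longleftrightarrow> g \<in> fixing_subgroup G (F j)"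
proof -
  have "T.star g (base j) = base j \<longleftrightarrow> (\<forall>x\<in>F j. g x = x)"
    unfolding T.star_def base_def by (auto simp: fun_eq_iff restrict_def)
  then show ?thesis using assms(2) by (simp add: fixing_subgroup_def)
qed

sublocale CL: character_lattice "Gal k \<K>" T.embs T.star "characters (length b) T" "character_action k \<K> T"
  T.qc lam "int (p ^ n)" "base None"
proof (intro character_lattice.intro quotient_lattice.intro quotient_lattice_axioms.intro
    L.mod_character_axioms G.group_axioms character_lattice_axioms.intro)
  show "finite (carrier (Gal k \<K>))" by (rule finite_G)
  show "comm_group (characters (length b) T)" by (rule T.comm_group_M)
  show "base None \<in> T.embs" by (rule base_in) simp
  fix g assume "g \<in> carrier (Gal k \<K>)"
  then show "T.star g (base None) = base None \<longleftrightarrow> int (p ^ n) dvd lam g"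
    using stabilizer_base[of None g] lam_kernel by (simp add: fixing_subgroup_def del: of_nat_power)
qed (simp_all add: T.star_closed T.star_one T.star_mult T.qc_closed T.qc_surj T.qc_add T.qc_eq_one T.act_qc)

definition Stab where "Stab i = fixing_subgroup G (Ki i)"
text \<open>The image of \<open>Stab i\<close> under \<open>lam\<close> is generated by
  \<open>p ^ lvl i\<close>, so the exponent \<open>e\<^sub>i(n)\<close> is
  \<open>n - lvl i\<close>.\<close>

definition lvl where "lvl i = L.level (Stab i)"

lemma Stab_subgroup: "i \<in> I \<Longrightarrow> subgroup (Stab i) G"
  unfolding Stab_def by (rule subgroup_fixing) (rule Ki)

lemma Stab_carrier: "h \<in> Stab i \<Longrightarrow> h \<in> carrier G" by (simp add: Stab_def fixing_subgroup_def)

definition extend :: "('i \<Rightarrow> int) \<Rightarrow> 'i option \<times> ('a \<Rightarrow> 'a) \<Rightarrow> int"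
  where "extend c s = (case fst s of None \<Rightarrow> 0 | Some i \<Rightarrow> c i)"

lemma extend_star [simp]: "extend c (T.star g s) = extend c s"
  by (simp add: extend_def T.star_def)

lemma extend_base [simp]: "extend c (base None) = 0" "extend c (base (Some i)) = c i"
  by (simp_all add: extend_def base_def)

lemma extend_invariant: "CL.invariant (extend c)"
  by (simp add: CL.invariant_def)

lemma trivial_on_cong:
  "(\<And>s. s \<in> T.embs \<Longrightarrow> u s = v s) \<Longrightarrow> CL.trivial_on H u \<longleftrightarrow> CL.trivial_on H v"
  unfolding CL.trivial_on_def by simp

lemma dvd_lam_conj:
  assumes "y \<in> carrier G" "h \<in> carrier G"
  shows "int (p ^ n) dvd lam (inv\<^bsub>G\<^esub> y \<otimes>\<^bsub>G\<^esub> h \<otimes>\<^bsub>G\<^esub> y) - lam h"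
  using L.lam_conj[of "inv\<^bsub>G\<^esub> y" h] assms by simp

lemma dvd_cong_mult:
  fixes a a' N z :: int
  assumes "N dvd a - a'" shows "N dvd a * z \<longleftrightarrow> N dvd a' * z"
proof -
  have "N dvd a * z - a' * z" using dvd_mult2[OF assms, of z] by (simp add: left_diff_distrib)
  then show ?thesis by (metis dvd_diff_commute dvd_diff_left_iff)
qed

text \<open>Every embedding of \<open>K\<^sub>i\<close> is the translate of the inclusion by some
  \<open>y\<close>, and its stabiliser is the conjugate of \<open>Stab i\<close> by
  \<open>y\<close>. The embeddings of \<open>K\<close> impose nothing, because \<open>p ^ n\<close>
  divides \<open>lam\<close> on their stabilisers.\<close>

lemma trivial_on_extend:
  assumes H: "H \<subseteq> carrier G"
  shows "CL.trivial_on H (extend c) \<longleftrightarrow> (\<exists>x. \<forall>i\<in>I. \<forall>y\<in>carrier G. \<forall>h\<in>H.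
    inv\<^bsub>G\<^esub> y \<otimes>\<^bsub>G\<^esub> h \<otimes>\<^bsub>G\<^esub> y \<in> Stab i \<longrightarrow> int (p ^ n) dvd lam h * (c i - x))"
proof -
  have stab: "T.star h (T.star y (base j)) = T.star y (base j) \<longleftrightarrow> inv\<^bsub>G\<^esub> y \<otimes>\<^bsub>G\<^esub> h \<otimes>\<^bsub>G\<^esub> y \<in> fixing_subgroup G (F j)"
    if "h \<in> carrier G" "y \<in> carrier G" "j \<in> J" for h y j
  proof -
    have bj: "base j \<in> T.embs" by (rule base_in[OF that(3)])
    have "T.star (inv\<^bsub>G\<^esub> y \<otimes>\<^bsub>G\<^esub> h \<otimes>\<^bsub>G\<^esub> y) (base j) = T.star (inv\<^bsub>G\<^esub> y) (T.star h (T.star y (base j)))"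
      using that bj by (simp add: T.star_mult T.star_closed)
    also have "\<dots> = base j \<longleftrightarrow> T.star h (T.star y (base j)) = T.star y (base j)"
      using CL.star_inv_star[OF that(2)] bj that T.star_closed by metis
    finally show ?thesis using stabilizer_base[OF that(3)] that by simp
  qed
  show ?thesis unfolding CL.trivial_on_def
  proof (intro ex_cong1 iffI ballI impI)
    fix x i y h
    assume *: "\<forall>s\<in>T.embs. \<forall>g\<in>H. T.star g s = s \<longrightarrow> int (p ^ n) dvd lam g * (extend c s - x)"
      and iyh: "i \<in> I" "y \<in> carrier G" "h \<in> H" "inv\<^bsub>G\<^esub> y \<otimes>\<^bsub>G\<^esub> h \<otimes>\<^bsub>G\<^esub> y \<in> Stab i"
    have "T.star y (base (Some i)) \<in> T.embs" using iyh by (intro T.star_closed base_in) auto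
    moreover have "T.star h (T.star y (base (Some i))) = T.star y (base (Some i))"
      using stab[of h y "Some i"] iyh H by (auto simp: Stab_def)
    ultimately have "int (p ^ n) dvd lam h * (extend c (T.star y (base (Some i))) - x)" using * iyh(3) by blast
    then show "int (p ^ n) dvd lam h * (c i - x)" by simp
  next
    fix x s h
    assume *: "\<forall>i\<in>I. \<forall>y\<in>carrier G. \<forall>h\<in>H. inv\<^bsub>G\<^esub> y \<otimes>\<^bsub>G\<^esub> h \<otimes>\<^bsub>G\<^esub> y \<in> Stab i \<longrightarrow> int (p ^ n) dvd lam h * (c i - x)"
      and s: "s \<in> T.embs" "h \<in> H" "T.star h s = s"
    obtain j y where jy: "j \<in> J" "y \<in> carrier G" "s = T.star y (base j)" using embs_cases[OF s(1)] .
    have hG: "h \<in> carrier G" using s(2) H by blast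
    have conj: "inv\<^bsub>G\<^esub> y \<otimes>\<^bsub>G\<^esub> h \<otimes>\<^bsub>G\<^esub> y \<in> fixing_subgroup G (F j)" using stab[OF hG jy(2,1)] s(3) jy(3) by simp
    show "int (p ^ n) dvd lam h * (extend c s - x)"
    proof (cases j)
      case None
      then have "int (p ^ n) dvd lam (inv\<^bsub>G\<^esub> y \<otimes>\<^bsub>G\<^esub> h \<otimes>\<^bsub>G\<^esub> y)"
        using conj lam_kernel by (simp add: fixing_subgroup_def del: of_nat_power)
      then have "int (p ^ n) dvd lam (inv\<^bsub>G\<^esub> y \<otimes>\<^bsub>G\<^esub> h \<otimes>\<^bsub>G\<^esub> y) * (extend c s - x)" by (rule dvd_mult2)
      then show ?thesis unfolding dvd_cong_mult[OF dvd_lam_conj[OF jy(2) hG]] .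
    next
      case (Some i)
      then have "i \<in> I" using jy(1) by auto
      moreover have "inv\<^bsub>G\<^esub> y \<otimes>\<^bsub>G\<^esub> h \<otimes>\<^bsub>G\<^esub> y \<in> Stab i" using conj by (simp add: Stab_def Some)
      ultimately have "int (p ^ n) dvd lam h * (c i - x)" using * jy(2) s(2) by blast
      then show ?thesis by (simp add: jy(3) Some)
    qed
  qed
qed

text \<open>\<open>lam\<close> is invariant under conjugation modulo \<open>p ^ n\<close>, so the
  translates by \<open>y\<close> add nothing to the condition for \<open>Stab i\<close>, which is a
  congruence modulo \<open>p ^ (n - lvl i)\<close>.\<close>

lemma trivial_on_G_iff:
  "CL.trivial_on (carrier G) (extend c) \<longleftrightarrow> (\<exists>x. \<forall>i\<in>I. int (p ^ (n - lvl i)) dvd c i - x)"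
  unfolding trivial_on_extend[OF subset_refl]
proof (intro ex_cong1 iffI ballI impI)
  fix x i
  assume *: "\<forall>i\<in>I. \<forall>y\<in>carrier G. \<forall>h\<in>carrier G. inv\<^bsub>G\<^esub> y \<otimes>\<^bsub>G\<^esub> h \<otimes>\<^bsub>G\<^esub> y \<in> Stab i \<longrightarrow> int (p ^ n) dvd lam h * (c i - x)"
    and i: "i \<in> I"
  have "int (p ^ n) dvd lam h * (c i - x)" if h: "h \<in> Stab i" for h
  proof -
    have "inv\<^bsub>G\<^esub> \<one>\<^bsub>G\<^esub> \<otimes>\<^bsub>G\<^esub> h \<otimes>\<^bsub>G\<^esub> \<one>\<^bsub>G\<^esub> \<in> Stab i" using h Stab_carrier[OF h] by simp
    then show ?thesis using * i Stab_carrier[OF h] G.one_closed by blast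
  qed
  then show "int (p ^ (n - lvl i)) dvd c i - x"
    unfolding lvl_def L.level_trivial_iff[OF Stab_subgroup[OF i], symmetric] by blast
next
  fix x i y h
  assume *: "\<forall>i\<in>I. int (p ^ (n - lvl i)) dvd c i - x" and i: "i \<in> I"
    and yh: "y \<in> carrier G" "h \<in> carrier G" "inv\<^bsub>G\<^esub> y \<otimes>\<^bsub>G\<^esub> h \<otimes>\<^bsub>G\<^esub> y \<in> Stab i"
  have "int (p ^ n) dvd lam (inv\<^bsub>G\<^esub> y \<otimes>\<^bsub>G\<^esub> h \<otimes>\<^bsub>G\<^esub> y) * (c i - x)"
    using * i yh(3) L.level_trivial_iff[OF Stab_subgroup[OF i], of "c i - x"] unfolding lvl_def by blast
  then show "int (p ^ n) dvd lam h * (c i - x)" unfolding dvd_cong_mult[OF dvd_lam_conj[OF yh(1,2)]] .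
qed

section \<open>Local triviality as congruences indexed by conjugacy classes\<close>

abbreviation (input) \<Gamma> where "\<Gamma> i m \<equiv> Gam k \<K> K p n (Ki i) m"

text \<open>The conditions of all levels \<open>C^m\<close> on integer representatives; congruences
  replace the reductions between the groups \<open>A_m\<close>.\<close>

definition compatible :: "('i \<Rightarrow> int) \<Rightarrow> bool"
  where "compatible c \<longleftrightarrow> (\<forall>m\<in>{1..n}. \<forall>i\<in>I. \<forall>j\<in>I. \<Gamma> i m \<inter> \<Gamma> j m \<noteq> {} \<longrightarrow> int (p ^ m) dvd c i - c j)"

definition exact :: "nat \<Rightarrow> int \<Rightarrow> bool"
  where "exact a z \<longleftrightarrow> int (p ^ a) dvd z \<and> \<not> int (p ^ Suc a) dvd z"

lemma Gam_D:
  assumes "C \<in> \<Gamma> i m" "i \<in> I" "m \<in> {1..n}"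
  obtains g h where "g \<in> carrier G" "C = conj_class G g" "h \<in> generate G {g}" "h \<in> Stab i" "exact (n - m) (lam h)"
  using assms Gam_iff[OF Ki(1-3)[OF assms(2)], of m C] by (auto simp: Stab_def exact_def)

text \<open>Exactness involves \<open>p ^ Suc a\<close>, which divides \<open>p ^ n\<close> because
  \<open>a < n\<close>.\<close>

lemma exact_cong:
  assumes "int (p ^ n) dvd z - z'" "a < n" shows "exact a z \<longleftrightarrow> exact a z'"
proof -
  have "int (p ^ m) dvd z \<longleftrightarrow> int (p ^ m) dvd z'" if "m \<le> n" for m
    using dvd_trans[OF L.p_dvd_N[OF that] assms(1)] by (metis dvd_diff_commute dvd_diff_left_iff)
  then show ?thesis using assms(2) by (simp add: exact_def del: of_nat_power power_Suc)
qed

text \<open>Only a conjugate of \<open>h\<close> lies in \<open>Stab i\<close>; conjugating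
  \<open>g\<close> along with it changes neither the class of \<open>g\<close> nor the
  valuation.\<close>

lemma Gam_I:
  assumes i: "i \<in> I" "m \<in> {1..n}" and g: "g \<in> carrier G" and y: "y \<in> carrier G" and h: "h \<in> generate G {g}"
    and conj: "inv\<^bsub>G\<^esub> y \<otimes>\<^bsub>G\<^esub> h \<otimes>\<^bsub>G\<^esub> y \<in> Stab i" and ex: "exact (n - m) (lam h)"
  shows "conj_class G g \<in> \<Gamma> i m"
proof -
  let ?g = "inv\<^bsub>G\<^esub> y \<otimes>\<^bsub>G\<^esub> g \<otimes>\<^bsub>G\<^esub> y" and ?h = "inv\<^bsub>G\<^esub> y \<otimes>\<^bsub>G\<^esub> h \<otimes>\<^bsub>G\<^esub> y"
  have g': "?g \<in> carrier G" using g y by simp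
  have hG: "h \<in> carrier G" using h G.generate_incl[of "{g}"] g by blast
  have "conj_class G ?g = conj_class G g" using conj_class_conj[OF G.group_axioms, of "inv\<^bsub>G\<^esub> y" g] g y by simp
  then have "conj_class G g = conj_class G ?g" by simp
  moreover have "?h \<in> generate G {?g}"
    using G.conj_generate[OF y g', of h] h G.conj_inverse[OF y g] by simp
  moreover have "exact (n - m) (lam ?h)"
    using exact_cong[OF dvd_lam_conj[OF y hG], of "n - m"] ex i(2) by simp
  moreover have m: "1 \<le> m" "m \<le> n" using i(2) by simp_all
  ultimately show ?thesis
    unfolding Gam_iff[OF Ki(1-3)[OF i(1)] m] using conj unfolding exact_def Stab_def
    by (intro bexI[OF _ g'] conjI bexI[of _ ?h] IntI; blast)
qed

lemma exact_iff: "exact a z \<Longrightarrow> a \<le> n \<Longrightarrow> int (p ^ n) dvd z * x \<longleftrightarrow> int (p ^ (n - a)) dvd x"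
  unfolding exact_def using L.exact_multiplicity by blast

text \<open>All values of \<open>lam\<close> on \<open>Stab i\<close> are divisible by
  \<open>p ^ lvl i\<close>, so an exact valuation \<open>n - m\<close> forces
  \<open>lvl i \<le> n - m\<close>. This makes the component \<open>i\<close> of \<open>A_m\<close>
  equal to Z/p^m.\<close>

lemma Gam_level: "\<Gamma> i m \<noteq> {} \<Longrightarrow> i \<in> I \<Longrightarrow> m \<in> {1..n} \<Longrightarrow> m \<le> n - lvl i"
proof -
  assume *: "\<Gamma> i m \<noteq> {}" "i \<in> I" "m \<in> {1..n}"
  then obtain C where "C \<in> \<Gamma> i m" by blast
  then obtain g h where h: "h \<in> Stab i" "exact (n - m) (lam h)" using Gam_D[OF _ *(2,3)] by metis
  have "int (p ^ lvl i) dvd lam h" unfolding lvl_def by (rule L.level(2)[OF Stab_subgroup[OF *(2)] h(1)])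
  moreover have "\<not> int (p ^ Suc (n - m)) dvd lam h" using h(2) by (simp add: exact_def)
  ultimately have "\<not> Suc (n - m) \<le> lvl i" by (meson dvd_trans le_imp_power_dvd of_nat_dvd_iff)
  then show ?thesis using *(3) by auto
qed

text \<open>Two elements of one cyclic group with the same exact valuation \<open>n - m\<close> both
  pin down \<open>x\<close> modulo \<open>p ^ m\<close>, which gives the congruences. Conversely, a
  power of an element of least valuation reaches the valuation of any other element, and at this
  common level the congruence applies.\<close>

lemma locally_trivial_iff_compatible:
  "(\<forall>g\<in>carrier G. CL.trivial_on (generate G {g}) (extend c)) \<longleftrightarrow> compatible c"
proof
  assume loc: "\<forall>g\<in>carrier G. CL.trivial_on (generate G {g}) (extend c)"
  show "compatible c" unfolding compatible_def
  proof (intro ballI impI)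
    fix m i j assume m: "m \<in> {1..n}" and i: "i \<in> I" and j: "j \<in> I" and "\<Gamma> i m \<inter> \<Gamma> j m \<noteq> {}"
    then obtain C where C: "C \<in> \<Gamma> i m" "C \<in> \<Gamma> j m" by blast
    obtain g1 h1 where 1: "g1 \<in> carrier G" "C = conj_class G g1" "h1 \<in> generate G {g1}" "h1 \<in> Stab i" "exact (n - m) (lam h1)"
      using Gam_D[OF C(1) i m] .
    obtain g2 h2 where 2: "g2 \<in> carrier G" "C = conj_class G g2" "h2 \<in> generate G {g2}" "h2 \<in> Stab j" "exact (n - m) (lam h2)"
      using Gam_D[OF C(2) j m] .
    have "g2 \<in> conj_class G g1" using self_conj_class[OF G.group_axioms 2(1)] 1(2) 2(2) by simp
    then obtain w where w: "w \<in> carrier G" "g2 = w \<otimes>\<^bsub>G\<^esub> g1 \<otimes>\<^bsub>G\<^esub> inv\<^bsub>G\<^esub> w" by (auto simp: conj_class_def)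
    \<comment> \<open>The common class is represented by \<open>g1\<close> and by \<open>g2\<close>;
      conjugation by \<open>w\<close> brings \<open>h2\<close> into the cyclic group of
      \<open>g1\<close>.\<close>
    define h where "h = inv\<^bsub>G\<^esub> w \<otimes>\<^bsub>G\<^esub> h2 \<otimes>\<^bsub>G\<^esub> w"
    have hg: "h \<in> generate G {g1}" unfolding h_def using G.conj_generate[OF w(1) 1(1)] 2(3) w(2) by simp
    have sub: "generate G {g1} \<subseteq> carrier G" using 1(1) by (intro G.generate_incl) simp
    from bspec[OF loc 1(1)] obtain x where x': "\<forall>i\<in>I. \<forall>y\<in>carrier G. \<forall>h\<in>generate G {g1}.
       inv\<^bsub>G\<^esub> y \<otimes>\<^bsub>G\<^esub> h \<otimes>\<^bsub>G\<^esub> y \<in> Stab i \<longrightarrow> int (p ^ n) dvd lam h * (c i - x)"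
      unfolding trivial_on_extend[OF sub] by (elim exE)
    note x = x'[rule_format]
    have "int (p ^ n) dvd lam h1 * (c i - x)"
      using x[OF i G.one_closed 1(3)] 1(4) Stab_carrier[OF 1(4)] by simp
    then have ci: "int (p ^ m) dvd c i - x" using exact_iff[OF 1(5)] m by simp
    have "inv\<^bsub>G\<^esub> (inv\<^bsub>G\<^esub> w) \<otimes>\<^bsub>G\<^esub> h \<otimes>\<^bsub>G\<^esub> inv\<^bsub>G\<^esub> w = h2"
      unfolding h_def using G.conj_inverse[OF w(1) Stab_carrier[OF 2(4)]] w(1) by simp
    then have "int (p ^ n) dvd lam h * (c j - x)" using x[OF j _ hg, of "inv\<^bsub>G\<^esub> w"] w(1) 2(4) by simp
    then have "int (p ^ n) dvd lam h2 * (c j - x)"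
      using dvd_cong_mult[OF dvd_lam_conj[OF w(1) Stab_carrier[OF 2(4)]]] unfolding h_def by blast
    then have cj: "int (p ^ m) dvd c j - x" using exact_iff[OF 2(5)] m by simp
    show "int (p ^ m) dvd c i - c j" using dvd_diff[OF ci cj] by simp
  qed
next
  assume comp: "compatible c"
  show "\<forall>g\<in>carrier G. CL.trivial_on (generate G {g}) (extend c)"
  proof
    fix g assume g: "g \<in> carrier G"
    have sub: "generate G {g} \<subseteq> carrier G" using g by (intro G.generate_incl) simp
    \<comment> \<open>The valuation of \<open>lam h\<close> capped at \<open>n\<close>; the cap is
      attained exactly on the kernel, where the divisibility is immediate.\<close>
    define v where "v h = (GREATEST a. a \<le> n \<and> int (p ^ a) dvd lam h)" for h
    have v: "v h \<le> n" "int (p ^ v h) dvd lam h" for h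
      using GreatestI_nat[of "\<lambda>a. a \<le> n \<and> int (p ^ a) dvd lam h" 0 n] unfolding v_def by auto
    have v_max: "a \<le> v h" if "a \<le> n" "int (p ^ a) dvd lam h" for a h
      using Greatest_le_nat[of "\<lambda>a. a \<le> n \<and> int (p ^ a) dvd lam h" a n] that unfolding v_def by auto
    have v_exact: "exact (v h) (lam h)" if "v h < n" for h
      unfolding exact_def using v(2) v_max[of "Suc (v h)" h] that by auto
    define good where "good = (\<lambda>(i, y, h). i \<in> I \<and> y \<in> carrier G \<and> h \<in> generate G {g} \<and>
      inv\<^bsub>G\<^esub> y \<otimes>\<^bsub>G\<^esub> h \<otimes>\<^bsub>G\<^esub> y \<in> Stab i)"
    show "CL.trivial_on (generate G {g}) (extend c)"
    proof (cases "\<exists>t. good t")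
      case False
      then show ?thesis unfolding trivial_on_extend[OF sub] good_def by auto
    next
      case True
      then obtain t0 where t0: "good t0" and min: "\<And>t. good t \<Longrightarrow> v (snd (snd t0)) \<le> v (snd (snd t))"
        using ex_has_least_nat[of good _ "\<lambda>t. v (snd (snd t))"] by blast
      obtain i0 y0 h0 where t0_eq: "t0 = (i0, y0, h0)" by (cases t0)
      have i0: "i0 \<in> I" "y0 \<in> carrier G" "h0 \<in> generate G {g}" "inv\<^bsub>G\<^esub> y0 \<otimes>\<^bsub>G\<^esub> h0 \<otimes>\<^bsub>G\<^esub> y0 \<in> Stab i0"
        using t0 by (auto simp: t0_eq good_def)
      have h0G: "h0 \<in> carrier G" using i0(3) sub by blast
      have "int (p ^ n) dvd lam h * (c i - c i0)"
        if i: "i \<in> I" and y: "y \<in> carrier G" and h: "h \<in> generate G {g}" and conj: "inv\<^bsub>G\<^esub> y \<otimes>\<^bsub>G\<^esub> h \<otimes>\<^bsub>G\<^esub> y \<in> Stab i"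
        for i y h
      proof (cases "v h = n")
        case True
        then show ?thesis using v(2)[of h] by (intro dvd_mult2) simp
      next
        case False
        then have a: "v h < n" using v(1)[of h] by simp
        define m where "m = n - v h"
        have m: "m \<in> {1..n}" "n - m = v h" using a by (auto simp: m_def)
        have le: "v h0 \<le> v h" using min[of "(i, y, h)"] i y h conj by (simp add: good_def t0_eq)
        \<comment> \<open>This power of \<open>p\<close> raises the valuation of
          \<open>lam h0\<close> to that of \<open>lam h\<close>, so that both elements witness the
          same index \<open>m\<close>.\<close>
        define t where "t = p ^ (v h - v h0)"
        define h0' where "h0' = h0 [^]\<^bsub>G\<^esub> t"
        have "exact (v h) (int t * lam h0)"
        proof -
          have e: "exact (v h0) (lam h0)" by (intro v_exact) (use le a in linarith)
          have vh: "v h = (v h - v h0) + v h0" using le by simp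
          have "int (p ^ v h) = int t * int (p ^ v h0)" "int (p ^ Suc (v h)) = int t * int (p ^ Suc (v h0))"
            by (subst vh, simp add: t_def power_add)+
          moreover have "int t \<noteq> 0" using L.p_gt_0 by (simp add: t_def)
          ultimately show ?thesis using e unfolding exact_def by (simp only: dvd_mult_cancel_left simp_thms)
        qed
        then have ex0: "exact (n - m) (lam h0')"
          using exact_cong[OF L.lam_pow[OF h0G, of t] a] by (simp add: h0'_def m(2))
        have h0'g: "h0' \<in> generate G {g}"
        proof -
          have "h0 [^]\<^bsub>G\<^esub> l \<in> generate G {g}" for l :: nat
          proof (induction l)
            case 0
            show ?case unfolding G.nat_pow_0 by (rule generate.one)
          next
            case (Suc l)
            show ?case unfolding G.nat_pow_Suc by (rule generate.eng[OF Suc i0(3)])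
          qed
          then show ?thesis by (simp add: h0'_def)
        qed
        have "inv\<^bsub>G\<^esub> y0 \<otimes>\<^bsub>G\<^esub> h0 [^]\<^bsub>G\<^esub> l \<otimes>\<^bsub>G\<^esub> y0 \<in> Stab i0" for l :: nat
        proof (induction l)
          case 0
          then show ?case using subgroup.one_closed[OF Stab_subgroup[OF i0(1)]] i0(2) by simp
        next
          case (Suc l)
          have "inv\<^bsub>G\<^esub> y0 \<otimes>\<^bsub>G\<^esub> (h0 [^]\<^bsub>G\<^esub> l \<otimes>\<^bsub>G\<^esub> h0) \<otimes>\<^bsub>G\<^esub> y0
            = (inv\<^bsub>G\<^esub> y0 \<otimes>\<^bsub>G\<^esub> h0 [^]\<^bsub>G\<^esub> l \<otimes>\<^bsub>G\<^esub> y0) \<otimes>\<^bsub>G\<^esub> (inv\<^bsub>G\<^esub> y0 \<otimes>\<^bsub>G\<^esub> h0 \<otimes>\<^bsub>G\<^esub> y0)"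
            using i0(2) h0G by (simp add: G.m_assoc) (simp flip: G.m_assoc)
          then show ?case unfolding G.nat_pow_Suc using subgroup.m_closed[OF Stab_subgroup[OF i0(1)] Suc.IH i0(4)] by (simp only:)
        qed
        then have conj0: "inv\<^bsub>G\<^esub> y0 \<otimes>\<^bsub>G\<^esub> h0' \<otimes>\<^bsub>G\<^esub> y0 \<in> Stab i0" by (simp add: h0'_def)
        have A: "conj_class G g \<in> \<Gamma> i m"
          by (rule Gam_I[OF i m(1) g y h conj]) (simp add: m(2) v_exact[OF a])
        have "conj_class G g \<in> \<Gamma> i0 m" by (rule Gam_I[OF i0(1) m(1) g i0(2) h0'g conj0 ex0])
        then have "\<Gamma> i m \<inter> \<Gamma> i0 m \<noteq> {}" using A by blast
        then have "int (p ^ m) dvd c i - c i0" by (rule comp[unfolded compatible_def, rule_format, OF m(1) i i0(1)])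
        then show ?thesis using exact_iff[OF v_exact[OF a]] a by (simp add: m_def)
      qed
      then show ?thesis unfolding trivial_on_extend[OF sub] by blast
    qed
  qed
qed

lemma e_exp_level: "i \<in> I \<Longrightarrow> m \<le> n \<Longrightarrow> e_exp k K p (Ki i) m = m - lvl i"
  unfolding lvl_def Stab_def by (rule e_exp_eq[OF Ki(1-3)])

lemma A_exp_n: "i \<in> I \<Longrightarrow> A_exp k K p n Ki n i = n - lvl i"
  by (simp add: A_exp_def e_exp_level)

lemma A_exp_Gam: "\<Gamma> i m \<noteq> {} \<Longrightarrow> i \<in> I \<Longrightarrow> m \<in> {1..n} \<Longrightarrow> A_exp k K p n Ki m i = m"
  using Gam_level[of i m] by (simp add: A_exp_def e_exp_level)

section \<open>The groups of residue tuples and their identification\<close>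

abbreviation (input) "A \<equiv> A_group k K p n I Ki"
abbreviation (input) "C \<equiv> C_L k \<K> K p n I Ki"

lemma carrier_mod: "carrier (integer_mod_group (p ^ e)) = {0..<int (p ^ e)}"
  using L.p_gt_0 by (simp add: carrier_integer_mod_group)

lemma carrier_A: "carrier (A m) = (\<Pi>\<^sub>E i\<in>I. {0..<int (p ^ A_exp k K p n Ki m i)})"
  by (simp only: A_group_def carrier_product_group carrier_mod)

lemma carrier_A_n: "carrier (A n) = (\<Pi>\<^sub>E i\<in>I. {0..<int (p ^ (n - lvl i))})"
  unfolding carrier_A by (rule PiE_cong) (simp add: A_exp_n)

lemma A_n_mod:
  assumes "c \<in> carrier (A n)" "i \<in> I" shows "c i mod int (p ^ (n - lvl i)) = c i"
proof -
  have "c i \<in> {0..<int (p ^ (n - lvl i))}"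
    using PiE_mem[of c I "\<lambda>i. {0..<int (p ^ (n - lvl i))}" i] assms by (simp only: carrier_A_n)
  then show ?thesis unfolding atLeastLessThan_iff by (elim conjE) (rule mod_pos_pos_trivial)
qed

lemma reduction_in: "reduction k K p n I Ki m c \<in> carrier (A m)"
  unfolding carrier_A reduction_def using L.p_gt_0 by auto

text \<open>When the two sets meet, both components of \<open>A_m\<close> are Z/p^m, and equality of
  reduced integers is congruence modulo \<open>p ^ m\<close>.\<close>

lemma reduction_in_C_level:
  assumes m: "m \<in> {1..n}"
  shows "reduction k K p n I Ki m c \<in> C_level k \<K> K p n I Ki m \<longleftrightarrow>
    (\<forall>i\<in>I. \<forall>j\<in>I. \<Gamma> i m \<inter> \<Gamma> j m \<noteq> {} \<longrightarrow> int (p ^ m) dvd c i - c j)"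
proof -
  have "reduction k K p n I Ki m c i = reduction k K p n I Ki m c j \<longleftrightarrow> int (p ^ m) dvd c i - c j"
    if ij: "i \<in> I" "j \<in> I" and ne: "\<Gamma> i m \<inter> \<Gamma> j m \<noteq> {}" for i j
  proof -
    have "A_exp k K p n Ki m i = m" "A_exp k K p n Ki m j = m"
      using ne by (auto intro!: A_exp_Gam ij m)
    then show ?thesis using ij by (simp add: reduction_def mod_eq_dvd_iff del: of_nat_power)
  qed
  then show ?thesis unfolding C_level_def using reduction_in[of m c] by blast
qed

lemma reduction_n:
  assumes "c \<in> carrier (A n)" shows "reduction k K p n I Ki n c = c"
proof
  fix i
  show "reduction k K p n I Ki n c i = c i"
  proof (cases "i \<in> I")
    case True
    have "reduction k K p n I Ki n c i = c i mod int (p ^ (n - lvl i))"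
      by (simp only: reduction_def restrict_apply'[OF True] A_exp_n[OF True])
    then show ?thesis by (simp only: A_n_mod[OF assms True])
  next
    case False
    then have "c i = undefined" using assms unfolding carrier_A by (intro PiE_arb)
    then show ?thesis using False by (simp add: reduction_def)
  qed
qed

text \<open>Reduction at level \<open>n\<close> changes nothing on \<open>A n\<close>, so membership
  in \<open>C^n\<close> coincides with the instance \<open>m = n\<close> of the reduced
  conditions.\<close>

lemma carrier_C: "c \<in> carrier C \<longleftrightarrow> c \<in> carrier (A n) \<and> compatible c"
proof -
  have n: "n \<in> {1..n}" using n_ge_1 by simp
  have "c \<in> carrier C \<longleftrightarrow> c \<in> C_level k \<K> K p n I Ki n \<and> (\<forall>m\<in>{1..n}. reduction k K p n I Ki m c \<in> C_level k \<K> K p n I Ki m)"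
    by (simp add: C_L_def)
  also have "\<dots> \<longleftrightarrow> c \<in> carrier (A n) \<and> (\<forall>m\<in>{1..n}. reduction k K p n I Ki m c \<in> C_level k \<K> K p n I Ki m)"
  proof -
    have "c \<in> C_level k \<K> K p n I Ki n \<Longrightarrow> c \<in> carrier (A n)" by (simp add: C_level_def)
    moreover have "c \<in> C_level k \<K> K p n I Ki n"
      if "c \<in> carrier (A n)" "\<forall>m\<in>{1..n}. reduction k K p n I Ki m c \<in> C_level k \<K> K p n I Ki m"
      using bspec[OF that(2) n] unfolding reduction_n[OF that(1)] .
    ultimately show ?thesis by blast
  qed
  also have "\<dots> \<longleftrightarrow> c \<in> carrier (A n) \<and> compatible c"
    unfolding compatible_def by (simp only: reduction_in_C_level cong: ball_cong)
  finally show ?thesis .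
qed

text \<open>Where \<open>\<Gamma> i m\<close> is nonempty, \<open>m\<close> is at most
  \<open>n - lvl i\<close>, so changing a component by a multiple of \<open>p ^ (n - lvl i)\<close>
  preserves the congruence modulo \<open>p ^ m\<close>.\<close>

lemma compatible_cong:
  assumes "\<And>i. i \<in> I \<Longrightarrow> int (p ^ (n - lvl i)) dvd c i - d i" and c: "compatible c"
  shows "compatible d"
  unfolding compatible_def
proof (intro ballI impI)
  fix m i j assume m: "m \<in> {1..n}" and ij: "i \<in> I" "j \<in> I" and ne: "\<Gamma> i m \<inter> \<Gamma> j m \<noteq> {}"
  have cd: "int (p ^ m) dvd c l - d l" if "l \<in> I" "\<Gamma> l m \<noteq> {}" for l
    using Gam_level[OF that(2,1) m] le_imp_power_dvd[of m "n - lvl l" p] assms(1)[OF that(1)]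
    by (meson dvd_trans of_nat_dvd_iff)
  have "\<Gamma> i m \<noteq> {}" "\<Gamma> j m \<noteq> {}" using ne by blast+
  then have "int (p ^ m) dvd c i - d i" "int (p ^ m) dvd c j - d j" using cd[OF ij(1)] cd[OF ij(2)] by blast+
  moreover have "int (p ^ m) dvd c i - c j"
    by (rule c[unfolded compatible_def, rule_format, OF m ij ne])
  ultimately have "int (p ^ m) dvd (c i - c j) - (c i - d i) + (c j - d j)"
    by (intro dvd_add[OF dvd_diff])
  then show "int (p ^ m) dvd d i - d j" by (simp add: algebra_simps)
qed

lemma compatible_diff:
  assumes "compatible c" "compatible d" shows "compatible (\<lambda>i. c i - d i)"
  unfolding compatible_def
proof (intro ballI impI)
  fix m i j assume *: "m \<in> {1..n}" "i \<in> I" "j \<in> I" "\<Gamma> i m \<inter> \<Gamma> j m \<noteq> {}"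
  have "int (p ^ m) dvd (c i - c j) - (d i - d j)"
    by (rule dvd_diff[OF assms[unfolded compatible_def, rule_format, OF *]])
  then show "int (p ^ m) dvd c i - d i - (c j - d j)" by (simp add: algebra_simps)
qed

lemma compatible_const: "compatible (\<lambda>_. x)" by (simp add: compatible_def)

lemma compatible_add:
  assumes "compatible c" "compatible d" shows "compatible (\<lambda>i. c i + d i)"
  using compatible_diff[OF assms(1) compatible_diff[OF compatible_const[of 0] assms(2)]] by simp

text \<open>Elements of the product group are tuples of reduced integers; this is the canonical
  representative through which sums and inverses pass.\<close>

definition red :: "('i \<Rightarrow> int) \<Rightarrow> 'i \<Rightarrow> int"
  where "red c = (\<lambda>i\<in>I. c i mod int (p ^ (n - lvl i)))"

lemma red_in: "red c \<in> carrier (A n)"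
  unfolding carrier_A_n red_def using L.p_gt_0 by auto

lemma dvd_red: "i \<in> I \<Longrightarrow> int (p ^ (n - lvl i)) dvd c i - red c i"
  by (simp add: red_def minus_mod_eq_mult_div)

lemma red_in_C: assumes "compatible c" shows "red c \<in> carrier C"
  unfolding carrier_C using red_in compatible_cong[where d = "red c", OF dvd_red[where c = c] assms] by blast

lemma red_eqI:
  assumes "c \<in> carrier (A n)" "\<And>i. i \<in> I \<Longrightarrow> int (p ^ (n - lvl i)) dvd d i - c i"
  shows "c = red d"
proof
  fix i
  show "c i = red d i"
  proof (cases "i \<in> I")
    case True
    have "c i = c i mod int (p ^ (n - lvl i))" by (rule A_n_mod[OF assms(1) True, symmetric])
    also have "\<dots> = d i mod int (p ^ (n - lvl i))" using assms(2)[OF True] by (metis mod_eq_dvd_iff)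
    finally show ?thesis using True by (simp add: red_def)
  next
    case False
    then have "c i = undefined" using assms(1) unfolding carrier_A_n by (intro PiE_arb)
    then show ?thesis using False by (simp add: red_def)
  qed
qed

lemma group_A: "group (A n)"
  unfolding A_group_def by (intro product_group) simp

lemma mult_A: "c \<otimes>\<^bsub>A n\<^esub> d = red (\<lambda>i. c i + d i)"
  unfolding A_group_def red_def product_group_def
  by (simp add: mult_integer_mod_group A_exp_n cong: restrict_cong)

lemma inv_A: assumes "c \<in> carrier (A n)" shows "inv\<^bsub>A n\<^esub> c = red (\<lambda>i. - c i)"
proof -
  interpret group "A n" by (rule group_A)
  have one: "\<one>\<^bsub>A n\<^esub> = red (\<lambda>_. 0)" by (simp add: A_group_def red_def one_integer_mod_group)
  have "red (\<lambda>i. - c i) \<otimes>\<^bsub>A n\<^esub> c = \<one>\<^bsub>A n\<^esub>"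
    unfolding mult_A one red_def by (rule restrict_ext) (simp add: mod_simps)
  then show ?thesis using red_in assms by (intro inv_equality)
qed

lemma group_C: "group C"
proof -
  interpret group "A n" by (rule group_A)
  have "subgroup (carrier C) (A n)"
  proof (rule subgroupI)
    show "carrier C \<subseteq> carrier (A n)" by (rule subsetI) (simp only: carrier_C)
    show "carrier C \<noteq> {}" using red_in_C[OF compatible_const] by blast
    fix c assume c: "c \<in> carrier C"
    then have cc: "c \<in> carrier (A n)" "compatible c" using carrier_C by simp_all
    show "inv\<^bsub>A n\<^esub> c \<in> carrier C" unfolding inv_A[OF cc(1)]
      using red_in_C[OF compatible_diff[OF compatible_const[of 0] cc(2)]] by simp
    fix d assume "d \<in> carrier C"
    then have "compatible d" using carrier_C by simp
    then show "c \<otimes>\<^bsub>A n\<^esub> d \<in> carrier C" unfolding mult_A using red_in_C compatible_add cc(2) by simp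
  qed
  then have "group ((A n)\<lparr>carrier := carrier C\<rparr>)" by (rule subgroup_imp_group)
  moreover have "(A n)\<lparr>carrier := carrier C\<rparr> = C" by (simp add: C_L_def)
  ultimately show ?thesis by simp
qed

lemma mult_C: "c \<otimes>\<^bsub>C\<^esub> d = red (\<lambda>i. c i + d i)"
  using mult_A by (simp add: C_L_def)

text \<open>Global triviality asks all components to be congruent to one integer \<open>x\<close>; a
  reduced tuple with this property is the reduction of a constant.\<close>

lemma D_L_eq: "D_L k K p n I Ki = {c \<in> carrier C. CL.trivial_on (carrier G) (extend c)}"
proof -
  have D: "D_L k K p n I Ki = range (\<lambda>x. red (\<lambda>_. x))"
    unfolding D_L_def red_def by (rule image_cong) (simp_all add: e_exp_level cong: restrict_cong)
  show ?thesis unfolding D trivial_on_G_iff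
  proof (intro subset_antisym subsetI)
    fix c assume "c \<in> range (\<lambda>x. red (\<lambda>_. x))"
    then obtain x where c: "c = red (\<lambda>_. x)" by (rule rangeE)
    have "int (p ^ (n - lvl i)) dvd c i - x" if "i \<in> I" for i
      using dvd_red[OF that, of "\<lambda>_. x"] unfolding c by (simp add: dvd_diff_commute)
    then show "c \<in> {c \<in> carrier C. \<exists>x. \<forall>i\<in>I. int (p ^ (n - lvl i)) dvd c i - x}"
      using red_in_C[OF compatible_const] c by blast
  next
    fix c assume *: "c \<in> {c \<in> carrier C. \<exists>x. \<forall>i\<in>I. int (p ^ (n - lvl i)) dvd c i - x}"
    then obtain x where x: "\<forall>i\<in>I. int (p ^ (n - lvl i)) dvd c i - x" by blast
    have "c = red (\<lambda>_. x)"
      using * x carrier_C by (intro red_eqI) (auto simp only: dvd_diff_commute mem_Collect_eq)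
    then show "c \<in> range (\<lambda>x. red (\<lambda>_. x))" by blast
  qed
qed

lemma trivial_extendI:
  assumes "\<And>s. s \<in> T.embs \<Longrightarrow> u s = extend c s" "\<And>i. i \<in> I \<Longrightarrow> int (p ^ (n - lvl i)) dvd c i"
  shows "CL.trivial_on (carrier G) u"
proof -
  have "CL.trivial_on (carrier G) (extend c)" unfolding trivial_on_G_iff using assms(2) by (intro exI[of _ 0]) simp
  then show ?thesis using trivial_on_cong[of u "extend c"] assms(1) by blast
qed

text \<open>Each orbit on \<open>T.embs\<close> contains the inclusion of its factor, so an
  invariant function is known from its values there.\<close>

lemma invariant_eq_extend:
  assumes "CL.invariant u" "u (base None) = 0" "s \<in> T.embs"
  shows "u s = extend (\<lambda>i. u (base (Some i))) s"
proof -
  obtain j g where jg: "j \<in> J" "g \<in> carrier G" "s = T.star g (base j)" using embs_cases[OF assms(3)] .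
  have "u s = u (base j)" using assms(1) jg(2) base_in[OF jg(1)] unfolding jg(3) CL.invariant_def by blast
  then show ?thesis using assms(2) by (cases j) (simp_all add: jg(3))
qed

theorem Sha2_iso:
  "Sha2_cycl G (characters (length b) T) (character_action k \<K> T) \<cong> C Mod D_L k K p n I Ki"
proof -
  obtain g where g: "g \<in> carrier G" "int (p ^ n) dvd lam g - 1" using lam_surj[of 1] .
  show ?thesis unfolding D_L_eq
  proof (rule CL.Sha2_cycl_iso[OF g group_C])
    show "CL.invariant (extend c)" for c by (rule extend_invariant)
    show "extend c (base None) = 0" for c by simp
  next
    fix c h assume "c \<in> carrier C" "h \<in> carrier G"
    then show "CL.trivial_on (generate G {h}) (extend c)"
      using locally_trivial_iff_compatible[of c] carrier_C by blast
  next
    fix c d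
    show "CL.trivial_on (carrier G) (\<lambda>s. extend (c \<otimes>\<^bsub>C\<^esub> d) s - (extend c s + extend d s))"
    proof (rule trivial_extendI)
      show "extend (c \<otimes>\<^bsub>C\<^esub> d) s - (extend c s + extend d s) = extend (\<lambda>i. (c \<otimes>\<^bsub>C\<^esub> d) i - (c i + d i)) s" for s
        by (simp add: extend_def split: option.split)
      show "int (p ^ (n - lvl i)) dvd (c \<otimes>\<^bsub>C\<^esub> d) i - (c i + d i)" if "i \<in> I" for i
        using dvd_red[OF that, of "\<lambda>i. c i + d i"] unfolding mult_C by (simp add: dvd_diff_commute)
    qed
  next
    fix u assume u: "CL.invariant u" "u (base None) = 0"
      and loc: "\<And>g. g \<in> carrier G \<Longrightarrow> CL.trivial_on (generate G {g}) u"
    \<comment> \<open>The values \<open>d i\<close> are arbitrary integers; reducing them changes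
      \<open>u\<close> only by a globally trivial function.\<close>
    define d where "d = (\<lambda>i. u (base (Some i)))"
    have u_eq: "u s = extend d s" if "s \<in> T.embs" for s unfolding d_def by (rule invariant_eq_extend[OF u that])
    have "compatible d" using loc locally_trivial_iff_compatible trivial_on_cong[of u "extend d"] u_eq by blast
    then have "red d \<in> carrier C" by (rule red_in_C)
    moreover have "CL.trivial_on (carrier G) (\<lambda>s. u s - extend (red d) s)"
    proof (rule trivial_extendI)
      show "u s - extend (red d) s = extend (\<lambda>i. d i - red d i) s" if "s \<in> T.embs" for s
        unfolding u_eq[OF that] by (simp add: extend_def split: option.split)
    qed (rule dvd_red)
    ultimately show "\<exists>c\<in>carrier C. CL.trivial_on (carrier G) (\<lambda>s. u s - extend c s)" by blast
  qed
qed

end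

theorem theorem4p8:
  fixes k K \<K> :: "'a::field set" and Ki :: "'i \<Rightarrow> 'a set" and I :: "'i set"
    and p n :: nat and b :: "('i option \<Rightarrow> 'a) list"
  defines "J \<equiv> insert None (Some ` I)"
  defines "L \<equiv> (\<Pi>\<^sub>E j\<in>J. case_option K Ki j)"
  defines "T \<equiv> norm_one_torus k J b"
  assumes "is_separable_closure_of k"
    and "Factorial_Ring.prime p" and "n \<ge> 1"
    and "cyclic_extension k K (p ^ n)"
    and "finite I" and "\<And>i. i \<in> I \<Longrightarrow> finite_separable_extension k (Ki i)"
    and "finite_galois_extension k \<K>"
    and "K \<subseteq> \<K>" and "\<And>i. i \<in> I \<Longrightarrow> Ki i \<subseteq> \<K>"
    and "is_basis k J L b"
  shows "Sha2_cycl (Gal k \<K>) (characters (length b) T) (character_action k \<K> T)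
    \<cong> C_L k \<K> K p n I Ki Mod D_L k K p n I Ki"
proof -
  have "multinorm k \<K> K p n I Ki b"
    unfolding multinorm_def multinorm_axioms_def cyclic_tower_def cyclic_tower_axioms_def
      galois_extension_def galois_extension_axioms_def separable_closure_def
    using assms(4-) by (auto simp: J_def L_def finite_separable_extension_def finite_extension_def)
  then show ?thesis unfolding T_def J_def by (rule multinorm.Sha2_iso)
qed

end
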